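(* Let $\alpha>1/2$, consider a very simple family of trees with degree generating function $\Phi$, and let $X_n$ be the total cost of two-sided destruction of a random tree of size $n$ from this family with toll $t_n=n^\alpha$. Define $\sigma^2:=\tau^2\Phi''(\tau)/\Phi(\tau)$ ($\sigma>0$) and $\alpha':=\alpha+\frac12$. Then, as $n\to\infty$, $$\sigma^{-1}n^{-\alpha'}X_n \to X^{(\alpha)}\quad\text{in distribution},$$ with convergence of all moments, where $X^{(\alpha)}$ has the unique distribution whose $s$th moment $m_s\equiv m_s(\alpha)$ is given by $$m_1=\frac{\Gamma(\alpha-\frac12)}{\sqrt2\,\Gamma(\alpha)}$$ and, for $s\ge2$, by the recurrence $$m_s=\frac{1}{4\sqrt\pi}\sum_{k=1}^{s-1}\binom{s}{k}\frac{\Gamma(k\alpha'-\frac12)\,\Gamma((s-k)\alpha'-\frac12)}{\Gamma(s\alpha'-\frac12)}\,m_k m_{s-k}+\frac{s\,\Gamma(s\alpha'-1)}{\sqrt2\,\Gamma(s\alpha'-\frac12)}\,m_{s-1}.$$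
   Context: Very simple families. A simply generated family is given by a degree generating function $\Phi(t)=\sum_{k\ge0}\phi_kt^k$ with $\phi_k\ge0$, $\phi_0=1$: each ordered rooted tree $T$ has weight $w(T)=\prod_{v\in T}\phi_{d(v)}$ ($d(v)$ = outdegree of $v$), $T_n$ is the total weight of the trees with $n$ nodes, and a random tree of size $n$ equals $T$ with probability $w(T)/T_n$. The generating function $T(z)=\sum_{n\ge1}T_nz^n$ satisfies $T(z)=z\Phi(T(z))$. Put $\alpha_i:=\phi_{i+1}/\phi_i$ for $i=0,1$. The family is very simple if $\alpha_0>0$ and $\Phi$ is one of the following; each type has associated constants $a_1,a_0$: (A) $\Phi(t)=e^{\alpha_0t}$, with $a_1=\alpha_0$, $a_0=0$; (B) $\Phi(t)=(1+\alpha_0t/d)^d$ with an integer $d\ge2$, with $a_1=\alpha_0\frac{d-1}{d}$, $a_0=\frac{\alpha_0}{d}$; (C) $\Phi(t)=[1-(2\alpha_1-\alpha_0)t]^{-\alpha_0/(2\alpha_1-\alpha_0)}$ with $2\alpha_1-\alpha_0>0$, with $a_1=2\alpha_1$, $a_0=-(2\alpha_1-\alpha_0)$. Let $\tau$ be the unique root of $t\Phi'(t)=\Phi(t)$ in $0<t<R$, where $R$ is the radius of convergence of $\Phi$. Two-sided destruction. From a random tree of size $n\ge2$ of the family, a uniformly random edge is cut at cost $t_n$, giving two rooted trees (the one not containing the original root is rooted at its endpoint of the cut edge); the process continues recursively on both trees. For very simple families, conditionally on their sizes the two trees are independent random trees of the same family, and the size $K_n$ of the tree containing the root satisfies $$\Pr[K_n=k]=p_{n,k}=(a_1k+a_0)\frac{T_kT_{n-k}}{(n-1)T_n},\qquad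 1\le k\le n-1.$$ The total cost $X_n$ has the law determined by $X_1=t_1$ and, for $n\ge2$, $X_n\overset{d}{=}X_{K_n}+X^*_{n-K_n}+t_n$, where $(X_j)_{j\ge1}$ and $(X_j^* )_{j\ge1}$ are independent copies of each other and are independent of $K_n$. *)

theory Defs
  imports "HOL-Probability.Probability"
begin

subsection \<open>Simply generated families\<close>

datatype ordered_tree = Node "ordered_tree list"

primrec num_nodes :: "ordered_tree \<Rightarrow> nat" where
  "num_nodes (Node ts) = Suc (sum_list (map num_nodes ts))"

primrec tree_weight :: "real fps \<Rightarrow> ordered_tree \<Rightarrow> real" where
  "tree_weight \<Phi> (Node ts) = fps_nth \<Phi> (length ts) * prod_list (map (tree_weight \<Phi>) ts)"

definition total_weight :: "real fps \<Rightarrow> nat \<Rightarrow> real" where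
  "total_weight \<Phi> n = (\<Sum>t | num_nodes t = n. tree_weight \<Phi> t)"

definition random_tree :: "real fps \<Rightarrow> nat \<Rightarrow> ordered_tree pmf" where
  "random_tree \<Phi> n =
     embed_pmf (\<lambda>t. if num_nodes t = n then tree_weight \<Phi> t / total_weight \<Phi> n else 0)"

definition coeff_ratio :: "real fps \<Rightarrow> nat \<Rightarrow> real" where
  "coeff_ratio \<Phi> i = fps_nth \<Phi> (Suc i) / fps_nth \<Phi> i"

text \<open>
  In type C, \<open>fps_binomial r\<close> is the series \<open>(1 + t) ^ r\<close>, so that the composition below is
  \<open>(1 - c * t) ^ (- \<alpha>\<^sub>0 / c)\<close> with \<open>c = 2 * \<alpha>\<^sub>1 - \<alpha>\<^sub>0\<close>.
\<close>

definition very_simple_A :: "real fps \<Rightarrow> bool" where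
  "very_simple_A \<Phi> \<longleftrightarrow> \<Phi> = fps_exp (coeff_ratio \<Phi> 0)"

definition very_simple_B :: "real fps \<Rightarrow> bool" where
  "very_simple_B \<Phi> \<longleftrightarrow>
     (\<exists>d::nat. d \<ge> 2 \<and> \<Phi> = (1 + fps_const (coeff_ratio \<Phi> 0 / real d) * fps_X) ^ d)"

definition very_simple_C :: "real fps \<Rightarrow> bool" where
  "very_simple_C \<Phi> \<longleftrightarrow>
     (let c = 2 * coeff_ratio \<Phi> 1 - coeff_ratio \<Phi> 0
      in c > 0 \<and> \<Phi> = fps_binomial (- coeff_ratio \<Phi> 0 / c) oo (- (fps_const c * fps_X)))"

definition very_simple :: "real fps \<Rightarrow> bool" where
  "very_simple \<Phi> \<longleftrightarrow>
     fps_nth \<Phi> 0 = 1 \<and> (\<forall>k. fps_nth \<Phi> k \<ge> 0) \<and> coeff_ratio \<Phi> 0 > 0 \<and>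
     (very_simple_A \<Phi> \<or> very_simple_B \<Phi> \<or> very_simple_C \<Phi>)"

definition char_tau :: "real fps \<Rightarrow> real" where
  "char_tau \<Phi> = (THE t. 0 < t \<and> ereal t < fps_conv_radius \<Phi> \<and>
                         t * eval_fps (fps_deriv \<Phi>) t = eval_fps \<Phi> t)"

definition char_sigma :: "real fps \<Rightarrow> real" where
  "char_sigma \<Phi> =
     sqrt ((char_tau \<Phi>)\<^sup>2 * eval_fps (fps_deriv (fps_deriv \<Phi>)) (char_tau \<Phi>) /
           eval_fps \<Phi> (char_tau \<Phi>))"

subsection \<open>Two-sided destruction\<close>

text \<open>
  A node is addressed by the path of child indices leading to it from the root; an edge is
  identified with its endpoint farther from the root, i.e. with the address of a non-root node.
\<close>

fun is_node :: "ordered_tree \<Rightarrow> nat list \<Rightarrow> bool" where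
  "is_node t [] \<longleftrightarrow> True"
| "is_node (Node ts) (i # p) \<longleftrightarrow> i < length ts \<and> is_node (ts ! i) p"

definition edges :: "ordered_tree \<Rightarrow> nat list set" where
  "edges t = {p. p \<noteq> [] \<and> is_node t p}"

fun cut_branch :: "ordered_tree \<Rightarrow> nat list \<Rightarrow> ordered_tree" where
  "cut_branch t [] = t"
| "cut_branch (Node ts) (i # p) = cut_branch (ts ! i) p"

text \<open>The value on the empty path, which is not an edge, is irrelevant.\<close>

fun cut_trunk :: "ordered_tree \<Rightarrow> nat list \<Rightarrow> ordered_tree" where
  "cut_trunk t [] = t"
| "cut_trunk (Node ts) [i] = Node (take i ts @ drop (Suc i) ts)"
| "cut_trunk (Node ts) (i # j # p) = Node (ts[i := cut_trunk (ts ! i) (j # p)])"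

lemma num_nodes_pos [simp]: "0 < num_nodes t"
  by (cases t) simp

lemma num_nodes_nth:
  assumes "i < length ts"
  shows "sum_list (map num_nodes ts) =
    num_nodes (ts ! i) + sum_list (map num_nodes (take i ts @ drop (Suc i) ts))"
  by (subst id_take_nth_drop[OF assms]) simp

lemma num_nodes_cut:
  assumes "p \<in> edges t"
  shows "num_nodes (cut_trunk t p) + num_nodes (cut_branch t p) = num_nodes t"
proof -
  have "p \<noteq> [] \<Longrightarrow> is_node t p \<Longrightarrow> ?thesis"
  proof (induction t p rule: cut_trunk.induct)
    case (1 t)
    then show ?case by simp
  next
    case (2 ts i)
    then show ?case by (simp add: num_nodes_nth)
  next
    case (3 ts i j p)
    let ?u = "cut_trunk (ts ! i) (j # p)"
    have i: "i < length ts" and n: "is_node (ts ! i) (j # p)" using 3 by auto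
    have "sum_list (map num_nodes (ts[i := ?u])) =
      num_nodes ?u + sum_list (map num_nodes (take i ts @ drop (Suc i) ts))"
      using num_nodes_nth[of i "ts[i := ?u]"] i by simp
    moreover have "num_nodes ?u + num_nodes (cut_branch (ts ! i) (j # p)) = num_nodes (ts ! i)"
      using 3 n by simp
    ultimately show ?case using num_nodes_nth[OF i] by simp
  qed
  with assms show ?thesis by (simp add: edges_def)
qed

lemma edges_Node:
  "edges (Node ts) = (\<Union>i<length ts. (#) i ` insert [] (edges (ts ! i)))"
proof -
  have "p \<in> edges (Node ts) \<longleftrightarrow> p \<in> (\<Union>i<length ts. (#) i ` insert [] (edges (ts ! i)))" for p
    by (cases p) (auto simp: edges_def)
  then show ?thesis by blast
qed

lemma finite_edges [simp]: "finite (edges t)"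
  by (induction t) (simp add: edges_Node)

lemma edges_nonempty:
  assumes "num_nodes t \<ge> 2"
  shows "edges t \<noteq> {}"
proof -
  obtain ts where t: "t = Node ts" by (cases t)
  with assms have "ts \<noteq> []" by auto
  then have "[0] \<in> edges t" by (simp add: t edges_def)
  then show ?thesis by blast
qed

function destruction_cost :: "(nat \<Rightarrow> real) \<Rightarrow> ordered_tree \<Rightarrow> real pmf" where
  "destruction_cost toll t =
     (if num_nodes t < 2 then return_pmf (toll 1)
      else bind_pmf (pmf_of_set (edges t)) (\<lambda>e.
             bind_pmf (destruction_cost toll (cut_trunk t e)) (\<lambda>x.
             bind_pmf (destruction_cost toll (cut_branch t e)) (\<lambda>y.
               return_pmf (x + y + toll (num_nodes t))))))"
  by pat_completeness auto
termination
proof (relation "Wellfounded.measure (\<lambda>(toll, t). num_nodes t)", goal_cases)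
  case 1
  show ?case by simp
next
  case (2 toll t e)
  then have "e \<in> edges t" by (simp add: edges_nonempty)
  from num_nodes_cut[OF this] show ?case
    using num_nodes_pos[of "cut_trunk t e"] num_nodes_pos[of "cut_branch t e"] by (simp del: num_nodes_pos)
next
  case (3 toll t e x)
  then have "e \<in> edges t" by (simp add: edges_nonempty)
  from num_nodes_cut[OF this] show ?case
    using num_nodes_pos[of "cut_trunk t e"] num_nodes_pos[of "cut_branch t e"] by (simp del: num_nodes_pos)
qed

declare destruction_cost.simps [simp del]

definition total_cost :: "real fps \<Rightarrow> (nat \<Rightarrow> real) \<Rightarrow> nat \<Rightarrow> real pmf" where
  "total_cost \<Phi> toll n = bind_pmf (random_tree \<Phi> n) (destruction_cost toll)"

subsection \<open>The random tree is well defined\<close>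

lemma finite_num_nodes: "finite {t. num_nodes t = n}"
proof (induction n rule: less_induct)
  case (less n)
  let ?A = "\<Union>m<n. {t. num_nodes t = m}"
  have "finite ?A" using less by blast
  then have "finite {ts. set ts \<subseteq> ?A \<and> length ts \<le> n}"
    by (rule finite_lists_length_le)
  moreover have "{t. num_nodes t = n} \<subseteq> Node ` {ts. set ts \<subseteq> ?A \<and> length ts \<le> n}"
  proof
    fix t assume "t \<in> {t. num_nodes t = n}"
    then obtain ts where t: "t = Node ts" and n: "n = Suc (sum_list (map num_nodes ts))"
      by (cases t) auto
    have "num_nodes u < n" if "u \<in> set ts" for u
      using member_le_sum_list[of "num_nodes u" "map num_nodes ts"] that n by simp
    moreover have "length ts \<le> sum_list (map num_nodes ts)"
    proof (induction ts)
      case (Cons u us)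
      then show ?case using num_nodes_pos[of u] by (simp del: num_nodes_pos)
    qed simp
    ultimately show "t \<in> Node ` {ts. set ts \<subseteq> ?A \<and> length ts \<le> n}"
      using t n by auto
  qed
  ultimately show ?case by (rule finite_surj)
qed

lemma tree_weight_nonneg:
  assumes "\<And>k. fps_nth \<Phi> k \<ge> 0"
  shows "tree_weight \<Phi> t \<ge> 0"
proof (induction t)
  case (Node ts)
  then have "prod_list (map (tree_weight \<Phi>) ts) \<ge> 0"
    by (induction ts) auto
  then show ?case using assms by simp
qed

lemma total_weight_pos:
  assumes "very_simple \<Phi>" and "n \<ge> 1"
  shows "total_weight \<Phi> n > 0"
proof -
  have nn: "\<And>k. fps_nth \<Phi> k \<ge> 0" and p0: "fps_nth \<Phi> 0 = 1" and p1: "fps_nth \<Phi> 1 > 0"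
    using assms(1) by (auto simp: very_simple_def coeff_ratio_def)
  have "\<exists>t. num_nodes t = Suc m \<and> tree_weight \<Phi> t > 0" for m
  proof (induction m)
    case 0
    show ?case using p0 by (intro exI[of _ "Node []"]) simp
  next
    case (Suc m)
    then obtain t where "num_nodes t = Suc m" "tree_weight \<Phi> t > 0" by blast
    then show ?case using p1 by (intro exI[of _ "Node [t]"]) simp
  qed
  then obtain t where "num_nodes t = n" "tree_weight \<Phi> t > 0"
    using assms(2) by (metis Suc_pred' less_eq_Suc_le One_nat_def)
  then show ?thesis
    unfolding total_weight_def
    by (intro sum_pos2[where i = t]) (auto simp: finite_num_nodes tree_weight_nonneg[OF nn])
qed

lemma pmf_random_tree:
  assumes "very_simple \<Phi>" and "n \<ge> 1"
  shows "pmf (random_tree \<Phi> n) t =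
    (if num_nodes t = n then tree_weight \<Phi> t / total_weight \<Phi> n else 0)"
proof -
  let ?f = "\<lambda>t. if num_nodes t = n then tree_weight \<Phi> t / total_weight \<Phi> n else 0"
  have pos: "total_weight \<Phi> n > 0" using assms by (rule total_weight_pos)
  have nn: "?f t \<ge> 0" for t
    using assms(1) pos by (auto simp: very_simple_def intro!: divide_nonneg_pos tree_weight_nonneg)
  have "(\<integral>\<^sup>+t. ennreal (?f t) \<partial>count_space UNIV) =
      (\<Sum>t | num_nodes t = n. ennreal (?f t))"
    by (rule nn_integral_count_space') (auto simp: finite_num_nodes)
  also have "\<dots> = ennreal (\<Sum>t | num_nodes t = n. ?f t)"
    by (rule sum_ennreal) (rule nn)
  also have "(\<Sum>t | num_nodes t = n. ?f t) = 1"
    using pos by (simp add: total_weight_def sum_divide_distrib[symmetric])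
  finally show ?thesis
    unfolding random_tree_def by (intro pmf_embed_pmf nn) (simp only: ennreal_1)
qed

subsection \<open>Normalization and the limit distribution\<close>

definition normalized_cost :: "real fps \<Rightarrow> real \<Rightarrow> nat \<Rightarrow> real pmf" where
  "normalized_cost \<Phi> \<alpha> n =
     map_pmf (\<lambda>x. inverse (char_sigma \<Phi>) * real n powr (- (\<alpha> + 1 / 2)) * x)
       (total_cost \<Phi> (\<lambda>j. real j powr \<alpha>) n)"

text \<open>
  Here \<open>\<alpha>' = \<alpha> + 1/2\<close>; the value 1 at \<open>s = 0\<close> is the zeroth moment and is not used by the
  recurrence.
\<close>

function limit_moment :: "real \<Rightarrow> nat \<Rightarrow> real" where
  "limit_moment \<alpha> s =
     (let \<alpha>' = \<alpha> + 1 / 2 in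
      if s = 0 then 1
      else if s = 1 then Gamma (\<alpha> - 1 / 2) / (sqrt 2 * Gamma \<alpha>)
      else 1 / (4 * sqrt pi) *
             (\<Sum>k = 1..s - 1. real (s choose k) *
                (Gamma (real k * \<alpha>' - 1 / 2) * Gamma (real (s - k) * \<alpha>' - 1 / 2) /
                 Gamma (real s * \<alpha>' - 1 / 2)) *
                limit_moment \<alpha> k * limit_moment \<alpha> (s - k)) +
           real s * Gamma (real s * \<alpha>' - 1) / (sqrt 2 * Gamma (real s * \<alpha>' - 1 / 2)) *
             limit_moment \<alpha> (s - 1))"
  by pat_completeness auto
termination
  by (relation "Wellfounded.measure snd") auto

declare limit_moment.simps [simp del]

definition has_limit_moments :: "real \<Rightarrow> real measure \<Rightarrow> bool" where
  "has_limit_moments \<alpha> M \<longleftrightarrow>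
     real_distribution M \<and>
     (\<forall>s\<ge>1. integrable M (\<lambda>x. x ^ s) \<and> (LINT x|M. x ^ s) = limit_moment \<alpha> s)"

end

theory Submission
  imports Defs "HOL-Real_Asymp.Real_Asymp"
begin

text \<open>
  The degree generating function enters only through two constants: in each of the three types there
  are \<open>b > 0\<close> and \<open>g\<close> with \<open>b + g > 0\<close> and
  \<open>(k + 1) * \<phi>\<^sub>k\<^sub>+\<^sub>1 = (b + g * k) * \<phi>\<^sub>k\<close>; in terms of the usual constants, \<open>b + g = a\<^sub>1\<close> and \<open>g = - a\<^sub>0\<close>.

  \<^emph>\<open>From trees to a recurrence.\<close> The trees obtained by attaching a tree \<open>v\<close> at all possible places of
  a tree \<open>u\<close> have total weight \<open>w(u) * w(v) * (b * |u| + g * (|u| - 1))\<close> (\<open>grafts_weight\<close>). This is the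
  splitting law of the destruction process, and it turns into a quadratic recurrence for
  \<open>M\<^sub>s(n) = T\<^sub>n * E(X\<^sub>n ^ s)\<close> (\<open>moment_fps_recurrence\<close>). For \<open>s = 0\<close> it is a recurrence for \<open>T\<^sub>n\<close> alone. Lagrange
  inversion solves it, \<open>T\<^sub>n = (\<Prod>j<n-1. n * b + g * j) / n!\<close> (\<open>total_weight_eq\<close>), and Stirling's
  formula together with the trapezoidal rule gives \<open>U\<^sub>n = T\<^sub>n * \<rho> ^ n \<sim> c * n powr (- 3/2)\<close> with an explicit
  \<open>c\<close> (\<open>total_weight_asymp\<close>).

  \<^emph>\<open>Transfer.\<close> For \<open>s \<ge> 1\<close> the sequence \<open>G\<^sub>n = M\<^sub>s(n) * \<rho> ^ n\<close> satisfies a linear equation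
  \<open>(n - 1) * G\<^sub>n = ((b + g) * n - 2 * g) * (G * U)\<^sub>n + R\<^sub>n\<close> in which \<open>R\<close> is built from lower moments. For every power
  series \<open>h\<close> the series \<open>XD(U) * h\<close> is an exact solution with right-hand side
  \<open>XD(h) * (U - g * U\<^sup>2)\<close>, where \<open>XD\<close> is \<open>z * d/dz\<close> (\<open>solves_model\<close>). Taking \<open>h = (1 - z) powr (- p)\<close> yields a solution with
  \<open>R\<^sub>n\<close> of order \<open>n powr p\<close> and \<open>G\<^sub>n\<close> of order \<open>n powr (p - 1/2)\<close>. As the kernel is nonnegative and \<open>n * U\<^sub>n\<close> solves the homogeneous
  equation, an induction on \<open>n\<close> compares any other solution with this one (\<open>transfer_negligible\<close>), which
  determines the leading term for every \<open>R\<^sub>n \<sim> l * n powr p\<close> with \<open>p > 0\<close> (\<open>transfer\<close>). Products of series with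
  power-law coefficients are also compared with powers of \<open>1 - z\<close>, whose products are exact. An
  induction on \<open>s\<close> then gives \<open>E(X\<^sub>n ^ s) \<sim> \<sigma> ^ s * m\<^sub>s * n powr (s * \<alpha>')\<close>, and the recurrence for
  \<open>m\<^sub>s\<close> is the bookkeeping of the constants (\<open>moment_rec\<close>).

  \<^emph>\<open>The limit law.\<close> After multiplication by \<open>\<Gamma>(s * \<alpha>' - 1/2) / s!\<close> the recurrence for \<open>m\<^sub>s\<close> resembles the one for the
  Catalan numbers, and it follows that \<open>\<Sum> m\<^sub>s * t ^ s / s!\<close> converges for every \<open>t\<close>
  (\<open>limit_moment_summable\<close>). The characteristic functions of the normalized costs therefore converge
  everywhere to \<open>\<Sum> m\<^sub>s * (\<i> * t) ^ s / s!\<close>. This function determines the limit law, and tightness provides it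
  (\<open>method_of_moments\<close>).
\<close>

section \<open>Power-law asymptotics of coefficients\<close>

text \<open>
  The coefficients are asymptotic to \<open>A * n powr p\<close>; for \<open>A = 0\<close> this means that they are of smaller
  order than \<open>n powr p\<close>.
\<close>

definition coeff_asymp :: "real fps \<Rightarrow> real \<Rightarrow> real \<Rightarrow> bool" where
  "coeff_asymp f p A \<longleftrightarrow> (\<lambda>n. fps_nth f n * real n powr (- p)) \<longlonglongrightarrow> A"

lemma fps_nth_XD [simp]: "fps_nth (fps_XD f) n = of_nat n * fps_nth f n"
  by (simp add: fps_XD_def fps_mult_fps_X_deriv_shift)

lemma coeff_asymp_add:
  "coeff_asymp f p A \<Longrightarrow> coeff_asymp g p B \<Longrightarrow> coeff_asymp (f + g) p (A + B)"
  unfolding coeff_asymp_def by (drule (1) tendsto_add) (simp add: algebra_simps)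

lemma coeff_asymp_cmult:
  "coeff_asymp f p A \<Longrightarrow> coeff_asymp (fps_const c * f) p (c * A)"
  unfolding coeff_asymp_def by (drule tendsto_mult_left[of _ _ _ c]) (simp add: algebra_simps)

lemma coeff_asymp_unique: "coeff_asymp f p A \<Longrightarrow> coeff_asymp f p B \<Longrightarrow> A = B"
  unfolding coeff_asymp_def by (rule LIMSEQ_unique)

lemma coeff_asymp_diff:
  "coeff_asymp f p A \<Longrightarrow> coeff_asymp g p B \<Longrightarrow> coeff_asymp (f - g) p (A - B)"
  unfolding coeff_asymp_def by (drule (1) tendsto_diff) (simp add: algebra_simps)

lemma coeff_asymp_sum:
  assumes "\<And>j. j \<in> A \<Longrightarrow> coeff_asymp (f j) p (a j)"
  shows "coeff_asymp (\<Sum>j\<in>A. f j) p (\<Sum>j\<in>A. a j)"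
  using tendsto_sum[of A "\<lambda>j n. fps_nth (f j) n * real n powr (- p)" a] assms
  by (simp add: coeff_asymp_def fps_sum_nth sum_distrib_right)

lemma coeff_asymp_XD_iff: "coeff_asymp (fps_XD f) (p + 1) A \<longleftrightarrow> coeff_asymp f p A"
proof -
  have "eventually (\<lambda>n. fps_nth (fps_XD f) n * real n powr (- (p + 1)) =
      fps_nth f n * real n powr (- p)) sequentially"
    using eventually_gt_at_top[of 0]
  proof eventually_elim
    case (elim n)
    have "real n powr (- p) = real n powr 1 * real n powr (- (p + 1))"
      unfolding powr_add[symmetric] by simp
    then show ?case using elim by simp
  qed
  then show ?thesis unfolding coeff_asymp_def by (rule tendsto_cong)
qed

lemmas coeff_asymp_XD = coeff_asymp_XD_iff[THEN iffD2]

lemma coeff_asymp_negligible: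
  assumes "coeff_asymp f p A" "p < q"
  shows "coeff_asymp f q 0"
proof -
  have "(\<lambda>n. real n powr (- (q - p))) \<longlonglongrightarrow> 0"
    using assms(2) by real_asymp
  with assms(1) have "(\<lambda>n. fps_nth f n * real n powr (- p) * real n powr (- (q - p))) \<longlonglongrightarrow> A * 0"
    unfolding coeff_asymp_def by (rule tendsto_mult)
  then show ?thesis by (simp add: coeff_asymp_def mult.assoc flip: powr_add)
qed

lemma coeff_asymp_bounded:
  assumes "coeff_asymp f p A" "fps_nth f 0 = 0"
  obtains C where "C > 0" "\<And>n. \<bar>fps_nth f n\<bar> \<le> C * real n powr p"
proof -
  have "Bseq (\<lambda>n. fps_nth f n * real n powr (- p))"
    using assms(1) unfolding coeff_asymp_def by (intro convergent_imp_Bseq convergentI)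
  then obtain C where C: "C > 0" "\<And>n. norm (fps_nth f n * real n powr (- p)) \<le> C"
    by (auto elim: BseqE)
  have "\<bar>fps_nth f n\<bar> \<le> C * real n powr p" for n
    using C(2)[of n] assms(2) by (cases "n = 0") (auto simp: abs_mult powr_minus field_simps)
  with C(1) show ?thesis by (rule that)
qed

section \<open>Products of series with power-law coefficients\<close>

text \<open>
  These are the expansions of \<open>(1 - z) powr (- P)\<close>. Their products are known exactly, which makes them the
  yardstick for products of other series.
\<close>

definition model_fps :: "real \<Rightarrow> real fps" where
  "model_fps P = Abs_fps (\<lambda>n. pochhammer P n / fact n)"

lemma model_fps_nth: "fps_nth (model_fps P) n = pochhammer P n / fact n"
  by (simp add: model_fps_def)

lemma model_fps_mult: "model_fps P * model_fps Q = model_fps (P + Q)"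
proof (rule fps_ext)
  fix n
  have "fps_nth (model_fps P * model_fps Q) n =
      (\<Sum>k\<le>n. real (n choose k) * pochhammer P k * pochhammer Q (n - k) / fact n)"
    by (auto simp: fps_mult_nth model_fps_nth binomial_fact field_simps atLeast0AtMost intro!: sum.cong)
  also have "\<dots> = pochhammer (P + Q) n / fact n"
    by (simp add: pochhammer_binomial_sum sum_divide_distrib)
  finally show "fps_nth (model_fps P * model_fps Q) n = fps_nth (model_fps (P + Q)) n"
    by (simp add: model_fps_nth)
qed

lemma model_fps_pos: "P > 0 \<Longrightarrow> fps_nth (model_fps P) n > 0"
  by (simp add: model_fps_nth pochhammer_pos)

text \<open>
  This is Gauss's product for the reciprocal of the Gamma function.
\<close>

lemma coeff_asymp_model:
  fixes P :: real
  shows "coeff_asymp (model_fps P) (P - 1) (rGamma P)"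
proof -
  have "(\<lambda>n. rGamma_series P n * (real n / (real n + P))) \<longlonglongrightarrow> rGamma P * 1"
    by (intro tendsto_mult rGamma_series_LIMSEQ) real_asymp
  moreover have "eventually (\<lambda>n. rGamma_series P n * (real n / (real n + P)) =
      fps_nth (model_fps P) n * real n powr (- (P - 1))) sequentially"
    using eventually_gt_at_top[of "nat \<lceil>\<bar>P\<bar>\<rceil>"]
  proof eventually_elim
    case (elim n)
    then have n: "real n > \<bar>P\<bar>" by linarith
    have "real n powr (1 - P) = real n / real n powr P"
      using n by (simp add: powr_diff)
    moreover have "rGamma_series P n = pochhammer P n * (real n + P) / (fact n * real n powr P)"
      using n by (simp add: rGamma_series_def pochhammer_Suc powr_def mult_ac add_ac)
    ultimately show ?case using n by (simp add: model_fps_nth)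
  qed
  ultimately show ?thesis unfolding coeff_asymp_def
    by (simp add: tendsto_cong)
qed

lemma coeff_asymp_shift:
  assumes "coeff_asymp f p A"
  shows "(\<lambda>n. fps_nth f (n - k) * real n powr (- p)) \<longlonglongrightarrow> A"
proof -
  have "(\<lambda>n. (real (n + k) / real n) powr (- p)) \<longlonglongrightarrow> 1" by real_asymp
  with assms have "(\<lambda>n. fps_nth f n * real n powr (- p) * (real (n + k) / real n) powr (- p)) \<longlonglongrightarrow> A * 1"
    unfolding coeff_asymp_def by (rule tendsto_mult)
  moreover have "eventually (\<lambda>n. fps_nth f n * real n powr (- p) * (real (n + k) / real n) powr (- p)
      = fps_nth f n * real (n + k) powr (- p)) sequentially"
    using eventually_gt_at_top[of 0]
    by eventually_elim (simp add: powr_divide)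
  ultimately have "(\<lambda>n. fps_nth f n * real (n + k) powr (- p)) \<longlonglongrightarrow> A * 1"
    by (rule Lim_transform_eventually)
  then have "(\<lambda>n. fps_nth f (n + k - k) * real (n + k) powr (- p)) \<longlonglongrightarrow> A" by simp
  then show ?thesis by (rule LIMSEQ_offset)
qed

lemma model_ratio_iff:
  assumes "P > 0"
  shows "coeff_asymp f (P - 1) A \<longleftrightarrow>
    (\<lambda>n. fps_nth f n / fps_nth (model_fps P) n) \<longlonglongrightarrow> A * Gamma P"
proof -
  let ?e = "fps_nth (model_fps P)"
  have r: "rGamma P \<noteq> 0" "rGamma P = inverse (Gamma P)" "Gamma P \<noteq> 0"
    using Gamma_real_pos[OF assms] by (simp_all add: rGamma_inverse_Gamma)
  have e: "(\<lambda>n. ?e n * real n powr (- (P - 1))) \<longlonglongrightarrow> rGamma P"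
    using coeff_asymp_model[of P] by (simp only: coeff_asymp_def)
  have nz: "?e n \<noteq> 0" for n using model_fps_pos[OF assms, of n] by simp
  have ev: "eventually (\<lambda>n. real n powr (- (P - 1)) \<noteq> 0) sequentially"
    using eventually_gt_at_top[of 0] by eventually_elim simp
  show ?thesis
  proof
    assume "coeff_asymp f (P - 1) A"
    then have "(\<lambda>n. fps_nth f n * real n powr (- (P - 1)) / (?e n * real n powr (- (P - 1))))
        \<longlonglongrightarrow> A / rGamma P"
      unfolding coeff_asymp_def by (intro tendsto_divide e r)
    moreover have "eventually (\<lambda>n. fps_nth f n * real n powr (- (P - 1)) / (?e n * real n powr (- (P - 1)))
        = fps_nth f n / ?e n) sequentially"
      using ev by eventually_elim simp
    ultimately show "(\<lambda>n. fps_nth f n / ?e n) \<longlonglongrightarrow> A * Gamma P"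
      using r by (simp add: tendsto_cong field_simps)
  next
    assume "(\<lambda>n. fps_nth f n / ?e n) \<longlonglongrightarrow> A * Gamma P"
    then have "(\<lambda>n. fps_nth f n / ?e n * (?e n * real n powr (- (P - 1)))) \<longlonglongrightarrow> A * Gamma P * rGamma P"
      by (intro tendsto_mult e)
    moreover have "A * Gamma P * rGamma P = A" using r by simp
    moreover have "fps_nth f n / ?e n * (?e n * real n powr (- (P - 1))) = fps_nth f n * real n powr (- (P - 1))" for n
      using nz[of n] by simp
    ultimately show "coeff_asymp f (P - 1) A" by (simp only: coeff_asymp_def)
  qed
qed

text \<open>
  Up to a small multiple of the model coefficients, only finitely many coefficients of \<open>g\<close> remain. Against
  the factor \<open>f\<close>, each of these contributes a term of order \<open>n powr (P - 1)\<close>, and \<open>Q > 0\<close>.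
\<close>

lemma conv_negligible:
  assumes P: "P > 0" and Q: "Q > 0"
    and f: "\<And>n. \<bar>fps_nth f n\<bar> \<le> C * fps_nth (model_fps P) n"
    and g: "(\<lambda>n. fps_nth g n / fps_nth (model_fps Q) n) \<longlonglongrightarrow> 0"
  shows "(\<lambda>n. fps_nth (g * f) n / fps_nth (model_fps (P + Q)) n) \<longlonglongrightarrow> 0"
proof (rule LIMSEQ_I)
  fix \<epsilon> :: real assume \<epsilon>: "\<epsilon> > 0"
  let ?eP = "fps_nth (model_fps P)" and ?eQ = "fps_nth (model_fps Q)"
    and ?eR = "fps_nth (model_fps (P + Q))"
  have pP: "?eP n > 0" and pQ: "?eQ n > 0" and pR: "?eR n > 0" for n
    using model_fps_pos P Q by (simp_all)
  have C: "C \<ge> 0" using f[of 0] by (simp add: model_fps_nth)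
  define \<delta> where "\<delta> = \<epsilon> / (2 * (C + 1))"
  have \<delta>: "\<delta> > 0" using \<epsilon> C by (simp add: \<delta>_def)
  obtain N where N: "\<And>n. n \<ge> N \<Longrightarrow> \<bar>fps_nth g n / ?eQ n\<bar> < \<delta>"
    using LIMSEQ_D[OF g \<delta>] by auto
  define h where "h i = (if i < N then \<bar>fps_nth g i\<bar> else 0)" for i
  have gh: "\<bar>fps_nth g i\<bar> \<le> \<delta> * ?eQ i + h i" for i
    using N[of i] pQ[of i] \<delta> by (cases "i < N") (auto simp: h_def field_simps)
  have bound: "\<bar>fps_nth (g * f) n\<bar> \<le> C * \<delta> * ?eR n + C * (\<Sum>i<N. h i * ?eP (n - i))"
    if n: "n \<ge> N" for n
  proof -
    have "\<bar>fps_nth (g * f) n\<bar> \<le> (\<Sum>i=0..n. \<bar>fps_nth g i * fps_nth f (n - i)\<bar>)"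
      unfolding fps_mult_nth by (rule sum_abs)
    also have "\<dots> \<le> (\<Sum>i=0..n. (\<delta> * ?eQ i + h i) * (C * ?eP (n - i)))"
      unfolding abs_mult by (intro sum_mono mult_mono gh f order_trans[OF abs_ge_zero gh]) auto
    also have "\<dots> = C * \<delta> * (\<Sum>i=0..n. ?eQ i * ?eP (n - i)) + C * (\<Sum>i=0..n. h i * ?eP (n - i))"
      by (simp only: distrib_right sum.distrib sum_distrib_left) (simp add: mult_ac)
    also have "(\<Sum>i=0..n. ?eQ i * ?eP (n - i)) = ?eR n"
      using model_fps_mult[of Q P] by (simp add: fps_mult_nth[symmetric] add.commute)
    also have "(\<Sum>i=0..n. h i * ?eP (n - i)) = (\<Sum>i<N. h i * ?eP (n - i))"
      using n by (intro sum.mono_neutral_right) (auto simp: h_def)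
    finally show ?thesis .
  qed
  have lim: "(\<lambda>n. C * (\<Sum>i<N. h i * (?eP (n - i) / ?eR n))) \<longlonglongrightarrow> C * (\<Sum>i<N. h i * 0)"
  proof (intro tendsto_intros)
    fix i
    have "(\<lambda>n. (?eP (n - i) * real n powr (- (P - 1)) * real n powr (- Q)) /
        (?eR n * real n powr (- (P + Q - 1)))) \<longlonglongrightarrow> (rGamma P * 0) / rGamma (P + Q)"
      using Q P by (intro tendsto_intros coeff_asymp_shift coeff_asymp_model
          coeff_asymp_model[unfolded coeff_asymp_def]) (real_asymp, simp add: rGamma_eq_zero_iff
            nonpos_Ints_def)
    moreover have "eventually (\<lambda>n. (?eP (n - i) * real n powr (- (P - 1)) * real n powr (- Q)) /
        (?eR n * real n powr (- (P + Q - 1))) = ?eP (n - i) / ?eR n) sequentially"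
      using eventually_gt_at_top[of 0]
    proof eventually_elim
      case (elim n)
      have "real n powr (- (P - 1)) * real n powr (- Q) = real n powr (- (P + Q - 1))"
        unfolding powr_add[symmetric] by (rule arg_cong[where f = "(powr) _"]) simp
      with elim show ?case by (simp add: mult.assoc)
    qed
    ultimately show "(\<lambda>n. ?eP (n - i) / ?eR n) \<longlonglongrightarrow> 0" by (simp add: tendsto_cong)
  qed
  then have "eventually (\<lambda>n. C * (\<Sum>i<N. h i * (?eP (n - i) / ?eR n)) < \<epsilon> / 2) sequentially"
    using \<epsilon> by (intro order_tendstoD[where y = 0]) auto
  then have "eventually (\<lambda>n. n \<ge> N \<and> C * (\<Sum>i<N. h i * (?eP (n - i) / ?eR n)) < \<epsilon> / 2) sequentially"
    by (intro eventually_conj eventually_ge_at_top)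
  then obtain M where M: "\<And>n. n \<ge> M \<Longrightarrow> n \<ge> N \<and> C * (\<Sum>i<N. h i * (?eP (n - i) / ?eR n)) < \<epsilon> / 2"
    by (auto simp: eventually_sequentially)
  have "norm (fps_nth (g * f) n / ?eR n - 0) < \<epsilon>" if "n \<ge> M" for n
  proof -
    have "\<bar>fps_nth (g * f) n\<bar> / ?eR n \<le> (C * \<delta> * ?eR n + C * (\<Sum>i<N. h i * ?eP (n - i))) / ?eR n"
      using bound[of n] M[OF that] pR[of n] by (intro divide_right_mono) auto
    also have "\<dots> = C * \<delta> + C * (\<Sum>i<N. h i * (?eP (n - i) / ?eR n))"
      using pR[of n] by (simp add: field_simps sum_divide_distrib sum_distrib_left)
    also have "\<dots> < C * \<delta> + \<epsilon> / 2" using M[OF that] by simp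
    also have "C * \<delta> \<le> \<epsilon> / 2" using C \<epsilon> by (simp add: \<delta>_def field_simps)
    finally show ?thesis using pR[of n] by (simp add: abs_divide)
  qed
  then show "\<exists>no. \<forall>n\<ge>no. norm (fps_nth (g * f) n / ?eR n - 0) < \<epsilon>" by blast
qed

lemma bounded_by_model:
  assumes "P > 0" "(\<lambda>n. fps_nth f n / fps_nth (model_fps P) n) \<longlonglongrightarrow> A"
  obtains C where "\<And>n. \<bar>fps_nth f n\<bar> \<le> C * fps_nth (model_fps P) n"
proof -
  have "Bseq (\<lambda>n. fps_nth f n / fps_nth (model_fps P) n)"
    using assms(2) by (intro convergent_imp_Bseq convergentI)
  then obtain C where C: "\<And>n. norm (fps_nth f n / fps_nth (model_fps P) n) \<le> C"
    by (metis BseqE)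
  have "\<bar>fps_nth f n\<bar> \<le> C * fps_nth (model_fps P) n" for n
    using C[of n] model_fps_pos[OF assms(1), of n] by (simp add: field_simps abs_divide)
  then show ?thesis by (rule that)
qed

text \<open>
  Each factor is a multiple of a model series up to a remainder whose product is negligible.
\<close>

theorem coeff_asymp_mult:
  assumes P: "P > 0" and Q: "Q > 0"
    and f: "coeff_asymp f (P - 1) A" and g: "coeff_asymp g (Q - 1) B"
  shows "coeff_asymp (f * g) (P + Q - 1) (A * B * Gamma P * Gamma Q / Gamma (P + Q))"
proof -
  let ?R = "fps_nth (model_fps (P + Q))"
  let ?EP = "model_fps P" and ?EQ = "model_fps Q"
  define A' B' where "A' = A * Gamma P" and "B' = B * Gamma Q"
  define f0 g0 where "f0 = f - fps_const A' * ?EP" and "g0 = g - fps_const B' * ?EQ"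
  have nz: "fps_nth ?EP n \<noteq> 0" "fps_nth ?EQ n \<noteq> 0" "?R n \<noteq> 0" for n
    using model_fps_pos[of _ n] P Q by (metis less_irrefl add_pos_pos)+
  have f1: "(\<lambda>n. fps_nth f n / fps_nth ?EP n) \<longlonglongrightarrow> A'"
    using f P by (simp add: model_ratio_iff A'_def)
  have g1: "(\<lambda>n. fps_nth g n / fps_nth ?EQ n) \<longlonglongrightarrow> B'"
    using g Q by (simp add: model_ratio_iff B'_def)
  have f0: "(\<lambda>n. fps_nth f0 n / fps_nth ?EP n) \<longlonglongrightarrow> 0"
    using tendsto_diff[OF f1 tendsto_const[of A']] nz by (simp add: f0_def diff_divide_distrib)
  have g0: "(\<lambda>n. fps_nth g0 n / fps_nth ?EQ n) \<longlonglongrightarrow> 0"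
    using tendsto_diff[OF g1 tendsto_const[of B']] nz by (simp add: g0_def diff_divide_distrib)
  obtain C where C: "\<And>n. \<bar>fps_nth g n\<bar> \<le> C * fps_nth ?EQ n"
    using bounded_by_model[OF Q g1] by blast
  have P': "\<bar>fps_nth ?EP n\<bar> \<le> 1 * fps_nth ?EP n" for n
    using model_fps_pos[OF P, of n] by (simp add:)
  have "(\<lambda>n. A' * B' + A' * (fps_nth (g0 * ?EP) n / ?R n)
          + fps_nth (f0 * g) n / fps_nth (model_fps (Q + P)) n) \<longlonglongrightarrow> A' * B' + A' * 0 + 0"
    by (intro tendsto_intros conv_negligible[OF P Q P' g0] conv_negligible[OF Q P C f0])
  moreover have "f * g = fps_const (A' * B') * model_fps (P + Q) + fps_const A' * (g0 * ?EP) + f0 * g"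
  proof -
    have "f * g = (fps_const A' * fps_const B') * (?EP * ?EQ) + fps_const A' * (g0 * ?EP) + f0 * g"
      unfolding f0_def g0_def by (simp add: algebra_simps del: fps_const_mult)
    then show ?thesis by (simp add: model_fps_mult)
  qed
  then have "fps_nth (f * g) n / ?R n =
      A' * B' + A' * (fps_nth (g0 * ?EP) n / ?R n)
          + fps_nth (f0 * g) n / fps_nth (model_fps (Q + P)) n" for n
    using nz[of n] by (simp add: add_divide_distrib add.commute)
  ultimately have "(\<lambda>n. fps_nth (f * g) n / ?R n) \<longlonglongrightarrow> A' * B'"
    by simp
  moreover have "A' * B' = A * B * Gamma P * Gamma Q / Gamma (P + Q) * Gamma (P + Q)"
    using Gamma_real_pos[OF add_pos_pos[OF P Q]] by (simp add: A'_def B'_def)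
  ultimately show ?thesis using P Q by (simp only: model_ratio_iff add_pos_pos)
qed

text \<open>
  For \<open>P < 1\<close> the quotients \<open>f\<^sub>n\<^sub>-\<^sub>k / n powr (P - 1)\<close> are unbounded for \<open>k\<close> near \<open>n\<close>, so that dominated convergence does
  not apply directly. It applies to \<open>XD f * u\<close>, whose first factor has growing coefficients, and
  \<open>XD (f * u) = XD f * u + f * XD u\<close>, where the last product is of smaller order.
\<close>

theorem coeff_asymp_mult_summable:
  assumes P: "P > 0" and f: "coeff_asymp f (P - 1) A"
    and u: "coeff_asymp u (- 3 / 2) c" and sums: "summable (\<lambda>n. \<bar>fps_nth u n\<bar>)"
  shows "coeff_asymp (f * u) (P - 1) (A * (\<Sum>n. fps_nth u n))"
proof -
  let ?F = "fps_XD f"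
  have F: "coeff_asymp ?F P A" using coeff_asymp_XD[OF f] by simp
  obtain C where C: "C > 0" "\<And>n. \<bar>fps_nth ?F n\<bar> \<le> C * real n powr P"
    using coeff_asymp_bounded[OF F] by auto
  define a where "a k n = (if k \<le> n then fps_nth u k * (fps_nth ?F (n - k) * real n powr (- P)) else 0)" for k n
  have "(\<lambda>n. \<Sum>k. a k n) \<longlonglongrightarrow> (\<Sum>k. fps_nth u k * A)"
  proof (rule tannerys_theorem[THEN conjunct2, THEN conjunct2])
    fix k
    have "eventually (\<lambda>n. fps_nth u k * (fps_nth ?F (n - k) * real n powr (- P)) = a k n) sequentially"
      using eventually_ge_at_top[of k] by eventually_elim (simp add: a_def)
    moreover have "(\<lambda>n. fps_nth u k * (fps_nth ?F (n - k) * real n powr (- P))) \<longlonglongrightarrow> fps_nth u k * A"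
      by (intro tendsto_intros coeff_asymp_shift F)
    ultimately show "(\<lambda>n. a k n) \<longlonglongrightarrow> fps_nth u k * A" by (rule Lim_transform_eventually[rotated])
  next
    have "norm (a k n) \<le> \<bar>fps_nth u k\<bar> * C" for k n
    proof (cases "k \<le> n \<and> n > 0")
      case True
      have "\<bar>fps_nth ?F (n - k)\<bar> \<le> C * real (n - k) powr P" by (rule C)
      also have "\<dots> \<le> C * real n powr P" using C P by (intro mult_left_mono powr_mono2) auto
      finally have "\<bar>fps_nth ?F (n - k)\<bar> * real n powr (- P) \<le> C"
        using True by (simp add: powr_minus field_simps)
      then have "\<bar>fps_nth u k\<bar> * (\<bar>fps_nth ?F (n - k)\<bar> * real n powr (- P)) \<le> \<bar>fps_nth u k\<bar> * C"
        by (intro mult_left_mono) auto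
      then show ?thesis using True by (simp add: a_def abs_mult)
    qed (use C in \<open>auto simp: a_def\<close>)
    then show "\<forall>\<^sub>F (k, n) in at_top \<times>\<^sub>F sequentially. norm (a k n) \<le> \<bar>fps_nth u k\<bar> * C"
      by (intro always_eventually) auto
    show "summable (\<lambda>k. \<bar>fps_nth u k\<bar> * C)" using sums by (rule summable_mult2)
  qed auto
  moreover have "(\<Sum>k. a k n) = fps_nth (?F * u) n * real n powr (- P)" for n
  proof -
    have "(\<Sum>k. a k n) = (\<Sum>k=0..n. a k n)"
      by (rule suminf_finite) (auto simp: a_def)
    also have "\<dots> = (\<Sum>k=0..n. fps_nth u k * fps_nth ?F (n - k) * real n powr (- P))"
      by (intro sum.cong) (simp_all add: a_def)
    also have "\<dots> = fps_nth (u * ?F) n * real n powr (- P)"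
      unfolding fps_mult_nth sum_distrib_right ..
    finally show ?thesis by (simp add: mult.commute)
  qed
  moreover have "summable (fps_nth u)" using sums by (rule summable_rabs_cancel)
  then have "(\<Sum>k. fps_nth u k * A) = A * (\<Sum>k. fps_nth u k)"
    by (subst suminf_mult[symmetric]) (simp_all add: mult.commute)
  ultimately have 1: "coeff_asymp (?F * u) P (A * (\<Sum>n. fps_nth u n))"
    by (simp add: coeff_asymp_def)
  have Du: "coeff_asymp (fps_XD u) (1 / 2 - 1) c" using coeff_asymp_XD[OF u] by simp
  have "coeff_asymp (f * fps_XD u) (P + 1 / 2 - 1) (A * c * Gamma P * Gamma (1 / 2) / Gamma (P + 1 / 2))"
    using P by (intro coeff_asymp_mult f Du) auto
  then have 2: "coeff_asymp (f * fps_XD u) P 0" by (rule coeff_asymp_negligible) simp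
  have "fps_XD (f * u) = ?F * u + f * fps_XD u" by (simp add: fps_XD_def algebra_simps)
  with coeff_asymp_add[OF 1 2] have "coeff_asymp (fps_XD (f * u)) P (A * (\<Sum>n. fps_nth u n))" by simp
  then show ?thesis using coeff_asymp_XD_iff[of "f * u" "P - 1"] by simp
qed

section \<open>Cutting an edge\<close>

text \<open>
  All trees \<open>t\<close> with an edge \<open>e\<close> such that cutting \<open>e\<close> leaves the trunk \<open>u\<close> and the branch \<open>v\<close>, i.e. all ways
  to attach \<open>v\<close> to \<open>u\<close>.
\<close>

definition grafts :: "ordered_tree \<Rightarrow> ordered_tree \<Rightarrow> (ordered_tree \<times> nat list) set" where
  "grafts u v = {(t, e). e \<in> edges t \<and> cut_trunk t e = u \<and> cut_branch t e = v}"

lemma delete_nth_eq_iff: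
  assumes "i < length ts"
  shows "take i ts @ drop (Suc i) ts = us \<and> ts ! i = v \<longleftrightarrow>
    i \<le> length us \<and> ts = take i us @ v # drop i us"
proof
  assume *: "take i ts @ drop (Suc i) ts = us \<and> ts ! i = v"
  then have us: "us = take i ts @ drop (Suc i) ts" by simp
  have "i \<le> length us" using assms us by simp
  moreover have "take i us = take i ts" "drop i us = drop (Suc i) ts"
    using assms us by simp_all
  ultimately show "i \<le> length us \<and> ts = take i us @ v # drop i us"
    using id_take_nth_drop[OF assms] * by simp
next
  assume *: "i \<le> length us \<and> ts = take i us @ v # drop i us"
  then show "take i ts @ drop (Suc i) ts = us \<and> ts ! i = v"
    by (simp add: nth_append min_absorb2)
qed

text \<open>
  The branch hangs either directly from the root of the trunk or from within one of its subtrees.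
\<close>

lemma grafts_Node:
  "grafts (Node us) v =
     (\<lambda>i. (Node (take i us @ v # drop i us), [i])) ` {..length us} \<union>
     (\<Union>i<length us. (\<lambda>(t, p). (Node (us[i := t]), i # p)) ` grafts (us ! i) v)"
  (is "_ = ?A \<union> ?B")
proof (intro equalityI subsetI)
  fix x assume x: "x \<in> grafts (Node us) v"
  obtain ts e where xe: "x = (Node ts, e)" by (metis ordered_tree.exhaust surj_pair)
  from x xe have e: "e \<noteq> []" "is_node (Node ts) e" "cut_trunk (Node ts) e = Node us"
    "cut_branch (Node ts) e = v" by (auto simp: grafts_def edges_def)
  then obtain i p where p: "e = i # p" by (cases e) auto
  then have i: "i < length ts" using e by simp
  show "x \<in> ?A \<union> ?B"
  proof (cases p)
    case Nil
    then have "take i ts @ drop (Suc i) ts = us \<and> ts ! i = v" using e p by simp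
    then have "i \<le> length us \<and> ts = take i us @ v # drop i us"
      by (simp only: delete_nth_eq_iff[OF i])
    then show ?thesis using xe p Nil by auto
  next
    case (Cons j q)
    then have us: "us = ts[i := cut_trunk (ts ! i) p]" using e p by simp
    have "(ts ! i, p) \<in> grafts (us ! i) v" "ts = us[i := ts ! i]" "i < length us"
      using e p Cons us i by (auto simp: grafts_def edges_def)
    then have "x \<in> ?B" unfolding xe p by (auto intro!: bexI[of _ i] image_eqI[of _ _ "(ts ! i, p)"])
    then show ?thesis ..
  qed
next
  fix x assume "x \<in> ?A \<union> ?B"
  then show "x \<in> grafts (Node us) v"
  proof
    assume "x \<in> ?A"
    then obtain i where i: "i \<le> length us" "x = (Node (take i us @ v # drop i us), [i])" by auto
    let ?ts = "take i us @ v # drop i us"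
    have "i < length ?ts" using i by simp
    with delete_nth_eq_iff[OF this, of us v] i show ?thesis
      by (simp add: grafts_def edges_def)
  next
    assume "x \<in> ?B"
    then obtain i t p where i: "i < length us" "(t, p) \<in> grafts (us ! i) v"
      "x = (Node (us[i := t]), i # p)" by auto
    then show ?thesis by (cases p) (auto simp: grafts_def edges_def)
  qed
qed

lemma prod_list_insert_nth:
  fixes f :: "'a \<Rightarrow> 'b :: comm_monoid_mult"
  shows "prod_list (map f (take i us @ v # drop i us)) = f v * prod_list (map f us)"
proof -
  have "prod_list (map f us) = prod_list (map f (take i us @ drop i us))" by simp
  then show ?thesis by (simp only: map_append prod_list.append list.map prod_list.Cons mult_ac)
qed

lemma prod_list_update_nth:
  fixes f :: "'a \<Rightarrow> real"
  assumes "i < length us"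
  shows "prod_list (map f (us[i := t])) =
    f t * prod_list (map f (take i us @ drop (Suc i) us))"
  using assms by (simp add: upd_conv_take_nth_drop)

text \<open>
  This is the differential equation \<open>\<Phi>' = b * \<Phi> + g * t * \<Phi>'\<close>. Type A has \<open>g = 0\<close>, type B has \<open>g = - b / d\<close> and type C
  has \<open>g = 2 * \<alpha>\<^sub>1 - \<alpha>\<^sub>0\<close>, with \<open>b = \<alpha>\<^sub>0\<close> throughout.
\<close>

definition linear_ratio :: "real fps \<Rightarrow> real \<Rightarrow> real \<Rightarrow> bool" where
  "linear_ratio \<Phi> b g \<longleftrightarrow>
     (\<forall>k. real (Suc k) * fps_nth \<Phi> (Suc k) = (b + g * real k) * fps_nth \<Phi> k)"

text \<open>
  A branch can be attached to a node of outdegree \<open>d\<close> in \<open>d + 1\<close> positions, and the weight changes by the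
  factor \<open>\<phi>\<^sub>d\<^sub>+\<^sub>1 / \<phi>\<^sub>d\<close>, so that the node contributes \<open>b + g * d\<close> in total. The outdegrees of \<open>u\<close> add up to
  \<open>num_nodes u - 1\<close>. Induction on \<open>u\<close> avoids dividing by \<open>\<phi>\<^sub>d\<close>, which may vanish in type B.
\<close>

lemma grafts_weight:
  assumes "linear_ratio \<Phi> b g"
  shows "finite (grafts u v) \<and> (\<Sum>(t, e)\<in>grafts u v. tree_weight \<Phi> t) =
    (b * real (num_nodes u) + g * (real (num_nodes u) - 1)) * tree_weight \<Phi> u * tree_weight \<Phi> v"
proof (induction u)
  case (Node us)
  let ?w = "tree_weight \<Phi>" and ?d = "length us"
  let ?N = "\<lambda>u. b * real (num_nodes u) + g * (real (num_nodes u) - 1)"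
  let ?A = "(\<lambda>i. (Node (take i us @ v # drop i us), [i])) ` {..?d}"
  let ?f = "\<lambda>i (t, p). (Node (us[i := t]), i # p)"
  let ?B = "\<lambda>i. ?f i ` grafts (us ! i) v"
  have IH: "finite (grafts (us ! i) v)"
    "(\<Sum>(t, e)\<in>grafts (us ! i) v. ?w t) = ?N (us ! i) * ?w (us ! i) * ?w v" if "i < ?d" for i
    using Node.IH[of "us ! i"] that by auto
  have inj: "inj_on (?f i) X" if "i < ?d" for i X
    by (rule inj_onI) (auto, metis nth_list_update_eq that)
  have disj: "?A \<inter> (\<Union>i<?d. ?B i) = {}"
    by (auto simp: grafts_def edges_def)
  have A: "(\<Sum>(t, e)\<in>?A. ?w t) = (b + g * real ?d) * ?w (Node us) * ?w v"
  proof -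
    have "(\<Sum>(t, e)\<in>?A. ?w t) = (\<Sum>i\<le>?d. ?w (Node (take i us @ v # drop i us)))"
      by (subst sum.reindex) (auto intro: inj_onI)
    also have "\<dots> = (\<Sum>i\<le>?d. fps_nth \<Phi> (Suc ?d) * (?w v * prod_list (map ?w us)))"
      unfolding tree_weight.simps prod_list_insert_nth by (intro sum.cong) auto
    also have "\<dots> = (real (Suc ?d) * fps_nth \<Phi> (Suc ?d)) * (?w v * prod_list (map ?w us))"
      by simp
    also have "\<dots> = (b + g * real ?d) * ?w (Node us) * ?w v"
      using assms unfolding linear_ratio_def by (simp del: of_nat_Suc)
    finally show ?thesis .
  qed
  have B: "(\<Sum>(t, e)\<in>?B i. ?w t) = ?N (us ! i) * ?w (Node us) * ?w v" if i: "i < ?d" for i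
  proof -
    let ?P = "prod_list (map ?w (take i us @ drop (Suc i) us))"
    have "(\<Sum>(t, e)\<in>?B i. ?w t) = (\<Sum>(t, e)\<in>grafts (us ! i) v. ?w (Node (us[i := t])))"
      by (subst sum.reindex[OF inj[OF i]]) (simp add: case_prod_unfold)
    also have "\<dots> = (\<Sum>(t, e)\<in>grafts (us ! i) v. fps_nth \<Phi> ?d * ?P * ?w t)"
      by (intro sum.cong) (auto simp only: tree_weight.simps prod_list_update_nth[OF i] length_list_update mult_ac)
    also have "\<dots> = fps_nth \<Phi> ?d * ?P * (?N (us ! i) * ?w (us ! i) * ?w v)"
      unfolding IH(2)[OF i, symmetric] by (simp add: sum_distrib_left case_prod_unfold)
    also have "\<dots> = ?N (us ! i) * (fps_nth \<Phi> ?d * ?P * ?w (us ! i)) * ?w v"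
      by (simp only: mult_ac)
    also have "fps_nth \<Phi> ?d * ?P * ?w (us ! i) = ?w (Node us)"
      using prod_list_update_nth[OF i, of ?w "us ! i"] by (simp add: mult_ac)
    finally show ?thesis .
  qed
  have fin: "finite ?A" "finite (\<Union>i<?d. ?B i)" using IH(1) by auto
  have "(\<Sum>(t, e)\<in>(\<Union>i<?d. ?B i). ?w t) = (\<Sum>i<?d. (\<Sum>(t, e)\<in>?B i. ?w t))"
    using IH(1) by (intro sum.UNION_disjoint) auto
  also have "\<dots> = (\<Sum>i<?d. ?N (us ! i) * (?w (Node us) * ?w v))"
    using B by (intro sum.cong) (auto simp: mult_ac)
  also have "\<dots> = (\<Sum>i<?d. ?N (us ! i)) * (?w (Node us) * ?w v)"
    by (rule sum_distrib_right[symmetric])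
  also have "(\<Sum>i<?d. ?N (us ! i)) = (b + g) * (\<Sum>i<?d. real (num_nodes (us ! i))) - g * real ?d"
    by (simp add: algebra_simps sum.distrib sum_subtractf sum_distrib_left)
  also have "(\<Sum>i<?d. real (num_nodes (us ! i))) = real (num_nodes (Node us)) - 1"
    by (simp add: sum_list_sum_nth atLeast0LessThan)
  finally have "(\<Sum>(t, e)\<in>grafts (Node us) v. ?w t) = (b + g * real ?d) * ?w (Node us) * ?w v +
      ((b + g) * (real (num_nodes (Node us)) - 1) - g * real ?d) * (?w (Node us) * ?w v)"
    unfolding grafts_Node sum.union_disjoint[OF fin disj] A by simp
  also have "\<dots> = ?N (Node us) * ?w (Node us) * ?w v"
    by (simp add: algebra_simps)
  finally show ?case using fin by (simp only: grafts_Node finite_UnI simp_thms)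
qed

text \<open>
  The edges are grouped by the pair of trees that cutting them produces.
\<close>

theorem sum_over_cuts:
  fixes F :: "ordered_tree \<Rightarrow> ordered_tree \<Rightarrow> real"
  assumes lr: "linear_ratio \<Phi> b g"
  shows "(\<Sum>t | num_nodes t = n. tree_weight \<Phi> t *
            (\<Sum>e\<in>edges t. F (cut_trunk t e) (cut_branch t e))) =
    (\<Sum>k=0..n. (b * real k + g * (real k - 1)) *
       (\<Sum>u | num_nodes u = k. \<Sum>v | num_nodes v = n - k.
          tree_weight \<Phi> u * tree_weight \<Phi> v * F u v))"
proof -
  let ?w = "tree_weight \<Phi>"
  let ?S = "SIGMA t:{t. num_nodes t = n}. edges t"
  let ?T = "SIGMA k:{0..n}. {u. num_nodes u = k} \<times> {v. num_nodes v = n - k}"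
  let ?c = "\<lambda>(t, e). (num_nodes (cut_trunk t e), cut_trunk t e, cut_branch t e)"
  have "(\<Sum>t | num_nodes t = n. ?w t * (\<Sum>e\<in>edges t. F (cut_trunk t e) (cut_branch t e))) =
      (\<Sum>(t, e)\<in>?S. ?w t * F (cut_trunk t e) (cut_branch t e))"
    by (simp add: sum.Sigma finite_num_nodes sum_distrib_left)
  also have "\<dots> = (\<Sum>y\<in>?T. \<Sum>x\<in>{x \<in> ?S. ?c x = y}. case x of (t, e) \<Rightarrow>
      ?w t * F (cut_trunk t e) (cut_branch t e))"
  proof (rule sum.group[symmetric])
    show "?c ` ?S \<subseteq> ?T"
    proof (rule image_subsetI)
      fix x assume "x \<in> ?S"
      then obtain t e where e: "e \<in> edges t" "n = num_nodes t" "x = (t, e)" by auto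
      from num_nodes_cut[OF e(1)] show "?c x \<in> ?T" unfolding e(2,3) by auto
    qed
  qed (auto simp: finite_num_nodes)
  also have "\<dots> = (\<Sum>y\<in>?T. case y of (k, u, v) \<Rightarrow>
      (b * real k + g * (real k - 1)) * (?w u * ?w v * F u v))"
  proof (intro sum.cong refl)
    fix y assume "y \<in> ?T"
    then obtain k u v where *: "k \<in> {0..n}" "num_nodes v = n - num_nodes u" "k = num_nodes u"
      and y: "y = (num_nodes u, u, v)" by auto
    have "{x \<in> ?S. ?c x = (num_nodes u, u, v)} = grafts u v"
    proof -
      have "(t, e) \<in> ?S \<and> ?c (t, e) = (num_nodes u, u, v) \<longleftrightarrow> (t, e) \<in> grafts u v" for t e
        using num_nodes_cut[of e t] * by (auto simp: grafts_def)
      then show ?thesis by auto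
    qed
    then have "(\<Sum>x\<in>{x \<in> ?S. ?c x = (num_nodes u, u, v)}. case x of (t, e) \<Rightarrow> ?w t * F (cut_trunk t e) (cut_branch t e))
        = (\<Sum>(t, e)\<in>grafts u v. ?w t * F u v)"
      by (intro sum.cong) (auto simp: grafts_def)
    also have "\<dots> = (\<Sum>(t, e)\<in>grafts u v. ?w t) * F u v"
      by (simp add: sum_distrib_right case_prod_unfold)
    also have "\<dots> = (b * real (num_nodes u) + g * (real (num_nodes u) - 1)) * (?w u * ?w v * F u v)"
      using grafts_weight[OF lr, of u v] by (simp add: mult.assoc)
    finally show "(\<Sum>x\<in>{x \<in> ?S. ?c x = y}. case x of (t, e) \<Rightarrow> ?w t * F (cut_trunk t e) (cut_branch t e))
        = (case y of (k, u, v) \<Rightarrow> (b * real k + g * (real k - 1)) * (?w u * ?w v * F u v))"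
      by (simp only: y prod.case)
  qed
  also have "\<dots> = (\<Sum>k=0..n. (b * real k + g * (real k - 1)) *
       (\<Sum>u | num_nodes u = k. \<Sum>v | num_nodes v = n - k. ?w u * ?w v * F u v))"
  proof -
    have "(\<Sum>y\<in>?T. case y of (k, u, v) \<Rightarrow> (b * real k + g * (real k - 1)) * (?w u * ?w v * F u v)) =
      (\<Sum>k=0..n. \<Sum>(u, v)\<in>{u. num_nodes u = k} \<times> {v. num_nodes v = n - k}.
        (b * real k + g * (real k - 1)) * (?w u * ?w v * F u v))"
      by (rule sum.Sigma[symmetric]) (auto simp: finite_num_nodes)
    then show ?thesis unfolding sum.cartesian_product[symmetric] sum_distrib_left .
  qed
  finally show ?thesis .
qed

lemma card_edges: "card (edges t) = num_nodes t - 1"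
proof (induction t)
  case (Node ts)
  have "card (edges (Node ts)) = (\<Sum>i<length ts. card ((#) i ` insert [] (edges (ts ! i))))"
    unfolding edges_Node by (rule card_UN_disjoint) auto
  also have "\<dots> = (\<Sum>i<length ts. num_nodes (ts ! i))"
  proof (intro sum.cong refl)
    fix i assume "i \<in> {..<length ts}"
    then have "card (edges (ts ! i)) = num_nodes (ts ! i) - 1" using Node.IH by simp
    moreover have "[] \<notin> edges (ts ! i)" by (simp add: edges_def)
    moreover have "card ((#) i ` insert [] (edges (ts ! i))) = card (insert [] (edges (ts ! i)))"
      by (rule card_image) (auto intro: inj_onI)
    ultimately show "card ((#) i ` insert [] (edges (ts ! i))) = num_nodes (ts ! i)"
      using num_nodes_pos[of "ts ! i"] by (simp del: num_nodes_pos image_insert)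
  qed
  finally show ?case by (simp add: sum_list_sum_nth atLeast0LessThan)
qed

section \<open>Moments of the destruction cost\<close>

lemma finite_set_pmf_destruction_cost [simp]: "finite (set_pmf (destruction_cost toll t))"
proof (induction toll t rule: destruction_cost.induct)
  case (1 toll t)
  show ?case
  proof (cases "num_nodes t < 2")
    case True
    then show ?thesis by (subst destruction_cost.simps) simp
  next
    case False
    then have ne: "edges t \<noteq> {}" by (simp add: edges_nonempty)
    have "finite (set_pmf (destruction_cost toll (cut_trunk t e)))"
      "finite (set_pmf (destruction_cost toll (cut_branch t e)))" if "e \<in> edges t" for e
    proof -
      have e: "e \<in> set_pmf (pmf_of_set (edges t))" using that ne by (simp add: set_pmf_of_set)
      obtain x where x: "x \<in> set_pmf (destruction_cost toll (cut_trunk t e))"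
        using set_pmf_not_empty[of "destruction_cost toll (cut_trunk t e)"] by blast
      show "finite (set_pmf (destruction_cost toll (cut_trunk t e)))"
        "finite (set_pmf (destruction_cost toll (cut_branch t e)))"
        using "1.IH"(1)[OF False e] "1.IH"(2)[OF False e x] by blast+
    qed
    then show ?thesis using False ne
      by (subst destruction_cost.simps) (auto simp: set_bind_pmf)
  qed
qed

definition tree_moment :: "(nat \<Rightarrow> real) \<Rightarrow> ordered_tree \<Rightarrow> nat \<Rightarrow> real" where
  "tree_moment toll t s = measure_pmf.expectation (destruction_cost toll t) (\<lambda>x. x ^ s)"

lemma tree_moment_0 [simp]: "tree_moment toll t 0 = 1"
  by (simp add: tree_moment_def)

lemma expectation_sum_independent_power:
  fixes p q :: "real pmf"
  assumes p: "finite (set_pmf p)" and q: "finite (set_pmf q)"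
  shows "measure_pmf.expectation (bind_pmf p (\<lambda>x. bind_pmf q (\<lambda>y. return_pmf (x + y + c)))) (\<lambda>x. x ^ s)
    = (\<Sum>i\<le>s. real (s choose i) * c ^ i * (\<Sum>j\<le>s - i. real (s - i choose j) *
        measure_pmf.expectation p (\<lambda>x. x ^ j) * measure_pmf.expectation q (\<lambda>x. x ^ (s - i - j))))"
proof -
  let ?f = "\<lambda>i j x y. real (s choose i) * c ^ i * (real (s - i choose j) * (pmf p x * x ^ j) * (pmf q y * y ^ (s - i - j)))"
  have E: "measure_pmf.expectation p f = (\<Sum>x\<in>set_pmf p. pmf p x * f x)"
    if "finite (set_pmf p)" for p and f :: "real \<Rightarrow> real"
    using integral_measure_pmf[of "set_pmf p" p f] that by simp
  have "measure_pmf.expectation (bind_pmf p (\<lambda>x. bind_pmf q (\<lambda>y. return_pmf (x + y + c)))) (\<lambda>x. x ^ s)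
    = (\<Sum>x\<in>set_pmf p. \<Sum>y\<in>set_pmf q. pmf p x * pmf q y * (x + y + c) ^ s)"
    using p q by (subst pmf_expectation_bind[of "set_pmf p"]; simp?;
        subst pmf_expectation_bind[of "set_pmf q"]; simp add: sum_distrib_left mult_ac)
  also have "\<dots> = (\<Sum>x\<in>set_pmf p. \<Sum>y\<in>set_pmf q. \<Sum>i\<le>s. \<Sum>j\<le>s - i.
      ?f i j x y)"
  proof (intro sum.cong refl)
    fix x y
    have "(x + y + c) ^ s = (\<Sum>i\<le>s. real (s choose i) * c ^ i * (x + y) ^ (s - i))"
      using binomial_ring[of c "x + y" s] by (simp add: add.commute)
    also have "\<dots> = (\<Sum>i\<le>s. \<Sum>j\<le>s - i. real (s choose i) * c ^ i * (real (s - i choose j) * x ^ j * y ^ (s - i - j)))"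
      by (intro sum.cong refl) (simp add: binomial_ring sum_distrib_left)
    finally show "pmf p x * pmf q y * (x + y + c) ^ s = (\<Sum>i\<le>s. \<Sum>j\<le>s - i.
      ?f i j x y)"
      by (simp add: sum_distrib_left mult_ac)
  qed
  also have "\<dots> = (\<Sum>i\<le>s. \<Sum>j\<le>s - i. \<Sum>x\<in>set_pmf p. \<Sum>y\<in>set_pmf q.
      ?f i j x y)"
    by (simp only: sum.swap[of _ _ "{..s}"] sum.swap[of _ _ "{..s - _}"])
  also have "\<dots> = (\<Sum>i\<le>s. real (s choose i) * c ^ i * (\<Sum>j\<le>s - i. real (s - i choose j) *
        (\<Sum>x\<in>set_pmf p. pmf p x * x ^ j) * (\<Sum>y\<in>set_pmf q. pmf q y * y ^ (s - i - j))))"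
    by (simp add: sum_distrib_left sum_distrib_right mult_ac)
  finally show ?thesis using p q by (simp add: E)
qed

lemma tree_moment_step:
  assumes "num_nodes t \<ge> 2"
  shows "(real (num_nodes t) - 1) * tree_moment toll t s = (\<Sum>e\<in>edges t.
    \<Sum>i\<le>s. real (s choose i) * toll (num_nodes t) ^ i * (\<Sum>j\<le>s - i. real (s - i choose j) *
      tree_moment toll (cut_trunk t e) j * tree_moment toll (cut_branch t e) (s - i - j)))"
proof -
  let ?S = "\<lambda>e. \<Sum>i\<le>s. real (s choose i) * toll (num_nodes t) ^ i * (\<Sum>j\<le>s - i. real (s - i choose j) * tree_moment toll (cut_trunk t e) j * tree_moment toll (cut_branch t e) (s - i - j))"
  have ne: "edges t \<noteq> {}" using assms by (rule edges_nonempty)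
  have c: "real (card (edges t)) = real (num_nodes t) - 1" "real (card (edges t)) \<noteq> 0"
    using assms by (simp_all add: card_edges of_nat_diff)
  have "tree_moment toll t s = measure_pmf.expectation (bind_pmf (pmf_of_set (edges t)) (\<lambda>e.
             bind_pmf (destruction_cost toll (cut_trunk t e)) (\<lambda>x.
             bind_pmf (destruction_cost toll (cut_branch t e)) (\<lambda>y.
               return_pmf (x + y + toll (num_nodes t)))))) (\<lambda>x. x ^ s)"
    unfolding tree_moment_def using assms by (subst destruction_cost.simps) simp
  also have "\<dots> = (\<Sum>e\<in>edges t. ?S e /\<^sub>R real (card (edges t)))"
    using ne by (subst pmf_expectation_bind_pmf_of_set)
      (auto simp: set_bind_pmf expectation_sum_independent_power tree_moment_def)
  also have "\<dots> = (\<Sum>e\<in>edges t. ?S e) / real (card (edges t))"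
    by (subst sum_divide_distrib) (simp add: divide_inverse_commute)
  finally show ?thesis using c by (simp add: field_simps)
qed

text \<open>
  The coefficients are the moments of the cost, multiplied by the total weight of the trees of that
  size. In this form the two parts of a cut tree decouple into a product of series.
\<close>

definition moment_fps :: "real fps \<Rightarrow> (nat \<Rightarrow> real) \<Rightarrow> nat \<Rightarrow> real fps" where
  "moment_fps \<Phi> toll s =
     Abs_fps (\<lambda>n. \<Sum>t | num_nodes t = n. tree_weight \<Phi> t * tree_moment toll t s)"

lemma sum_atMost_reflect: "(\<Sum>j\<le>m. f (m - j)) = sum f {..m :: nat}"
  by (rule sum.reindex_bij_witness[of _ "\<lambda>j. m - j" "\<lambda>j. m - j"]) auto

lemma sum_mult_left_commute:
  "(\<Sum>i\<in>A. c i * (K * f i)) = K * (\<Sum>i\<in>A. c i * f i :: real)"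
  by (simp add: sum_distrib_left mult.left_commute)

text \<open>
  The power of the sum of toll and partial costs is expanded by the binomial theorem. The factor
  \<open>b * k + g * (k - 1)\<close> of a trunk of size \<open>k\<close> may be replaced by its average over \<open>k\<close> and \<open>n - k\<close>, because
  the rest of the sum is symmetric in trunk and branch.
\<close>

theorem moment_fps_recurrence:
  assumes lr: "linear_ratio \<Phi> b g" and n: "n \<ge> 2"
  shows "(real n - 1) * fps_nth (moment_fps \<Phi> toll s) n =
    ((b + g) * real n - 2 * g) / 2 * (\<Sum>i\<le>s. real (s choose i) * toll n ^ i *
      (\<Sum>j\<le>s - i. real (s - i choose j) *
         fps_nth (moment_fps \<Phi> toll j * moment_fps \<Phi> toll (s - i - j)) n))"
proof -
  let ?D = "\<lambda>i j. real (s - i choose j)"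
  let ?C = "\<lambda>i. real (s choose i) * toll n ^ i"
  let ?K = "((b + g) * real n - 2 * g) / 2"
  let ?cost = "\<lambda>u v. \<Sum>i\<le>s. ?C i * (\<Sum>j\<le>s - i. ?D i j * tree_moment toll u j * tree_moment toll v (s - i - j))"
  let ?M = "\<lambda>s. fps_nth (moment_fps \<Phi> toll s)" and ?w = "tree_weight \<Phi>"
  let ?MM = "\<lambda>j l. fps_nth (moment_fps \<Phi> toll j * moment_fps \<Phi> toll l) n"
  let ?c = "\<lambda>k. b * real k + g * (real k - 1)"
  have "(real n - 1) * ?M s n = (\<Sum>t | num_nodes t = n. ?w t * (\<Sum>e\<in>edges t. ?cost (cut_trunk t e) (cut_branch t e)))"
    unfolding moment_fps_def fps_nth_Abs_fps sum_distrib_left[of "real n - 1"]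
  proof (intro sum.cong refl)
    fix t assume "t \<in> {t. num_nodes t = n}"
    then show "(real n - 1) * (?w t * tree_moment toll t s) = ?w t * (\<Sum>e\<in>edges t. ?cost (cut_trunk t e) (cut_branch t e))"
      using tree_moment_step[of t toll s] n by (simp add: mult_ac)
  qed
  also have "\<dots> = (\<Sum>k=0..n. ?c k *
     (\<Sum>u | num_nodes u = k. \<Sum>v | num_nodes v = n - k. ?w u * ?w v *
      ?cost u v))"
    by (rule sum_over_cuts[OF lr])
  also have "\<dots> = (\<Sum>k=0..n. ?c k * (\<Sum>i\<le>s. ?C i *
      (\<Sum>j\<le>s - i. ?D i j * (?M j k * ?M (s - i - j) (n - k)))))"
  proof (intro sum.cong refl arg_cong2[of _ _ _ _ "(*)"])
    fix k
    have factor: "(\<Sum>u | num_nodes u = k. \<Sum>v | num_nodes v = n - k.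
        C * (D * ((?w u * tree_moment toll u j) * (?w v * tree_moment toll v l)))) =
      C * (D * (?M j k * ?M l (n - k)))" for C D j l
      unfolding moment_fps_def fps_nth_Abs_fps sum_product unfolding sum_distrib_left ..
    have "(\<Sum>u | num_nodes u = k. \<Sum>v | num_nodes v = n - k. ?w u * ?w v *
      ?cost u v) =
      (\<Sum>u | num_nodes u = k. \<Sum>v | num_nodes v = n - k.
      \<Sum>i\<le>s. \<Sum>j\<le>s - i. ?C i * (?D i j *
      ((?w u * tree_moment toll u j) * (?w v * tree_moment toll v (s - i - j)))))"
      by (simp add: sum_distrib_left mult_ac)
    also have "\<dots> = (\<Sum>i\<le>s. \<Sum>j\<le>s - i. \<Sum>u | num_nodes u = k. \<Sum>v | num_nodes v = n - k.
       ?C i * (?D i j *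
      ((?w u * tree_moment toll u j) * (?w v * tree_moment toll v (s - i - j)))))"
      by (simp only: sum.swap[of _ _ "{..s}"] sum.swap[of _ _ "{..s - _}"])
    also have "\<dots> = (\<Sum>i\<le>s. ?C i *
      (\<Sum>j\<le>s - i. ?D i j * (?M j k * ?M (s - i - j) (n - k))))"
      unfolding factor sum_distrib_left ..
    finally show "(\<Sum>u | num_nodes u = k. \<Sum>v | num_nodes v = n - k. ?w u * ?w v *
      ?cost u v) = \<dots>" .
  qed
  also have "\<dots> = (\<Sum>k=0..n. \<Sum>i\<le>s. \<Sum>j\<le>s - i. ?C i *
      (?D i j * (?c k * (?M j k * ?M (s - i - j) (n - k)))))"
    by (simp only: sum_distrib_left) (simp only: mult_ac)
  also have "\<dots> = (\<Sum>i\<le>s. \<Sum>j\<le>s - i. \<Sum>k=0..n. ?C i *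
      (?D i j * (?c k * (?M j k * ?M (s - i - j) (n - k)))))"
    by (simp only: sum.swap[of _ _ "{..s}"] sum.swap[of _ _ "{..s - _}"])
  also have "\<dots> = (\<Sum>i\<le>s. ?C i * (\<Sum>j\<le>s - i. ?D i j *
      (\<Sum>k=0..n. ?c k * (?M j k * ?M (s - i - j) (n - k)))))"
    by (simp only: sum_distrib_left)
  also have "\<dots> = (\<Sum>i\<le>s. ?C i *
      (?K * (\<Sum>j\<le>s - i. ?D i j *
         ?MM j (s - i - j))))"
  proof (intro sum.cong refl arg_cong2[of _ _ _ _ "(*)"])
    fix i
    define m where "m = s - i"
    let ?h = "\<lambda>j k. real (m choose j) * (?c k * (?M j k * ?M (m - j) (n - k)))"
    let ?h' = "\<lambda>j k. real (m choose j) * (?c (n - k) * (?M j k * ?M (m - j) (n - k)))"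
    let ?S = "\<Sum>j\<le>m. \<Sum>k=0..n. ?h j k"
    have "?S = (\<Sum>j\<le>m. \<Sum>k=0..n. ?h (m - j) (n - k))"
      unfolding atLeast0AtMost sum_atMost_reflect[of "?h (m - _)" n] sum_atMost_reflect[of "\<lambda>j. \<Sum>k\<le>n. ?h j k" m] ..
    also have "\<dots> = (\<Sum>j\<le>m. \<Sum>k=0..n. ?h' j k)"
      by (intro sum.cong refl) (auto simp: binomial_symmetric[symmetric] mult_ac)
    finally have "2 * ?S = (\<Sum>j\<le>m. \<Sum>k=0..n. ?h j k + ?h' j k)"
      by (simp add: sum.distrib)
    also have "\<dots> = (\<Sum>j\<le>m. \<Sum>k=0..n. ((b + g) * real n - 2 * g) * (real (m choose j) * (?M j k * ?M (m - j) (n - k))))"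
      by (intro sum.cong refl) (auto simp: algebra_simps of_nat_diff)
    also have "\<dots> = ((b + g) * real n - 2 * g) * (\<Sum>j\<le>m. real (m choose j) *
         ?MM j (m - j))"
      by (simp only: sum_distrib_left fps_mult_nth)
    finally have "?S = ?K * (\<Sum>j\<le>m. real (m choose j) *
         ?MM j (m - j))"
      by (simp only: times_divide_eq_left)
    moreover have "?S = (\<Sum>j\<le>m. real (m choose j) * (\<Sum>k=0..n. ?c k * (?M j k * ?M (m - j) (n - k))))"
      unfolding sum_distrib_left ..
    ultimately show "(\<Sum>j\<le>s - i. ?D i j * (\<Sum>k=0..n. ?c k * (?M j k * ?M (s - i - j) (n - k)))) =
      ?K * (\<Sum>j\<le>s - i. ?D i j *
         ?MM j (s - i - j))"
      unfolding m_def by (rule trans[OF sym, rotated])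
  qed
  also have "\<dots> = ?K * (\<Sum>i\<le>s. ?C i *
      (\<Sum>j\<le>s - i. ?D i j *
         ?MM j (s - i - j)))"
    by (rule sum_mult_left_commute)
  finally show ?thesis .
qed

lemma moment_fps_0_nth: "fps_nth (moment_fps \<Phi> toll 0) n = total_weight \<Phi> n"
  by (simp add: moment_fps_def total_weight_def)

lemma moment_fps_nth_0 [simp]: "fps_nth (moment_fps \<Phi> toll s) 0 = 0"
proof -
  have "{t. num_nodes t = 0} = {}" using num_nodes_pos by (auto simp del: num_nodes_pos)
  then show ?thesis unfolding moment_fps_def fps_nth_Abs_fps by (simp only: sum.empty)
qed

lemma set_pmf_random_tree:
  assumes "very_simple \<Phi>" "n \<ge> 1"
  shows "set_pmf (random_tree \<Phi> n) \<subseteq> {t. num_nodes t = n}"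
proof
  fix t assume "t \<in> set_pmf (random_tree \<Phi> n)"
  then have "pmf (random_tree \<Phi> n) t \<noteq> 0" by (simp add: set_pmf_iff)
  then show "t \<in> {t. num_nodes t = n}" using pmf_random_tree[OF assms, of t] by (auto split: if_splits)
qed

lemma expectation_total_cost:
  assumes "very_simple \<Phi>" "n \<ge> 1"
  shows "measure_pmf.expectation (total_cost \<Phi> toll n) (\<lambda>x. x ^ s) =
    fps_nth (moment_fps \<Phi> toll s) n / total_weight \<Phi> n"
proof -
  have "measure_pmf.expectation (total_cost \<Phi> toll n) (\<lambda>x. x ^ s) =
      (\<Sum>t | num_nodes t = n. pmf (random_tree \<Phi> n) t *\<^sub>R tree_moment toll t s)"
    unfolding total_cost_def tree_moment_def
    by (rule pmf_expectation_bind[OF finite_num_nodes _ set_pmf_random_tree[OF assms]]) simp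
  also have "\<dots> = (\<Sum>t | num_nodes t = n. tree_weight \<Phi> t * tree_moment toll t s / total_weight \<Phi> n)"
    by (intro sum.cong refl) (simp add: pmf_random_tree[OF assms])
  finally show ?thesis by (simp add: moment_fps_def sum_divide_distrib)
qed

section \<open>Lagrange inversion\<close>

lemma fps_compose_mult_nth:
  fixes a W Y :: "'a :: idom fps"
  assumes "fps_nth W 0 = 0"
  shows "fps_nth ((a oo W) * Y) n = (\<Sum>k=0..n. fps_nth a k * fps_nth (W ^ k * Y) n)"
proof -
  have "fps_nth ((a oo W) * Y) n = (\<Sum>i=0..n. (\<Sum>k=0..i. fps_nth a k * fps_nth (W ^ k) i) * fps_nth Y (n - i))"
    by (simp add: fps_mult_nth fps_compose_nth)
  also have "\<dots> = (\<Sum>i=0..n. (\<Sum>k=0..n. fps_nth a k * fps_nth (W ^ k) i) * fps_nth Y (n - i))"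
  proof -
    have "(\<Sum>k=0..i. fps_nth a k * fps_nth (W ^ k) i) = (\<Sum>k=0..n. fps_nth a k * fps_nth (W ^ k) i)"
      if "i \<in> {0..n}" for i
      using that startsby_zero_power_prefix[OF assms] by (intro sum.mono_neutral_left) auto
    then show ?thesis by (intro sum.cong refl) (simp only:)
  qed
  also have "\<dots> = (\<Sum>k=0..n. fps_nth a k * fps_nth (W ^ k * Y) n)"
    unfolding fps_mult_nth sum_distrib_left sum_distrib_right
    by (subst sum.swap) (simp add: mult.assoc)
  finally show ?thesis .
qed

text \<open>
  Facts about the inverse \<open>S\<close> of \<open>z / \<Phi>\<close>, which is the solution of \<open>S = z * \<Phi>(S)\<close>.
\<close>

lemma inverse_of_quotient:
  fixes \<Phi> :: "real fps"
  assumes "fps_nth \<Phi> 0 = 1"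
  defines "I \<equiv> inverse \<Phi>"
  defines "W \<equiv> fps_X * I"
  defines "S \<equiv> fps_inv W"
  shows "I * \<Phi> = 1" "fps_nth I 0 = 1" "fps_nth W 0 = 0" "fps_nth W 1 \<noteq> 0"
    "S oo W = fps_X" "W oo S = fps_X" "fps_nth S 0 = 0"
    "fps_deriv W = I - fps_X * fps_deriv \<Phi> * I\<^sup>2" "(fps_deriv S oo W) * fps_deriv W = 1"
proof -
  show "I * \<Phi> = 1" unfolding I_def using assms(1) by (simp add: inverse_mult_eq_1)
  show I0: "fps_nth I 0 = 1" using assms(1) by (simp add: I_def)
  show W0: "fps_nth W 0 = 0" and W1: "fps_nth W 1 \<noteq> 0" using I0 by (simp_all add: W_def)
  show SW: "S oo W = fps_X" unfolding S_def by (rule fps_inv[OF W0 W1])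
  show "W oo S = fps_X" unfolding S_def by (rule fps_inv_right[OF W0 W1])
  show "fps_nth S 0 = 0" by (simp add: S_def fps_inv_def)
  have "fps_deriv I = - fps_deriv \<Phi> * I\<^sup>2"
    unfolding I_def using assms(1) by (simp add: fps_inverse_deriv)
  then show "fps_deriv W = I - fps_X * fps_deriv \<Phi> * I\<^sup>2"
    by (simp add: W_def algebra_simps)
  show "(fps_deriv S oo W) * fps_deriv W = 1"
    using arg_cong[OF SW, of fps_deriv] fps_compose_deriv[OF W0, of S] by simp
qed

text \<open>
  Let \<open>S\<close> be the inverse of \<open>W = z / \<Phi>\<close>. Differentiating \<open>S(W) = z\<close> and multiplying by \<open>\<Phi> ^ m\<close> expresses \<open>\<Phi> ^ m\<close> as
  the sum of the series \<open>(k + 1) * S\<^sub>k\<^sub>+\<^sub>1 * W ^ k * W' * \<Phi> ^ m\<close>. Only \<open>k = m - 1\<close> contributes to the coefficient of \<open>z ^ (m - 1)\<close>: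
  it would be the residue of \<open>W powi (k - m) * W'\<close>, which is a derivative for \<open>k < m - 1\<close>.
\<close>

theorem Lagrange_inversion:
  fixes \<Phi> :: "real fps"
  assumes "fps_nth \<Phi> 0 = 1" "m \<ge> 1"
  shows "real m * fps_nth (fps_inv (fps_X * inverse \<Phi>)) m = fps_nth (\<Phi> ^ m) (m - 1)"
proof -
  define I where "I = inverse \<Phi>"
  define W where "W = fps_X * I"
  define S where "S = fps_inv W"
  note facts = inverse_of_quotient[OF assms(1), folded I_def, folded W_def, folded S_def]
  note I = facts(1) and I0 = facts(2) and W0 = facts(3) and W' = facts(8) and one = facts(9)
  have key: "fps_nth (W ^ k * (fps_deriv W * \<Phi> ^ m)) (m - 1) = (if k = m - 1 then 1 else 0)"
    if "k \<le> m - 1" for k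
  proof -
    define j where "j = m - k"
    have j: "j \<ge> 1" "m = k + j" "m - 1 - k = j - 1" using that assms(2) by (auto simp: j_def)
    have "(I * \<Phi>) ^ k = 1" unfolding I by simp
    then have "W ^ k * (fps_deriv W * \<Phi> ^ m) = fps_X ^ k * (fps_deriv W * \<Phi> ^ j)"
      unfolding W_def j(2) power_add power_mult_distrib by (simp add: mult_ac)
    then have "fps_nth (W ^ k * (fps_deriv W * \<Phi> ^ m)) (m - 1) = fps_nth (fps_deriv W * \<Phi> ^ j) (j - 1)"
      using that j by (simp only: fps_X_power_mult_nth if_not_P not_less)
    also have "\<dots> = (if j = 1 then 1 else 0)"
    proof (cases "j = 1")
      case True
      then show ?thesis using I0 assms(1) by (simp add: W')
    next
      case False
      then obtain i where i: "j = Suc (Suc i)" using j by (metis Suc_diff_1 less_eq_Suc_le One_nat_def Suc_pred not0_implies_Suc)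
      \<comment> \<open>The multiple \<open>i + 1\<close> of this series is \<open>(i + 1) * f - XD f\<close> for \<open>f = \<Phi> ^ (i + 1)\<close>, which has no coefficient at \<open>i + 1\<close>.\<close>
      have "fps_deriv W * \<Phi> ^ j = (I * \<Phi>) * \<Phi> ^ Suc i - fps_X * (fps_deriv \<Phi> * \<Phi> ^ i) * (I * \<Phi>)\<^sup>2"
        unfolding W' i by (simp add: algebra_simps power2_eq_square)
      then have d: "fps_deriv W * \<Phi> ^ j = \<Phi> ^ Suc i - fps_X * (fps_deriv \<Phi> * \<Phi> ^ i)"
        unfolding I by simp
      have "fps_XD (\<Phi> ^ Suc i) = fps_const (real (Suc i)) * (fps_X * (fps_deriv \<Phi> * \<Phi> ^ i))"
        by (simp only: fps_XD_def o_apply fps_deriv_power diff_Suc_1 mult_ac)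
      then have "fps_const (real (Suc i)) * (fps_deriv W * \<Phi> ^ j) =
          fps_const (real (Suc i)) * \<Phi> ^ Suc i - fps_XD (\<Phi> ^ Suc i)"
        unfolding d by (simp only: right_diff_distrib)
      then have "fps_nth (fps_const (real (Suc i)) * (fps_deriv W * \<Phi> ^ j)) (Suc i) =
        fps_nth (fps_const (real (Suc i)) * \<Phi> ^ Suc i - fps_XD (\<Phi> ^ Suc i)) (Suc i)" by simp
      then have "real (Suc i) * fps_nth (fps_deriv W * \<Phi> ^ j) (Suc i) = 0"
        by (simp del: of_nat_Suc)
      then show ?thesis by (simp add: i del: of_nat_Suc)
    qed
    finally show ?thesis using j by auto
  qed
  have "fps_nth (\<Phi> ^ m) (m - 1) = fps_nth ((fps_deriv S oo W) * (fps_deriv W * \<Phi> ^ m)) (m - 1)"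
    using one by (simp flip: mult.assoc)
  also have "\<dots> = (\<Sum>k=0..m-1. if k = m - 1 then fps_nth (fps_deriv S) k else 0)"
    unfolding fps_compose_mult_nth[OF W0] using key by (intro sum.cong refl) auto
  also have "\<dots> = real m * fps_nth S m"
    using assms(2) by (simp add: sum.delta)
  finally show ?thesis by (simp add: S_def W_def I_def)
qed

section \<open>The total weight of the trees of a given size\<close>

lemma linear_ratio_iff:
  "linear_ratio \<Phi> b g \<longleftrightarrow> fps_deriv \<Phi> = fps_const b * \<Phi> + fps_const g * fps_XD \<Phi>"
  by (simp add: linear_ratio_def fps_eq_iff algebra_simps)

lemma linear_ratio_mult:
  assumes "linear_ratio \<Phi> b g" "linear_ratio \<Psi> c g"
  shows "linear_ratio (\<Phi> * \<Psi>) (b + c) g"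
proof -
  have "fps_XD (\<Phi> * \<Psi>) = fps_XD \<Phi> * \<Psi> + \<Phi> * fps_XD \<Psi>"
    by (simp add: fps_XD_def algebra_simps)
  then show ?thesis unfolding linear_ratio_iff fps_const_add[symmetric]
    using assms[unfolded linear_ratio_iff] by (simp only: fps_deriv_mult) (simp add: algebra_simps del: fps_const_add)
qed

lemma linear_ratio_power:
  assumes "linear_ratio \<Phi> b g"
  shows "linear_ratio (\<Phi> ^ m) (real m * b) g"
proof (induction m)
  case 0
  show ?case by (simp add: linear_ratio_iff fps_XD_def)
next
  case (Suc m)
  then show ?case using linear_ratio_mult[OF assms Suc] by (simp add: algebra_simps)
qed

lemma linear_ratio_nth:
  assumes "linear_ratio \<Phi> b g" "fps_nth \<Phi> 0 = 1"
  shows "fps_nth \<Phi> d = (\<Prod>j<d. b + g * real j) / fact d"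
proof (induction d)
  case (Suc d)
  have "real (Suc d) * fps_nth \<Phi> (Suc d) = (b + g * real d) * fps_nth \<Phi> d"
    using assms(1) by (simp only: linear_ratio_def)
  with Suc show ?case by (simp add: field_simps del: of_nat_Suc)
qed (use assms in simp)

text \<open>
  This is the equation \<open>z * T' * (1 - (b + g) * T) = T * (1 - g * T)\<close> on the level of coefficients.
\<close>

definition size_recurrence :: "real \<Rightarrow> real \<Rightarrow> real fps \<Rightarrow> bool" where
  "size_recurrence b g T \<longleftrightarrow> (\<forall>n. (real n - 1) * fps_nth T n =
     ((b + g) * real n - 2 * g) / 2 * fps_nth (T * T) n)"

lemma size_recurrence_iff:
  "size_recurrence b g T \<longleftrightarrow>
     fps_XD T - T = fps_const (b + g) * (fps_XD T * T) - fps_const g * (T * T)"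
proof -
  have XD: "fps_XD (T * T) = fps_const 2 * (fps_XD T * T)"
    by (simp add: fps_XD_def algebra_simps numeral_fps_const)
  have "real n * fps_nth (T * T) n = 2 * fps_nth (fps_XD T * T) n" for n
    using arg_cong[OF XD, of "\<lambda>f. fps_nth f n"] by simp
  note H = this
  have eq: "((b + g) * real n - 2 * g) / 2 * fps_nth (T * T) n =
      (b + g) * fps_nth (fps_XD T * T) n - g * fps_nth (T * T) n" for n
  proof -
    have "((b + g) * real n - 2 * g) / 2 * fps_nth (T * T) n =
        (b + g) / 2 * (real n * fps_nth (T * T) n) - g * fps_nth (T * T) n"
      by (simp add: field_simps)
    then show ?thesis unfolding H by simp
  qed
  show ?thesis
    by (simp only: size_recurrence_def fps_eq_iff eq fps_sub_nth fps_mult_left_const_nth fps_nth_XD)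
      (simp add: algebra_simps)
qed

lemma size_recurrence_unique:
  assumes A: "size_recurrence b g A" "fps_nth A 0 = 0"
    and B: "size_recurrence b g B" "fps_nth B 0 = 0" "fps_nth A 1 = fps_nth B 1"
  shows "A = B"
proof (rule fps_ext)
  fix n
  show "fps_nth A n = fps_nth B n"
  proof (induction n rule: less_induct)
    case (less n)
    show ?case
    proof (cases "n \<ge> 2")
      case True
      have "fps_nth (A * A) n = fps_nth (B * B) n"
        unfolding fps_mult_nth
      proof (intro sum.cong refl)
        fix i assume "i \<in> {0..n}"
        then consider "i = 0" | "i = n" | "i < n" "n - i < n" by fastforce
        then show "fps_nth A i * fps_nth A (n - i) = fps_nth B i * fps_nth B (n - i)"
          by cases (use less A B in auto)
      qed
      then have "(real n - 1) * fps_nth A n = (real n - 1) * fps_nth B n"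
        using A(1) B(1) by (simp only: size_recurrence_def)
      then show ?thesis using True by simp
    next
      case False
      then have "n = 0 \<or> n = 1" by auto
      then show ?thesis using A B by auto
    qed
  qed
qed

text \<open>
  In terms of \<open>t = T(z)\<close>, i.e. after the substitution \<open>z = t / \<Phi>(t)\<close>, the equation becomes an identity that
  follows from \<open>(1 - g * t) * \<Phi>' = b * \<Phi>\<close>.
\<close>

lemma size_recurrence_inverse:
  assumes lr: "linear_ratio \<Phi> b g" and \<Phi>0: "fps_nth \<Phi> 0 = 1"
  shows "size_recurrence b g (fps_inv (fps_X * inverse \<Phi>))"
proof -
  define I where "I = inverse \<Phi>"
  define W where "W = fps_X * I"
  define S where "S = fps_inv W"
  define P where "P = fps_deriv S oo W"
  note facts = inverse_of_quotient[OF \<Phi>0, folded I_def, folded W_def, folded S_def, folded P_def]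
  note I = facts(1) and W0 = facts(3) and SW = facts(5) and WS = facts(6) and S0 = facts(7)
    and W' = facts(8) and one = facts(9)
  let ?b = "fps_const b" and ?g = "fps_const g"
  have d\<Phi>: "(1 - ?g * fps_X) * fps_deriv \<Phi> = ?b * \<Phi>"
    using lr unfolding linear_ratio_iff fps_XD_def by (simp add: algebra_simps)
  have "(1 - ?g * fps_X) * fps_deriv W = (1 - ?g * fps_X) * I - fps_X * ((1 - ?g * fps_X) * fps_deriv \<Phi>) * I\<^sup>2"
    unfolding W' by (simp add: algebra_simps)
  also have "\<dots> = (1 - ?g * fps_X) * I - fps_X * ?b * I * (I * \<Phi>)"
    unfolding d\<Phi> by (simp add: algebra_simps power2_eq_square)
  also have "\<dots> = I * (1 - (?b + ?g) * fps_X)"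
    unfolding I by (simp add: algebra_simps del: fps_const_add)
  finally have W'': "(1 - ?g * fps_X) * fps_deriv W = I * (1 - (?b + ?g) * fps_X)" .
  have "fps_X * (1 - ?g * fps_X) = fps_X * (P * ((1 - ?g * fps_X) * fps_deriv W))"
  proof -
    have "P * ((1 - ?g * fps_X) * fps_deriv W) = (1 - ?g * fps_X) * (P * fps_deriv W)"
      by (simp only: mult_ac)
    then show ?thesis unfolding one by simp
  qed
  also have "\<dots> = W * P * (1 - (?b + ?g) * fps_X)"
    unfolding W'' unfolding W_def by (simp only: mult_ac)
  finally have eq: "W * P * (1 - (?b + ?g) * fps_X) = fps_X * (1 - ?g * fps_X)" ..
  define E where "E = fps_XD S - S - (fps_const (b + g) * (fps_XD S * S) - ?g * (S * S))"
  have XDS: "fps_XD S oo W = W * P"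
    by (simp add: fps_XD_def fps_compose_mult_distrib[OF W0] P_def W0)
  have "E oo W = W * P - fps_X - ((?b + ?g) * (W * P * fps_X) - ?g * (fps_X * fps_X))"
    unfolding E_def fps_compose_sub_distrib fps_compose_mult_distrib[OF W0] XDS SW by simp
  also have "\<dots> = W * P * (1 - (?b + ?g) * fps_X) - fps_X * (1 - ?g * fps_X)"
    by (simp add: algebra_simps)
  finally have "E oo W = 0" unfolding eq by simp
  then have "E oo (W oo S) = 0"
    using fps_compose_assoc[OF S0 W0, of E] by simp
  then have "E = 0" unfolding WS by simp
  then show ?thesis unfolding size_recurrence_iff E_def S_def W_def I_def by simp
qed

lemma trees_of_size_1: "{t. num_nodes t = 1} = {Node []}"
proof (intro equalityI subsetI)
  fix t assume "t \<in> {t. num_nodes t = 1}"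
  then obtain ts where t: "t = Node ts" "sum_list (map num_nodes ts) = 0" by (cases t) auto
  then have "ts = []"
  proof (cases ts)
    case (Cons a us)
    then show ?thesis using t(2) num_nodes_pos[of a] by (simp del: num_nodes_pos)
  qed simp
  then show "t \<in> {Node []}" using t by simp
qed simp

lemma total_weight_1: "fps_nth \<Phi> 0 = 1 \<Longrightarrow> total_weight \<Phi> 1 = 1"
  unfolding total_weight_def trees_of_size_1 by simp

lemma total_weight_0: "total_weight \<Phi> 0 = 0"
  using moment_fps_nth_0[of \<Phi> undefined 0] by (simp only: moment_fps_0_nth)

lemma size_recurrence_total_weight:
  assumes lr: "linear_ratio \<Phi> b g"
  shows "size_recurrence b g (Abs_fps (total_weight \<Phi>))"
proof -
  have M: "moment_fps \<Phi> (\<lambda>_. 0) 0 = Abs_fps (total_weight \<Phi>)"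
    by (rule fps_ext) (simp add: moment_fps_0_nth)
  have "(real n - 1) * total_weight \<Phi> n =
     ((b + g) * real n - 2 * g) / 2 * fps_nth (Abs_fps (total_weight \<Phi>) * Abs_fps (total_weight \<Phi>)) n" for n
  proof (cases "n \<ge> 2")
    case True
    from moment_fps_recurrence[OF lr this, of "\<lambda>_. 0" 0] show ?thesis by (simp add: M)
  next
    case False
    then have "n = 0 \<or> n = 1" by auto
    then show ?thesis by (auto simp: fps_mult_nth total_weight_0)
  qed
  then show ?thesis by (simp add: size_recurrence_def)
qed

text \<open>
  The recurrence has only one solution with the initial values \<open>0\<close> and \<open>1\<close>, hence the weights are the
  coefficients of the inverse of \<open>z / \<Phi>\<close>. By Lagrange inversion they are given by coefficients of \<open>\<Phi> ^ n\<close>,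
  and \<open>\<Phi> ^ n\<close> satisfies the relation of \<open>\<Phi>\<close> with \<open>n * b\<close> in place of \<open>b\<close>.
\<close>

theorem total_weight_eq:
  assumes lr: "linear_ratio \<Phi> b g" and \<Phi>0: "fps_nth \<Phi> 0 = 1" and n: "n \<ge> 1"
  shows "total_weight \<Phi> n = (\<Prod>j<n-1. real n * b + g * real j) / fact n"
proof -
  let ?S = "fps_inv (fps_X * inverse \<Phi>)"
  have W: "fps_nth (fps_X * inverse \<Phi>) 0 = 0" "fps_nth (fps_X * inverse \<Phi>) 1 = 1"
    using \<Phi>0 by simp_all
  have S1: "fps_nth ?S 1 = 1" using Lagrange_inversion[OF \<Phi>0, of 1] \<Phi>0 by simp
  have "Abs_fps (total_weight \<Phi>) = ?S"
    by (rule size_recurrence_unique[OF size_recurrence_total_weight[OF lr] _ size_recurrence_inverse[OF lr \<Phi>0]])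
      (use S1 total_weight_1[OF \<Phi>0] in \<open>simp_all add: total_weight_0 fps_inv_def\<close>)
  then have "total_weight \<Phi> n = fps_nth ?S n" by (metis fps_nth_Abs_fps)
  then have "real n * total_weight \<Phi> n = fps_nth (\<Phi> ^ n) (n - 1)"
    using Lagrange_inversion[OF \<Phi>0 n] by simp
  also have "\<dots> = (\<Prod>j<n-1. real n * b + g * real j) / fact (n - 1)"
    using \<Phi>0 by (intro linear_ratio_nth linear_ratio_power lr) (simp add: fps_nth_power_0)
  finally show ?thesis using n by (cases n) (simp_all add: field_simps del: of_nat_Suc)
qed

section \<open>Stirling's formula\<close>

text \<open>
  The differences of \<open>ln n! - (n + 1/2) * ln n + n\<close> are \<open>O(1 / n\<^sup>2)\<close>, so the quotient has a positive limit \<open>C\<close>.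
  Comparing \<open>n\<close> with \<open>2 * n\<close> by means of \<open>(2 * n)! = 4 ^ n * pochhammer (1/2) n * n!\<close> identifies it,
  since \<open>pochhammer (1/2) n / n!\<close> is a coefficient of a model series.
\<close>

theorem Stirling:
  "(\<lambda>n. fact n / (real n powr (real n + 1 / 2) * exp (- real n))) \<longlonglongrightarrow> sqrt (2 * pi)"
proof -
  define L where "L n = ln (fact n :: real) - (real n + 1 / 2) * ln (real n) + real n" for n
  define A where "A n = fact n / (real n powr (real n + 1 / 2) * exp (- real n))" for n
  have AL: "A n = exp (L n)" if "n > 0" for n
  proof -
    have "exp (L n) = exp (ln (fact n)) / exp ((real n + 1 / 2) * ln (real n)) * exp (real n)"
      by (simp only: L_def exp_add exp_diff)
    then show ?thesis using that by (simp add: A_def powr_def exp_minus field_simps)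
  qed
  have "eventually (\<lambda>n. L (Suc n) - L n = 1 - (real n + 1 / 2) * (ln (real n + 1) - ln (real n))) sequentially"
    using eventually_gt_at_top[of 0]
  proof eventually_elim
    case (elim n)
    have "ln (fact (Suc n) :: real) = ln (real (Suc n)) + ln (fact n)"
      by (simp add: ln_mult_pos del: of_nat_Suc)
    then show ?case by (simp add: L_def algebra_simps)
  qed
  moreover have "(\<lambda>n. 1 - (real n + 1 / 2) * (ln (real n + 1) - ln (real n))) \<in> O(\<lambda>n. 1 / real n ^ 2)"
    by real_asymp
  ultimately have "(\<lambda>n. L (Suc n) - L n) \<in> O(\<lambda>n. 1 / real n ^ 2)"
    by (rule landau_o.big.in_cong[THEN iffD2])
  moreover have "summable (\<lambda>n. norm (1 / real n ^ 2))"
    using inverse_power_summable[of 2, where 'a = real] by (simp add: divide_inverse)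
  ultimately have "summable (\<lambda>n. L (Suc n) - L n)"
    by (rule summable_comparison_test_bigo[rotated])
  then have "(\<lambda>n. \<Sum>k<n. L (Suc k) - L k) \<longlonglongrightarrow> (\<Sum>k. L (Suc k) - L k)"
    by (rule summable_LIMSEQ)
  then have "(\<lambda>n. L n - L 0) \<longlonglongrightarrow> (\<Sum>k. L (Suc k) - L k)"
    by (simp only: sum_lessThan_telescope)
  then have "L \<longlonglongrightarrow> (\<Sum>k. L (Suc k) - L k) + L 0"
    using tendsto_add[OF _ tendsto_const[of "L 0"]] by fastforce
  then have "(\<lambda>n. exp (L n)) \<longlonglongrightarrow> exp ((\<Sum>k. L (Suc k) - L k) + L 0)" by (rule tendsto_exp)
  then obtain C where C: "C > 0" "(\<lambda>n. exp (L n)) \<longlonglongrightarrow> C" using exp_gt_zero by blast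
  have A: "A \<longlonglongrightarrow> C"
    using C(2) by (rule Lim_transform_eventually)
      (use eventually_gt_at_top[of 0] in \<open>eventually_elim, simp add: AL\<close>)
  have "(\<lambda>n. A (2 * n)) \<longlonglongrightarrow> C"
    using LIMSEQ_subseq_LIMSEQ[OF A, of "(*) 2"] by (simp add: o_def strict_mono_def)
  then have "(\<lambda>n. A (2 * n) / (A n * A n)) \<longlonglongrightarrow> C / (C * C)"
    using C A by (intro tendsto_intros) auto
  moreover have "eventually (\<lambda>n. A (2 * n) / (A n * A n) =
      fps_nth (model_fps (1 / 2)) n * real n powr (- (1 / 2 - 1)) / sqrt 2) sequentially"
    using eventually_gt_at_top[of 0]
  proof eventually_elim
    case (elim n)
    let ?N = "real n ^ n"
    have "real (2 * n) powr (real (2 * n) + 1 / 2) = real (2 * n) ^ (2 * n) * sqrt (real (2 * n))"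
      using elim unfolding powr_add by (subst powr_realpow, simp, subst powr_half_sqrt) simp_all
    also have "real (2 * n) ^ (2 * n) = 2 ^ (2 * n) * (?N * ?N)"
      unfolding power_add[symmetric] mult_2[symmetric] of_nat_mult power_mult_distrib by simp
    also have "sqrt (real (2 * n)) = sqrt 2 * sqrt (real n)" by (simp add: real_sqrt_mult)
    finally have 1: "real (2 * n) powr (real (2 * n) + 1 / 2) = 2 ^ (2 * n) * (?N * ?N) * (sqrt 2 * sqrt (real n))" .
    have 2: "real n powr (real n + 1 / 2) = ?N * sqrt (real n)"
      using elim unfolding powr_add by (subst powr_realpow, simp, subst powr_half_sqrt) simp_all
    have 3: "real n powr (- (1 / 2 - 1)) = sqrt (real n)"
      using powr_half_sqrt[of "real n"] by simp
    have 4: "exp (- real (2 * n)) = exp (- real n) * exp (- real n)" by (simp flip: exp_add)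
    have 5: "(q * p * f) / ((q * (N * N) * (w * r)) * (E * E)) / ((f / (N * r * E)) * (f / (N * r * E))) = p / f * r / w"
      if "q > 0" "f > 0" "N > 0" "w > 0" "r > 0" "E > 0" for q p f N w r E :: real
      using that by (simp add: divide_simps)
    show ?case unfolding A_def 1 2 3 4 fact_double model_fps_nth
      by (rule 5) (use elim in simp_all)
  qed
  ultimately have "(\<lambda>n. fps_nth (model_fps (1 / 2)) n * real n powr (- (1 / 2 - 1)) / sqrt 2) \<longlonglongrightarrow> C / (C * C)"
    by (rule Lim_transform_eventually)
  moreover have "(\<lambda>n. fps_nth (model_fps (1 / 2)) n * real n powr (- (1 / 2 - 1)) / sqrt 2) \<longlonglongrightarrow> rGamma (1 / 2) / sqrt 2"
    using coeff_asymp_model[of "1 / 2", unfolded coeff_asymp_def] by (intro tendsto_divide) auto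
  ultimately have "C / (C * C) = rGamma (1 / 2) / sqrt 2" by (rule LIMSEQ_unique)
  then have "1 / C = 1 / (sqrt pi * sqrt 2)"
    using C(1) by (simp add: rGamma_inverse_Gamma Gamma_one_half_real field_simps)
  then have "C = sqrt (2 * pi)" using C(1) by (simp add: real_sqrt_mult field_simps)
  with A show ?thesis unfolding A_def[abs_def] by simp
qed

section \<open>Asymptotics of the total weights\<close>

text \<open>
  Regarded as a function of the right end point \<open>t\<close>, the error vanishes at \<open>t = a\<close> and has the derivative
  \<open>(f t - f a - (t - a) * f1 t) / 2\<close>, which the mean value theorem bounds by a multiple of \<open>h\<^sup>2\<close>.
\<close>

lemma trapezoid_step:
  fixes F f f1 f2 :: "real \<Rightarrow> real"
  assumes F: "\<And>x. x \<in> {a..a + h} \<Longrightarrow> (F has_real_derivative f x) (at x)"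
    and f: "\<And>x. x \<in> {a..a + h} \<Longrightarrow> (f has_real_derivative f1 x) (at x)"
    and f1: "\<And>x. x \<in> {a..a + h} \<Longrightarrow> (f1 has_real_derivative f2 x) (at x)"
    and M: "\<And>x. x \<in> {a..a + h} \<Longrightarrow> \<bar>f2 x\<bar> \<le> M" and h: "h > 0"
  shows "\<bar>F (a + h) - F a - h * (f a + f (a + h)) / 2\<bar> \<le> M * h ^ 3"
proof -
  let ?d = "\<lambda>t. (f t - f a - (t - a) * f1 t) / 2"
  define \<phi> where "\<phi> t = F t - F a - (t - a) * (f a + f t) / 2" for t
  have M0: "M \<ge> 0" using M[of a] h by auto
  have d: "(\<phi> has_real_derivative ?d t) (at t)" if "t \<in> {a..a + h}" for t
    unfolding \<phi>_def using F[OF that] f[OF that] that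
    by (auto intro!: derivative_eq_intros simp: field_simps)
  have bound: "\<bar>?d t\<bar> \<le> M * h\<^sup>2" if t: "a < t" "t < a + h" for t
  proof -
    obtain x where x: "a < x" "x < t" "f t - f a = (t - a) * f1 x"
      using MVT2[OF t(1), of f f1] f t by auto
    obtain y where y: "x < y" "y < t" "f1 t - f1 x = (t - x) * f2 y"
      using MVT2[OF x(2), of f1 f2] f1 t x by auto
    have "f t - f a - (t - a) * f1 t = - ((t - a) * ((t - x) * f2 y))"
      unfolding x(3) y(3)[symmetric] by (simp add: algebra_simps)
    then have "\<bar>f t - f a - (t - a) * f1 t\<bar> = (t - a) * ((t - x) * \<bar>f2 y\<bar>)"
      using t x by (simp add: abs_mult)
    also have "\<dots> \<le> h * (h * M)"
      using t x y h M[of y] by (intro mult_mono) auto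
    finally show ?thesis using M0 h by (simp add: power2_eq_square abs_divide) (smt (verit) mult.assoc mult.commute mult_nonneg_nonneg)
  qed
  obtain t where t: "a < t" "t < a + h" "\<phi> (a + h) - \<phi> a = h * (?d t)"
    using MVT2[of a "a + h" \<phi> "\<lambda>t. ?d t"] d h by auto
  have "\<bar>\<phi> (a + h) - \<phi> a\<bar> = h * \<bar>?d t\<bar>"
    unfolding t(3) using h by (simp add: abs_mult)
  also have "\<dots> \<le> h * (M * h\<^sup>2)" using h bound[OF t(1,2)] by (intro mult_left_mono) auto
  finally show ?thesis by (simp add: \<phi>_def power2_eq_square power3_eq_cube mult_ac)
qed

lemma trapezoid_sum:
  fixes F f f1 f2 :: "real \<Rightarrow> real"
  assumes F: "\<And>x. x \<in> {0..1} \<Longrightarrow> (F has_real_derivative f x) (at x)"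
    and f: "\<And>x. x \<in> {0..1} \<Longrightarrow> (f has_real_derivative f1 x) (at x)"
    and f1: "\<And>x. x \<in> {0..1} \<Longrightarrow> (f1 has_real_derivative f2 x) (at x)"
    and M: "\<And>x. x \<in> {0..1} \<Longrightarrow> \<bar>f2 x\<bar> \<le> M"
  shows "(\<lambda>n. (\<Sum>j<n. f (real j / real n)) - real n * (F 1 - F 0)) \<longlonglongrightarrow> (f 0 - f 1) / 2"
proof -
  let ?err = "\<lambda>n. (\<Sum>j<n. f (real j / real n)) - real n * (F 1 - F 0) - (f 0 - f 1) / 2"
  have "\<bar>?err n\<bar> \<le> M / real n"
    if n: "n > 0" for n
  proof -
    let ?x = "\<lambda>j. real j / real n"
    have step: "\<bar>F (?x (Suc j)) - F (?x j) - (f (?x j) + f (?x (Suc j))) / (2 * real n)\<bar> \<le> M / real n ^ 3"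
      if j: "j < n" for j
    proof -
      have e: "?x j + 1 / real n = ?x (Suc j)" by (simp add: add_divide_distrib)
      have sub: "{?x j..?x j + 1 / real n} \<subseteq> {0..1}" unfolding e using j by (auto simp: field_simps)
      then have "\<bar>F (?x j + 1 / real n) - F (?x j) - 1 / real n * (f (?x j) + f (?x j + 1 / real n)) / 2\<bar>
          \<le> M * (1 / real n) ^ 3"
        using n by (intro trapezoid_step[of _ _ F f f1 f2]) (use F f f1 M subsetD[OF sub] n in \<open>blast | simp\<close>)+
      then show ?thesis unfolding e by (simp add: power_divide mult.commute)
    qed
    have "(\<Sum>j<n. F (?x (Suc j)) - F (?x j) - (f (?x j) + f (?x (Suc j))) / (2 * real n))
      = (F 1 - F 0) - (\<Sum>j<n. f (?x j) + f (?x (Suc j))) / (2 * real n)"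
      using n unfolding sum_subtractf[of _ "\<lambda>j. (f (?x j) + f (?x (Suc j))) / (2 * real n)"]
        sum_lessThan_telescope[of "\<lambda>j. F (?x j)"] by (simp add: sum_divide_distrib)
    also have "(\<Sum>j<n. f (?x j) + f (?x (Suc j))) = 2 * (\<Sum>j<n. f (?x j)) + (f 1 - f 0)"
      using sum_lessThan_telescope[of "\<lambda>j. f (?x j)" n] n by (simp add: sum.distrib sum_subtractf)
    finally have eq: "(\<Sum>j<n. F (?x (Suc j)) - F (?x j) - (f (?x j) + f (?x (Suc j))) / (2 * real n))
      = - ((\<Sum>j<n. f (?x j)) - real n * (F 1 - F 0) - (f 0 - f 1) / 2) / real n"
      using n by (simp add: field_simps)
    have "\<bar>(\<Sum>j<n. f (?x j)) - real n * (F 1 - F 0) - (f 0 - f 1) / 2\<bar> / real n =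
      \<bar>\<Sum>j<n. F (?x (Suc j)) - F (?x j) - (f (?x j) + f (?x (Suc j))) / (2 * real n)\<bar>"
      unfolding eq abs_divide abs_minus_cancel by simp
    also have "\<dots> \<le> (\<Sum>j<n. M / real n ^ 3)"
      by (rule order_trans[OF sum_abs sum_mono]) (use step in auto)
    also have "\<dots> = M / real n / real n" using n by (simp add: power3_eq_cube)
    finally show ?thesis using n by (simp only: divide_le_cancel)
  qed
  then have "eventually (\<lambda>n. norm (?err n)
      \<le> M / real n) sequentially"
    by (intro eventually_mono[OF eventually_gt_at_top[of 0]]) simp
  then have "(\<lambda>n. ?err n) \<longlonglongrightarrow> 0"
    by (rule Lim_null_comparison) (rule lim_const_over_n)
  then show ?thesis by (simp add: LIM_zero_iff)
qed

text \<open>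
  The product in \<open>total_weight_eq\<close> is the exponential of a sum of \<open>ln (b + g * x)\<close> over the points
  \<open>x = j / n\<close>, and \<open>b + g * x\<close> is positive on the unit interval. The trapezoidal rule evaluates the sum up to
  \<open>o(1)\<close>; the integral of the logarithm and the factor \<open>exp (- n)\<close> of Stirling's formula make up \<open>\<rho>\<close>.
\<close>

theorem total_weight_asymp:
  assumes lr: "linear_ratio \<Phi> b g" and \<Phi>0: "fps_nth \<Phi> 0 = 1" and b: "b > 0" and bg: "b + g > 0"
  obtains \<rho> where "\<rho> > 0" "coeff_asymp (Abs_fps (\<lambda>n. total_weight \<Phi> n * \<rho> ^ n)) (- 3 / 2)
    (sqrt (b / (2 * pi * (b + g) ^ 3)))"
proof -
  define f where "f x = ln (b + g * x)" for x
  have pos: "b + g * x > 0" if "x \<in> {0..1}" for x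
  proof -
    have eq: "b + g * x = b * (1 - x) + (b + g) * x" by (simp add: algebra_simps)
    show ?thesis
    proof (cases "x = 1")
      case False
      then have "b * (1 - x) > 0" "(b + g) * x \<ge> 0" using that b bg by auto
      then show ?thesis unfolding eq by linarith
    qed (use bg in simp)
  qed
  obtain F where F: "\<And>x. x \<in> {0..1} \<Longrightarrow> (F has_real_derivative f x) (at x)"
  proof (cases "g = 0")
    case True
    show ?thesis by (rule that[of "\<lambda>x. x * ln b"]) (auto intro!: derivative_eq_intros simp: f_def True)
  next
    case False
    show ?thesis
    proof (rule that[of "\<lambda>x. ((b + g * x) * ln (b + g * x) - (b + g * x)) / g"])
      fix x :: real assume "x \<in> {0..1}"
      then have p: "b + g * x > 0" by (rule pos)
      have "((\<lambda>x. ((b + g * x) * ln (b + g * x) - (b + g * x)) / g) has_real_derivative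
          (g * ln (b + g * x) + (b + g * x) * (g / (b + g * x)) - g) / g) (at x)"
        using p False by (auto intro!: derivative_eq_intros)
      then show "((\<lambda>x. ((b + g * x) * ln (b + g * x) - (b + g * x)) / g) has_real_derivative f x) (at x)"
        using p False by (simp add: f_def)
    qed
  qed
  define M where "M = g\<^sup>2 / (min b (b + g))\<^sup>2"
  have lim: "(\<lambda>n. (\<Sum>j<n. f (real j / real n)) - real n * (F 1 - F 0)) \<longlonglongrightarrow> (f 0 - f 1) / 2"
  proof (rule trapezoid_sum[of F f "\<lambda>x. g / (b + g * x)" "\<lambda>x. - (g\<^sup>2 / (b + g * x)\<^sup>2)" M])
    fix x :: real assume x: "x \<in> {0..1}"
    show "(f has_real_derivative g / (b + g * x)) (at x)"
      unfolding f_def using pos[OF x] by (auto intro!: derivative_eq_intros)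
    show "((\<lambda>x. g / (b + g * x)) has_real_derivative - (g\<^sup>2 / (b + g * x)\<^sup>2)) (at x)"
      using pos[OF x] by (auto intro!: derivative_eq_intros simp: power2_eq_square)
    have "min b (b + g) \<le> b + g * x"
      using x by (cases "g \<ge> 0") (auto simp: min_def mult_left_le mult_nonneg_nonneg mult_left_mono_neg[of x 1 g] split: if_splits)
    then show "\<bar>- (g\<^sup>2 / (b + g * x)\<^sup>2)\<bar> \<le> M"
      unfolding M_def using b bg pos[OF x] by (auto intro!: divide_left_mono power_mono mult_pos_pos simp: abs_divide)
  qed (rule F)
  define \<rho> where "\<rho> = exp (- (1 + (F 1 - F 0)))"
  define S where "S n = (\<Sum>j<n. f (real j / real n)) - real n * (F 1 - F 0)" for n
  define A where "A n = fact n / (real n powr (real n + 1 / 2) * exp (- real n))" for n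
  have "(\<lambda>n. exp (S n) / (b + g * (1 - 1 / real n)) / A n) \<longlonglongrightarrow>
      exp ((f 0 - f 1) / 2) / (b + g * (1 - 0)) / sqrt (2 * pi)"
    unfolding A_def using lim bg
    by (intro tendsto_intros Stirling lim_const_over_n) (auto simp: S_def)
  moreover have "eventually (\<lambda>n. exp (S n) / (b + g * (1 - 1 / real n)) / A n =
      total_weight \<Phi> n * \<rho> ^ n * real n powr (3 / 2)) sequentially"
    using eventually_gt_at_top[of 0]
  proof eventually_elim
    case (elim n)
    then obtain m where m: "n = Suc m" by (cases n) auto
    have "exp (\<Sum>j<n. f (real j / real n)) = (\<Prod>j<n. b + g * (real j / real n))"
      unfolding exp_sum[OF finite_lessThan] f_def
      by (intro prod.cong refl exp_ln pos) (auto simp: divide_le_eq_1)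
    also have "\<dots> = (\<Prod>j<m. (real n * b + g * real j) / real n) * (b + g * (real m / real n))"
      unfolding m prod.lessThan_Suc by (intro arg_cong2[of _ _ _ _ "(*)"] prod.cong refl) (simp add: field_simps)
    also have "real m / real n = 1 - 1 / real n" by (simp add: m field_simps)
    also have "(\<Prod>j<m. (real n * b + g * real j) / real n) = total_weight \<Phi> n * fact n / real n ^ m"
      using total_weight_eq[OF lr \<Phi>0, of n] m by (simp add: prod_dividef)
    finally have e: "exp (\<Sum>j<n. f (real j / real n)) = total_weight \<Phi> n * fact n / real n ^ m * (b + g * (1 - 1 / real n))" .
    have nz: "b + g * (1 - 1 / real n) > 0" by (rule pos) (use elim in auto)
    have \<rho>: "\<rho> ^ n = exp (- real n) / exp (real n * (F 1 - F 0))"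
      unfolding \<rho>_def by (simp add: exp_diff[symmetric] exp_of_nat_mult[symmetric] algebra_simps)
    have p: "real n powr (real n + 1 / 2) = real n ^ m * real n powr (3 / 2)"
    proof -
      have "real n powr (real n + 1 / 2) = real n powr (real m + 3 / 2)"
        by (rule arg_cong[where f = "(powr) _"]) (simp add: m)
      then show ?thesis using elim by (simp add: powr_add powr_realpow)
    qed
    have q: "(w * f / W * h / X) / h / (f / (W * P * E)) = w * (E / X) * P"
      if "f > 0" "W > 0" "h > 0" "X > 0" "P > 0" "E > 0" for w f W h X P E :: real
      using that by (simp add: divide_simps)
    show ?case unfolding S_def exp_diff e A_def \<rho> p
      by (rule q) (use nz elim in simp_all)
  qed
  ultimately have "(\<lambda>n. total_weight \<Phi> n * \<rho> ^ n * real n powr (3 / 2)) \<longlonglongrightarrow>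
      exp ((f 0 - f 1) / 2) / (b + g * (1 - 0)) / sqrt (2 * pi)"
    by (rule Lim_transform_eventually)
  also have "exp ((f 0 - f 1) / 2) = sqrt (b / (b + g))"
    using b bg powr_half_sqrt[of "b / (b + g)"] by (simp add: f_def powr_def ln_div)
  also have "sqrt (b / (b + g)) / (b + g * (1 - 0)) / sqrt (2 * pi) = sqrt (b / (2 * pi * (b + g) ^ 3))"
  proof -
    have "b / (2 * pi * (b + g) ^ 3) = b / (b + g) / (b + g)\<^sup>2 / (2 * pi)"
      by (simp add: power3_eq_cube power2_eq_square)
    then show ?thesis using bg by (simp only: real_sqrt_divide) simp
  qed
  finally show ?thesis
    using that[of \<rho>] by (simp add: coeff_asymp_def \<rho>_def)
qed

section \<open>The three types of very simple families\<close>

lemma linear_ratio_exp: "linear_ratio (fps_exp b) b 0"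
  by (simp add: linear_ratio_iff)

lemma linear_ratio_linear: "linear_ratio (1 + fps_const a * fps_X) a (- a)"
proof -
  have "fps_XD (1 + fps_const a * fps_X) = fps_const a * fps_X" by (simp add: fps_XD_def mult.commute)
  then show ?thesis unfolding linear_ratio_iff by (simp add: algebra_simps fps_const_neg[symmetric] del: fps_const_neg)
qed

lemma linear_ratio_binomial:
  assumes "c \<noteq> 0"
  shows "linear_ratio (fps_binomial (- b / c) oo (- (fps_const c * fps_X))) b c"
proof -
  have "- (fps_const c * fps_X) = fps_const (- c) * fps_X"
    by (simp flip: fps_const_neg)
  then have nth: "fps_nth (fps_binomial (- b / c) oo (- (fps_const c * fps_X))) n = (- c) ^ n * ((- b / c) gchoose n)" for n
    by (simp only: fps_compose_linear fps_nth_Abs_fps fps_binomial_nth)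
  have "real (Suc k) * ((- c) ^ Suc k * ((- b / c) gchoose Suc k)) = (b + c * real k) * ((- c) ^ k * ((- b / c) gchoose k))" for k
  proof -
    have "real (Suc k) * ((- b / c) gchoose Suc k) = (- b / c - real k) * ((- b / c) gchoose k)"
      using gbinomial_mult_1[of "- b / c" k] by (simp add: algebra_simps)
    then have "real (Suc k) * ((- c) ^ Suc k * ((- b / c) gchoose Suc k)) = (- c) ^ Suc k * ((- b / c - real k) * ((- b / c) gchoose k))"
      by (metis mult.left_commute)
    also have "\<dots> = (- c * (- b / c - real k)) * ((- c) ^ k * ((- b / c) gchoose k))" by simp
    also have "- c * (- b / c - real k) = b + c * real k" using assms by (simp add: field_simps)
    finally show ?thesis .
  qed
  then show ?thesis unfolding linear_ratio_def nth by blast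
qed

theorem very_simple_linear_ratio:
  assumes "very_simple \<Phi>"
  obtains b g where "linear_ratio \<Phi> b g" "b > 0" "b + g > 0" "fps_nth \<Phi> 0 = 1" "\<And>k. fps_nth \<Phi> k \<ge> 0"
proof -
  define b where "b = coeff_ratio \<Phi> 0"
  have base: "fps_nth \<Phi> 0 = 1" "\<And>k. fps_nth \<Phi> k \<ge> 0" "b > 0"
    and types: "very_simple_A \<Phi> \<or> very_simple_B \<Phi> \<or> very_simple_C \<Phi>"
    using assms by (auto simp: very_simple_def b_def)
  have "\<exists>g. linear_ratio \<Phi> b g \<and> b + g > 0"
    using types
  proof (elim disjE)
    assume "very_simple_A \<Phi>"
    then have "\<Phi> = fps_exp b" by (simp only: very_simple_A_def b_def)
    then show ?thesis using linear_ratio_exp[of b] base(3) by (intro exI[of _ 0]) simp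
  next
    assume "very_simple_B \<Phi>"
    then obtain d where d: "d \<ge> 2" "\<Phi> = (1 + fps_const (b / real d) * fps_X) ^ d"
      unfolding very_simple_B_def b_def by blast
    have "linear_ratio \<Phi> b (- (b / real d))"
      using linear_ratio_power[OF linear_ratio_linear[of "b / real d"], of d] d by simp
    moreover have "b + - (b / real d) > 0" using d(1) base(3) by (simp add: divide_less_eq)
    ultimately show ?thesis by blast
  next
    assume "very_simple_C \<Phi>"
    then obtain c where c: "c > 0" "\<Phi> = fps_binomial (- b / c) oo (- (fps_const c * fps_X))"
      unfolding very_simple_C_def b_def Let_def by blast
    have "linear_ratio \<Phi> b c" unfolding c(2) using c(1) by (intro linear_ratio_binomial) simp
    then show ?thesis using c(1) base(3) by (intro exI[of _ c]) simp
  qed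
  with base show ?thesis using that by blast
qed

text \<open>
  A ratio test; where the ratio \<open>(b + g * k) / (k + 1)\<close> is negative, in type B, both coefficients vanish.
\<close>

lemma linear_ratio_conv_radius:
  assumes lr: "linear_ratio \<Phi> b g" and b: "b > 0" and bg: "b + g > 0"
    and nn: "\<And>k. fps_nth \<Phi> k \<ge> 0"
  shows "ereal (1 / (b + g)) < fps_conv_radius \<Phi>"
proof -
  define h where "h = max g 0"
  have "h * (1 / (b + g)) < 1" unfolding h_def using b bg by (auto simp: max_def divide_less_eq)
  moreover have "((\<lambda>r. h * r) \<longlongrightarrow> h * (1 / (b + g))) (at_right (1 / (b + g)))"
    by (intro tendsto_intros)
  ultimately have "eventually (\<lambda>r. h * r < 1) (at_right (1 / (b + g)))"
    by (rule order_tendstoD(2)[rotated])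
  then have "eventually (\<lambda>r. h * r < 1 \<and> r > 1 / (b + g)) (at_right (1 / (b + g)))"
    by (intro eventually_conj eventually_at_right_less)
  then obtain r where r: "h * r < 1" "r > 1 / (b + g)"
    using eventually_happens'[OF trivial_limit_at_right_real] by blast
  have r0: "r > 0" using r(2) bg by (smt (verit) divide_pos_pos)
  have lim: "(\<lambda>k. (b / (real k + 1) + h) * r) \<longlonglongrightarrow> (0 + h) * r"
    by (intro tendsto_intros) real_asymp
  define c where "c = (1 + h * r) / 2"
  have c: "c < 1" "(0 + h) * r < c" using r by (auto simp: c_def)
  have "eventually (\<lambda>k. (b / (real k + 1) + h) * r < c) sequentially"
    by (rule order_tendstoD(2)[OF lim c(2)])
  then obtain N where N: "\<And>k. k \<ge> N \<Longrightarrow> (b / (real k + 1) + h) * r < c"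
    by (auto simp: eventually_sequentially)
  have "summable (\<lambda>k. fps_nth \<Phi> k * r ^ k)"
  proof (rule summable_ratio_test[OF c(1)])
    fix k assume k: "N \<le> k"
    have "real (Suc k) * fps_nth \<Phi> (Suc k) = (b + g * real k) * fps_nth \<Phi> k"
      using lr by (simp only: linear_ratio_def)
    then have "fps_nth \<Phi> (Suc k) = (b + g * real k) / (real k + 1) * fps_nth \<Phi> k"
      by (simp add: field_simps)
    also have "\<dots> \<le> (b / (real k + 1) + h) * fps_nth \<Phi> k"
    proof (intro mult_right_mono nn)
      have "g * real k \<le> h * (real k + 1)"
        unfolding h_def by (intro mult_mono) auto
      then show "(b + g * real k) / (real k + 1) \<le> b / (real k + 1) + h"
        by (simp add: divide_simps)
    qed
    finally have "fps_nth \<Phi> (Suc k) * r ^ Suc k \<le> (b / (real k + 1) + h) * fps_nth \<Phi> k * r ^ Suc k"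
      using r0 by (intro mult_right_mono) auto
    also have "\<dots> = (b / (real k + 1) + h) * r * (fps_nth \<Phi> k * r ^ k)" by simp
    also have "\<dots> \<le> c * (fps_nth \<Phi> k * r ^ k)"
      using N[OF k] nn[of k] r0 by (intro mult_right_mono) auto
    finally show "norm (fps_nth \<Phi> (Suc k) * r ^ Suc k) \<le> c * norm (fps_nth \<Phi> k * r ^ k)"
      using nn r0 by (simp add: abs_mult)
  qed
  then have "ereal (norm r) \<le> fps_conv_radius \<Phi>"
    unfolding fps_conv_radius_def by (rule conv_radius_geI)
  moreover have "ereal (1 / (b + g)) < ereal (norm r)" using r(2) r0 by simp
  ultimately show ?thesis by (rule less_le_trans[rotated])
qed

lemma linear_ratio_eval:
  fixes t :: real
  assumes lr: "linear_ratio \<Psi> b g" and t: "ereal \<bar>t\<bar> < fps_conv_radius \<Psi>"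
  shows "eval_fps (fps_deriv \<Psi>) t * (1 - g * t) = b * eval_fps \<Psi> t"
proof -
  have t': "ereal (norm t) < fps_conv_radius \<Psi>" using t by simp
  have td: "ereal (norm t) < fps_conv_radius (fps_deriv \<Psi>)"
    using t' fps_conv_radius_deriv[of \<Psi>] by (rule less_le_trans)
  have mult: "ereal (norm t) < fps_conv_radius (f * h)"
    if "ereal (norm t) < fps_conv_radius f" "ereal (norm t) < fps_conv_radius h" for f h :: "real fps"
    using that by (intro less_le_trans[OF _ fps_conv_radius_mult]) (simp add: min_def)
  have tX: "ereal (norm t) < fps_conv_radius (fps_X * fps_deriv \<Psi>)"
    using td by (intro mult) simp_all
  have "fps_deriv \<Psi> = fps_const b * \<Psi> + fps_const g * (fps_X * fps_deriv \<Psi>)"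
    using lr by (simp add: linear_ratio_iff fps_XD_def)
  then have "eval_fps (fps_deriv \<Psi>) t = eval_fps (fps_const b * \<Psi> + fps_const g * (fps_X * fps_deriv \<Psi>)) t"
    by (rule arg_cong)
  also have "\<dots> = eval_fps (fps_const b * \<Psi>) t + eval_fps (fps_const g * (fps_X * fps_deriv \<Psi>)) t"
    using t' td by (intro eval_fps_add mult) simp_all
  also have "\<dots> = b * eval_fps \<Psi> t + g * (t * eval_fps (fps_deriv \<Psi>) t)"
    using t' td tX by (simp add: eval_fps_mult)
  finally show ?thesis by (simp add: algebra_simps)
qed

text \<open>
  As \<open>(1 - g * t) * \<Phi>' = b * \<Phi>\<close> and \<open>\<Phi> > 0\<close>, the equation \<open>t * \<Phi>' = \<Phi>\<close> amounts to \<open>b * t = 1 - g * t\<close>. The derivative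
  \<open>\<Phi>'\<close> satisfies the same relation with \<open>b + g\<close> in place of \<open>b\<close>, which gives the second derivative.
\<close>

theorem char_tau_sigma:
  assumes lr: "linear_ratio \<Phi> b g" and b: "b > 0" and bg: "b + g > 0"
    and \<Phi>0: "fps_nth \<Phi> 0 = 1" and nn: "\<And>k. fps_nth \<Phi> k \<ge> 0"
  shows "char_tau \<Phi> = 1 / (b + g)" and "char_sigma \<Phi> = sqrt ((b + g) / b)"
proof -
  have pos: "eval_fps \<Phi> t > 0" if "0 < t" "ereal t < fps_conv_radius \<Phi>" for t
  proof -
    have "summable (\<lambda>n. fps_nth \<Phi> n * t ^ n)"
      using that by (intro summable_fps) simp
    moreover have "fps_nth \<Phi> n * t ^ n \<ge> 0" for n using nn that by simp
    ultimately show ?thesis unfolding eval_fps_def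
      using \<Phi>0 by (intro suminf_pos2[of _ 0]) auto
  qed
  have eq: "eval_fps (fps_deriv \<Phi>) t * (1 - g * t) = b * eval_fps \<Phi> t"
    if "0 < t" "ereal t < fps_conv_radius \<Phi>" for t
    using linear_ratio_eval[OF lr, of t] that by simp
  define \<tau> where "\<tau> = 1 / (b + g)"
  have \<tau>: "0 < \<tau>" "ereal \<tau> < fps_conv_radius \<Phi>"
    using linear_ratio_conv_radius[OF lr b bg nn] bg by (auto simp: \<tau>_def)
  have g\<tau>: "1 - g * \<tau> = b / (b + g)" using bg by (simp add: \<tau>_def field_simps)
  have d1: "eval_fps (fps_deriv \<Phi>) \<tau> = (b + g) * eval_fps \<Phi> \<tau>"
  proof -
    have "b * eval_fps (fps_deriv \<Phi>) \<tau> = b * ((b + g) * eval_fps \<Phi> \<tau>)"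
      using eq[OF \<tau>] b bg unfolding g\<tau> by (simp add: field_simps)
    then show ?thesis using b by simp
  qed
  have unique: "t = \<tau>" if "0 < t \<and> ereal t < fps_conv_radius \<Phi> \<and> t * eval_fps (fps_deriv \<Phi>) t = eval_fps \<Phi> t" for t
  proof -
    have e: "eval_fps (fps_deriv \<Phi>) t * (1 - g * t) = b * eval_fps \<Phi> t"
      using eq that by blast
    have "b * t * eval_fps \<Phi> t = t * (eval_fps (fps_deriv \<Phi>) t * (1 - g * t))"
      unfolding e by (simp only: mult_ac)
    also have "\<dots> = t * eval_fps (fps_deriv \<Phi>) t * (1 - g * t)" by (simp only: mult.assoc)
    also have "\<dots> = eval_fps \<Phi> t * (1 - g * t)" using that by simp
    finally have "b * t * eval_fps \<Phi> t = (1 - g * t) * eval_fps \<Phi> t" by (simp only: mult.commute)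
    moreover have "eval_fps \<Phi> t > 0" by (rule pos) (use that in auto)
    ultimately have "b * t = 1 - g * t" by (metis less_irrefl mult_right_cancel)
    then show ?thesis using bg by (simp add: \<tau>_def field_simps)
  qed
  show tau: "char_tau \<Phi> = 1 / (b + g)"
    unfolding char_tau_def \<tau>_def[symmetric]
  proof (rule the_equality)
    show "0 < \<tau> \<and> ereal \<tau> < fps_conv_radius \<Phi> \<and> \<tau> * eval_fps (fps_deriv \<Phi>) \<tau> = eval_fps \<Phi> \<tau>"
      using \<tau> d1 bg by (simp add: \<tau>_def)
  qed (rule unique)
  have lr': "linear_ratio (fps_deriv \<Phi>) (b + g) g"
  proof -
    have "fps_deriv \<Phi> = fps_const b * \<Phi> + fps_const g * (fps_X * fps_deriv \<Phi>)"
      using lr by (simp add: linear_ratio_iff fps_XD_def)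
    from arg_cong[OF this, of fps_deriv] show ?thesis
      unfolding linear_ratio_iff fps_XD_def fps_const_add[symmetric]
      by (simp add: algebra_simps del: fps_const_add)
  qed
  have "ereal \<bar>\<tau>\<bar> < fps_conv_radius (fps_deriv \<Phi>)"
    using \<tau> fps_conv_radius_deriv[of \<Phi>] by (auto intro: less_le_trans)
  from linear_ratio_eval[OF lr' this] have d2: "eval_fps (fps_deriv (fps_deriv \<Phi>)) \<tau> = (b + g)\<^sup>2 / b * ((b + g) * eval_fps \<Phi> \<tau>)"
    using b bg unfolding g\<tau> d1 by (simp add: field_simps power2_eq_square)
  have "(char_tau \<Phi>)\<^sup>2 * eval_fps (fps_deriv (fps_deriv \<Phi>)) (char_tau \<Phi>) / eval_fps \<Phi> (char_tau \<Phi>) = (b + g) / b"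
  proof -
    have "(1 / a)\<^sup>2 * (a\<^sup>2 / b * (a * e)) / e = a / b" if "a > 0" "e > 0" for a e :: real
      using that b by (simp add: field_simps power2_eq_square)
    from this[OF bg pos[OF \<tau>]] show ?thesis
      unfolding tau \<tau>_def[symmetric] d2 by (simp only: \<tau>_def)
  qed
  then show "char_sigma \<Phi> = sqrt ((b + g) / b)" unfolding char_sigma_def by simp
qed

section \<open>The transfer theorem\<close>

text \<open>
  The series \<open>U\<close> stands for the total weights, rescaled by powers of \<open>\<rho>\<close> such that they decay like \<open>n powr (- 3/2)\<close>.
\<close>

locale size_series =
  fixes b g c :: real and U :: "real fps"
  assumes b: "b > 0" and bg: "b + g > 0" and c: "c > 0"
    and U_rec: "size_recurrence b g U" and U0: "fps_nth U 0 = 0"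
    and U_pos: "\<And>n. n \<ge> 1 \<Longrightarrow> fps_nth U n > 0"
    and U_asymp: "coeff_asymp U (- 3 / 2) c"
begin

lemma kernel_pos: "n \<ge> 2 \<Longrightarrow> (b + g) * real n - 2 * g > 0"
proof -
  assume "n \<ge> 2"
  then have "(b + g) * 2 \<le> (b + g) * real n" using bg by (intro mult_left_mono) auto
  then show ?thesis using b by (simp add: algebra_simps)
qed

lemma U_nonneg: "fps_nth U n \<ge> 0"
  using U_pos[of n] U0 by (cases "n = 0") auto

lemma U_summable: "summable (\<lambda>n. \<bar>fps_nth U n\<bar>)"
proof -
  obtain C where C: "\<And>n. \<bar>fps_nth U n\<bar> \<le> C * real n powr (- 3 / 2)"
    using coeff_asymp_bounded[OF U_asymp U0] by blast
  have "summable (\<lambda>n. C * real n powr (- 3 / 2))"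
    by (intro summable_mult) (simp add: summable_real_powr_iff)
  then show ?thesis by (rule summable_comparison_test') (use C in auto)
qed

lemma XD_U_asymp: "coeff_asymp (fps_XD U) (1 / 2 - 1) c"
  using coeff_asymp_XD[OF U_asymp] by simp

lemma XD_square: "fps_XD (U * U) = fps_const 2 * (fps_XD U * U)"
  by (simp add: fps_XD_def algebra_simps numeral_fps_const)

lemma square_asymp_aux: "coeff_asymp (U * U) (- 3 / 2) (2 * (c * (\<Sum>n. fps_nth U n)))"
proof -
  have "coeff_asymp (fps_XD U * U) (1 / 2 - 1) (c * (\<Sum>n. fps_nth U n))"
    by (rule coeff_asymp_mult_summable[OF _ XD_U_asymp U_asymp U_summable]) simp
  from coeff_asymp_cmult[OF this, of 2] show ?thesis
    using coeff_asymp_XD_iff[of "U * U" "- 3 / 2"] unfolding XD_square by simp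
qed

text \<open>
  Both sides of the recurrence are of order \<open>n powr (- 1/2)\<close>, and the leading coefficients are \<open>c\<close> on the
  left and \<open>(b + g) * c\<close> times the sum on the right.
\<close>

lemma sum_U: "(\<Sum>n. fps_nth U n) = 1 / (b + g)"
proof -
  let ?S = "\<Sum>n. fps_nth U n"
  have eq: "fps_XD U - U = fps_const (b + g) * (fps_XD U * U) - fps_const g * (U * U)"
    using U_rec by (simp only: size_recurrence_iff)
  have "coeff_asymp (fps_XD U - U) (1 / 2 - 1) (c - 0)"
    by (intro coeff_asymp_diff XD_U_asymp coeff_asymp_negligible[OF U_asymp]) simp
  moreover have "coeff_asymp (fps_XD U - U) (1 / 2 - 1) ((b + g) * (c * ?S) - g * 0)"
    unfolding eq
    by (intro coeff_asymp_diff coeff_asymp_cmult coeff_asymp_mult_summable[OF _ XD_U_asymp U_asymp U_summable]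
        coeff_asymp_negligible[OF square_asymp_aux]) simp_all
  ultimately have "c - 0 = (b + g) * (c * ?S) - g * 0" by (rule coeff_asymp_unique)
  then have "c * 1 = c * ((b + g) * ?S)" by (simp add: algebra_simps)
  then have "1 = (b + g) * ?S" using c by (simp only: mult_left_cancel)
  then show ?thesis using bg by (simp add: field_simps)
qed

lemma square_asymp: "coeff_asymp (U * U) (- 3 / 2) (2 * c / (b + g))"
  using square_asymp_aux unfolding sum_U by simp

lemma mult_U_asymp: "P > 0 \<Longrightarrow> coeff_asymp f (P - 1) A \<Longrightarrow> coeff_asymp (f * U) (P - 1) (A / (b + g))"
  using coeff_asymp_mult_summable[OF _ _ U_asymp U_summable, of P f A] unfolding sum_U by simp

text \<open>
  Sizes below \<open>2\<close> are left out, since trees without edges obey no recurrence.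
\<close>

definition solves :: "real fps \<Rightarrow> real fps \<Rightarrow> bool" where
  "solves G R \<longleftrightarrow> (\<forall>n\<ge>2. (real n - 1) * fps_nth G n =
     ((b + g) * real n - 2 * g) * fps_nth (G * U) n + fps_nth R n)"

lemma solves_diff:
  assumes "solves G R" "solves G' R'"
  shows "solves (G - fps_const k * G') (R - fps_const k * R')"
  unfolding solves_def
proof (intro allI impI)
  let ?k = "\<lambda>n. (b + g) * real n - 2 * g"
  fix n :: nat assume "n \<ge> 2"
  then have 1: "(real n - 1) * fps_nth G n = ?k n * fps_nth (G * U) n + fps_nth R n"
    and 2: "(real n - 1) * fps_nth G' n = ?k n * fps_nth (G' * U) n + fps_nth R' n"
    using assms by (simp_all add: solves_def)
  have m: "(G - fps_const k * G') * U = G * U - fps_const k * (G' * U)" by (simp add: algebra_simps)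
  have "(real n - 1) * fps_nth (G - fps_const k * G') n = (real n - 1) * fps_nth G n - k * ((real n - 1) * fps_nth G' n)"
    by (simp add: algebra_simps)
  also have "\<dots> = ?k n * fps_nth ((G - fps_const k * G') * U) n + fps_nth (R - fps_const k * R') n"
    unfolding 1 2 m fps_sub_nth fps_mult_left_const_nth by (simp add: algebra_simps)
  finally show "(real n - 1) * fps_nth (G - fps_const k * G') n =
    ?k n * fps_nth ((G - fps_const k * G') * U) n + fps_nth (R - fps_const k * R') n" .
qed

lemma solvesI_fps:
  assumes "fps_XD G - G = fps_const (b + g) * fps_XD (G * U) - fps_const (2 * g) * (G * U) + R"
  shows "solves G R"
  unfolding solves_def
proof (intro allI impI)
  fix n
  show "(real n - 1) * fps_nth G n = ((b + g) * real n - 2 * g) * fps_nth (G * U) n + fps_nth R n"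
    using arg_cong[OF assms, of "\<lambda>f. fps_nth f n"]
    by (simp only: fps_sub_nth fps_add_nth fps_mult_left_const_nth fps_nth_XD) (simp add: algebra_simps)
qed

lemma XD_size_recurrence: "fps_XD (fps_XD U) - fps_XD U =
    fps_const (b + g) * fps_XD (fps_XD U * U) - fps_const (2 * g) * (fps_XD U * U)"
proof -
  have eq: "fps_XD U - U = fps_const (b + g) * (fps_XD U * U) - fps_const g * (U * U)"
    using U_rec by (simp only: size_recurrence_iff)
  have lin: "fps_XD (f - h) = fps_XD f - fps_XD h" "fps_XD (fps_const k * f) = fps_const k * fps_XD f" for f h :: "real fps" and k
    by (simp_all add: fps_XD_def algebra_simps)
  have "fps_const (2 * g) = fps_const g * fps_const 2" by (simp add: mult.commute)
  with arg_cong[OF eq, of fps_XD] show ?thesis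
    unfolding lin XD_square by (simp only: mult.assoc)
qed

text \<open>
  This corresponds to unit tolls for single nodes and no tolls otherwise, when the cost of a tree is its size.
\<close>

lemma solves_homogeneous: "solves (fps_XD U) 0"
  by (rule solvesI_fps) (simp add: XD_size_recurrence)

text \<open>
  Variation of constants: \<open>XD U\<close> solves the homogeneous equation, hence in \<open>XD U * h\<close> only the terms with
  \<open>XD h\<close> survive, and their factor is \<open>XD U * (1 - (b + g) * U) = U - g * U\<^sup>2\<close>.
\<close>

lemma solves_model: "solves (fps_XD U * h) (fps_XD h * U - fps_const g * (fps_XD h * U * U))"
proof (rule solvesI_fps)
  have eq: "fps_XD U = U + fps_const (b + g) * (fps_XD U * U) - fps_const g * (U * U)"
    using U_rec unfolding size_recurrence_iff by (simp add: algebra_simps)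
  have lin: "fps_XD (f * k) = fps_XD f * k + f * fps_XD k" for f k :: "real fps"
    by (simp add: fps_XD_def algebra_simps)
  define V where "V = fps_XD U"
  let ?a = "fps_const (b + g)" and ?g = "fps_const g" and ?h = "fps_XD h"
  have 1: "fps_XD V - V = ?a * fps_XD (V * U) - fps_const (2 * g) * (V * U)"
    using XD_size_recurrence by (simp add: V_def)
  have 2: "V - ?a * (V * U) = U - ?g * (U * U)"
    using eq by (simp add: V_def algebra_simps)
  have "fps_XD (V * h) - V * h - ?a * fps_XD (V * h * U) + fps_const (2 * g) * (V * h * U) =
      h * (fps_XD V - V - ?a * fps_XD (V * U) + fps_const (2 * g) * (V * U)) + ?h * (V - ?a * (V * U))"
    unfolding lin by (simp add: algebra_simps)
  also have "\<dots> = ?h * (U - ?g * (U * U))" unfolding 1 2 by simp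
  also have "\<dots> = ?h * U - ?g * (?h * U * U)" by (simp add: algebra_simps)
  finally show "fps_XD (fps_XD U * h) - fps_XD U * h = ?a * fps_XD (fps_XD U * h * U)
      - fps_const (2 * g) * (fps_XD U * h * U) + (?h * U - ?g * (?h * U * U))"
    unfolding V_def[symmetric] by (simp add: algebra_simps)
qed

lemma model_solution:
  assumes p: "p > 0"
  obtains H Q where "solves H Q" "\<And>n. fps_nth H n \<ge> 0" "fps_nth H 0 = 0"
    "coeff_asymp H (p - 1 / 2) (c * sqrt pi / Gamma (p + 1 / 2))"
    "coeff_asymp Q p (b / (Gamma p * (b + g)\<^sup>2))"
proof -
  define H where "H = fps_XD U * model_fps p"
  define Q where "Q = fps_XD (model_fps p) * U - fps_const g * (fps_XD (model_fps p) * U * U)"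
  have 1: "solves H Q" unfolding H_def Q_def by (rule solves_model)
  have 2: "fps_nth H n \<ge> 0" for n
    unfolding H_def fps_mult_nth using U_nonneg model_fps_pos[OF p]
    by (intro sum_nonneg mult_nonneg_nonneg) (auto intro: less_imp_le)
  have 3: "fps_nth H 0 = 0" by (simp add: H_def)
  have Gp: "Gamma p > 0" using p by (rule Gamma_real_pos)
  have rG: "rGamma p = 1 / Gamma p" by (simp add: rGamma_inverse_Gamma divide_inverse)
  have "coeff_asymp H (1 / 2 + p - 1) (c * (1 / Gamma p) * Gamma (1 / 2) * Gamma p / Gamma (1 / 2 + p))"
    unfolding H_def using p coeff_asymp_model[of p] unfolding rG
    by (intro coeff_asymp_mult XD_U_asymp) auto
  then have 4: "coeff_asymp H (p - 1 / 2) (c * sqrt pi / Gamma (p + 1 / 2))"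
    using Gp by (simp add: Gamma_one_half_real algebra_simps)
  have h: "coeff_asymp (fps_XD (model_fps p)) (p + 1 - 1) (1 / Gamma p)"
    using coeff_asymp_XD[OF coeff_asymp_model[of p]] unfolding rG by simp
  have h1: "coeff_asymp (fps_XD (model_fps p) * U) (p + 1 - 1) (1 / Gamma p / (b + g))"
    using p by (intro mult_U_asymp h) simp
  have h2: "coeff_asymp (fps_XD (model_fps p) * U * U) (p + 1 - 1) (1 / Gamma p / (b + g) / (b + g))"
    using p by (intro mult_U_asymp h1) simp
  have "coeff_asymp Q (p + 1 - 1) (1 / Gamma p / (b + g) - g * (1 / Gamma p / (b + g) / (b + g)))"
    unfolding Q_def by (intro coeff_asymp_diff coeff_asymp_cmult h1 h2)
  moreover have "1 / Gamma p / (b + g) - g * (1 / Gamma p / (b + g) / (b + g)) = b / (Gamma p * (b + g)\<^sup>2)"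
    using Gp bg by (simp add: divide_simps power2_eq_square)
  ultimately have "coeff_asymp Q p (b / (Gamma p * (b + g)\<^sup>2))" by simp
  with 1 2 3 4 show ?thesis by (rule that)
qed

text \<open>
  Let \<open>H\<close> be the model solution, with right-hand side \<open>Q\<close>, and \<open>V = XD U\<close> the homogeneous one. For large \<open>n\<close> the
  right-hand side \<open>R\<close> is below \<open>\<delta> * Q\<close>. As the kernel is nonnegative, induction on \<open>n\<close> bounds \<open>G\<close> by
  \<open>\<delta> * H + C * V\<close>, where \<open>C\<close> takes care of the small \<open>n\<close>; and \<open>V\<close> is of smaller order than \<open>H\<close> since \<open>p > 0\<close>.
\<close>

lemma transfer_negligible:
  assumes p: "p > 0" and G: "solves G R" "fps_nth G 0 = 0" and R: "coeff_asymp R p 0"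
  shows "coeff_asymp G (p - 1 / 2) 0"
  unfolding coeff_asymp_def
proof (rule LIMSEQ_I)
  fix \<epsilon> :: real assume \<epsilon>: "\<epsilon> > 0"
  let ?r = "\<lambda>n. real n powr (- (p - 1 / 2))"
  define V where "V = fps_XD U"
  define q where "q = b / (Gamma p * (b + g)\<^sup>2)"
  define L where "L = c * sqrt pi / Gamma (p + 1 / 2)"
  have q: "q > 0" using b bg Gamma_real_pos[OF p] by (simp add: q_def)
  have L: "L > 0" using c p Gamma_real_pos[of "p + 1 / 2"] by (simp add: L_def)
  obtain H Q where H: "solves H Q" "\<And>n. fps_nth H n \<ge> 0" "coeff_asymp H (p - 1 / 2) L" "coeff_asymp Q p q"
    using model_solution[OF p] unfolding q_def L_def by blast
  have V: "solves V 0" unfolding V_def by (rule solves_homogeneous)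
  have Vpos: "fps_nth V n > 0" if "n \<ge> 1" for n using U_pos[OF that] that by (simp add: V_def)
  have V0: "fps_nth V n \<ge> 0" for n using U_nonneg by (simp add: V_def)
  have Vneg: "coeff_asymp V (p - 1 / 2) 0"
    unfolding V_def by (rule coeff_asymp_negligible[OF XD_U_asymp]) (use p in simp)
  define \<delta> where "\<delta> = \<epsilon> / 2 / (L + 1)"
  have \<delta>: "\<delta> > 0" using \<epsilon> L by (simp add: \<delta>_def)
  have ev: "eventually (\<lambda>n. n \<ge> 2 \<and> \<bar>fps_nth R n\<bar> \<le> \<delta> * fps_nth Q n) sequentially"
  proof -
    have "(\<lambda>n. \<bar>fps_nth R n * real n powr (- p)\<bar>) \<longlonglongrightarrow> \<bar>0\<bar>"
      using R unfolding coeff_asymp_def by (intro tendsto_intros)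
    then have 1: "eventually (\<lambda>n. \<bar>fps_nth R n * real n powr (- p)\<bar> < \<delta> * (q / 2)) sequentially"
      using \<delta> q by (intro order_tendstoD(2)) auto
    have 2: "eventually (\<lambda>n. fps_nth Q n * real n powr (- p) > q / 2) sequentially"
      using H(4) q unfolding coeff_asymp_def by (intro order_tendstoD(1)) auto
    show ?thesis using 1 2 eventually_ge_at_top[of 2]
    proof eventually_elim
      case (elim n)
      have n: "real n powr (- p) > 0" using elim(3) by simp
      have "\<bar>fps_nth R n\<bar> * real n powr (- p) < \<delta> * (q / 2)" using elim(1) by (simp add: abs_mult)
      also have "\<dots> \<le> \<delta> * (fps_nth Q n * real n powr (- p))" using elim(2) \<delta> by (intro mult_left_mono) auto
      finally have "\<bar>fps_nth R n\<bar> * real n powr (- p) < (\<delta> * fps_nth Q n) * real n powr (- p)" by simp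
      then have "\<bar>fps_nth R n\<bar> < \<delta> * fps_nth Q n" using n by (simp only: mult_less_cancel_right_pos)
      then show ?case using elim(3) by simp
    qed
  qed
  then obtain N where N: "\<And>n. n \<ge> N \<Longrightarrow> n \<ge> 2 \<and> \<bar>fps_nth R n\<bar> \<le> \<delta> * fps_nth Q n"
    by (auto simp: eventually_sequentially)
  define C where "C = (\<Sum>k<N. \<bar>fps_nth G k\<bar> / fps_nth V k)"
  have C: "C \<ge> 0" unfolding C_def using V0 by (intro sum_nonneg divide_nonneg_nonneg) auto
  have bound: "\<bar>fps_nth G n\<bar> \<le> \<delta> * fps_nth H n + C * fps_nth V n" for n
  proof (induction n rule: less_induct)
    case (less n)
    show ?case
    proof (cases "n < N")
      case True
      have "\<bar>fps_nth G n\<bar> \<le> C * fps_nth V n"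
      proof (cases "n = 0")
        case False
        have "\<bar>fps_nth G n\<bar> / fps_nth V n \<le> C"
          unfolding C_def by (rule member_le_sum) (use True V0 in auto)
        then show ?thesis using Vpos[of n] False by (simp add: divide_le_eq)
      qed (use G(2) C V0 in simp)
      then show ?thesis using \<delta> H(2)[of n] by (simp add: add_increasing)
    next
      case False
      then have n: "n \<ge> 2" "\<bar>fps_nth R n\<bar> \<le> \<delta> * fps_nth Q n" using N[of n] by auto
      let ?k = "(b + g) * real n - 2 * g"
      have k: "?k > 0" by (rule kernel_pos[OF n(1)])
      have "\<bar>fps_nth (G * U) n\<bar> \<le> (\<Sum>i=0..n. \<bar>fps_nth G i * fps_nth U (n - i)\<bar>)"
        unfolding fps_mult_nth by (rule sum_abs)
      also have "\<dots> \<le> (\<Sum>i=0..n. (\<delta> * fps_nth H i + C * fps_nth V i) * fps_nth U (n - i))"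
      proof (rule sum_mono)
        fix i assume "i \<in> {0..n}"
        then show "\<bar>fps_nth G i * fps_nth U (n - i)\<bar> \<le> (\<delta> * fps_nth H i + C * fps_nth V i) * fps_nth U (n - i)"
          using less.IH[of i] U0 U_nonneg[of "n - i"]
          by (cases "i = n") (auto simp: abs_mult intro: mult_right_mono)
      qed
      also have "\<dots> = \<delta> * fps_nth (H * U) n + C * fps_nth (V * U) n"
        unfolding fps_mult_nth by (simp add: algebra_simps sum.distrib sum_distrib_left)
      finally have GU: "\<bar>fps_nth (G * U) n\<bar> \<le> \<delta> * fps_nth (H * U) n + C * fps_nth (V * U) n" .
      have "(real n - 1) * \<bar>fps_nth G n\<bar> = \<bar>(real n - 1) * fps_nth G n\<bar>" using n by (simp add: abs_mult)
      also have "\<dots> = \<bar>?k * fps_nth (G * U) n + fps_nth R n\<bar>" using G(1) n by (simp add: solves_def)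
      also have "\<dots> \<le> ?k * \<bar>fps_nth (G * U) n\<bar> + \<bar>fps_nth R n\<bar>"
        using k by (intro order_trans[OF abs_triangle_ineq]) (simp add: abs_mult)
      also have "\<dots> \<le> ?k * (\<delta> * fps_nth (H * U) n + C * fps_nth (V * U) n) + \<delta> * fps_nth Q n"
        using k GU n(2) by (intro add_mono mult_left_mono) auto
      also have "\<dots> = \<delta> * (?k * fps_nth (H * U) n + fps_nth Q n) + C * (?k * fps_nth (V * U) n)"
        by (simp only: distrib_left mult_ac add_ac)
      also have "?k * fps_nth (H * U) n + fps_nth Q n = (real n - 1) * fps_nth H n"
        using H(1) n by (simp add: solves_def)
      also have "?k * fps_nth (V * U) n = (real n - 1) * fps_nth V n"
        using V n by (simp add: solves_def)
      also have "\<delta> * ((real n - 1) * fps_nth H n) + C * ((real n - 1) * fps_nth V n) =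
          (real n - 1) * (\<delta> * fps_nth H n + C * fps_nth V n)"
        by (simp only: distrib_left mult_ac)
      finally show ?thesis using n by (simp add: mult_le_cancel_left)
    qed
  qed
  have "(\<lambda>n. \<delta> * (fps_nth H n * ?r n) + C * (fps_nth V n * ?r n))
      \<longlonglongrightarrow> \<delta> * L + C * 0"
    using H(3) Vneg unfolding coeff_asymp_def by (intro tendsto_intros)
  moreover have "\<delta> * L + C * 0 < \<epsilon>"
  proof -
    have "\<delta> * L \<le> \<delta> * (L + 1)" using \<delta> by simp
    also have "\<dots> = \<epsilon> / 2"
      using nonzero_divide_eq_eq[of "L + 1" "\<epsilon> / 2" \<delta>] \<delta>_def L by auto
    finally show ?thesis using \<epsilon> by simp
  qed
  ultimately have "eventually (\<lambda>n. \<delta> * (fps_nth H n * ?r n) +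
      C * (fps_nth V n * ?r n) < \<epsilon>) sequentially"
    by (rule order_tendstoD(2))
  then obtain M where M: "\<And>n. n \<ge> M \<Longrightarrow> \<delta> * (fps_nth H n * ?r n) +
      C * (fps_nth V n * ?r n) < \<epsilon>"
    by (auto simp: eventually_sequentially)
  have "norm (fps_nth G n * ?r n - 0) < \<epsilon>" if "n \<ge> M" for n
  proof -
    have "norm (fps_nth G n * ?r n - 0) = \<bar>fps_nth G n\<bar> * ?r n"
      by (simp add: abs_mult)
    also have "\<dots> \<le> (\<delta> * fps_nth H n + C * fps_nth V n) * ?r n"
      by (intro mult_right_mono bound) simp
    also have "\<dots> < \<epsilon>" using M[OF that] by (simp only: distrib_right mult.assoc)
    finally show ?thesis .
  qed
  then show "\<exists>M. \<forall>n\<ge>M. norm (fps_nth G n * ?r n - 0) < \<epsilon>" by blast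
qed

text \<open>
  Subtracting a multiple of the model solution reduces the claim to the negligible case.
\<close>

theorem transfer:
  assumes p: "p > 0" and G: "solves G R" "fps_nth G 0 = 0" and R: "coeff_asymp R p l"
  shows "coeff_asymp G (p - 1 / 2) (l * (c * sqrt pi * (b + g)\<^sup>2 / b) * Gamma p / Gamma (p + 1 / 2))"
proof -
  define q where "q = b / (Gamma p * (b + g)\<^sup>2)"
  define L where "L = c * sqrt pi / Gamma (p + 1 / 2)"
  have Gp: "Gamma p > 0" using p by (rule Gamma_real_pos)
  have q: "q > 0" using b bg Gp by (simp add: q_def)
  obtain H Q where H: "solves H Q" "coeff_asymp H (p - 1 / 2) L" "coeff_asymp Q p q" "fps_nth H 0 = 0"
    using model_solution[OF p] unfolding q_def L_def by blast
  have "coeff_asymp (R - fps_const (l / q) * Q) p (l - l / q * q)"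
    by (intro coeff_asymp_diff R coeff_asymp_cmult H)
  then have "coeff_asymp (R - fps_const (l / q) * Q) p 0" using q by simp
  moreover have "fps_nth (G - fps_const (l / q) * H) 0 = 0"
    using G(2) H(4) by simp
  ultimately have "coeff_asymp (G - fps_const (l / q) * H) (p - 1 / 2) 0"
    by (intro transfer_negligible[OF p solves_diff[OF G(1) H(1)]])
  from coeff_asymp_add[OF this coeff_asymp_cmult[OF H(2), of "l / q"]]
  have "coeff_asymp G (p - 1 / 2) (l / q * L)" by simp
  moreover have "l / q * L = l * (c * sqrt pi * (b + g)\<^sup>2 / b) * Gamma p / Gamma (p + 1 / 2)"
    using Gp b bg by (simp add: q_def L_def)
  ultimately show ?thesis by simp
qed

end

section \<open>The method of moments\<close>

text \<open>
  The power series of a characteristic function with moments \<open>m\<close>.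
\<close>

definition moment_char :: "(nat \<Rightarrow> real) \<Rightarrow> real \<Rightarrow> complex" where
  "moment_char m t = (\<Sum>k. (\<i> * of_real t) ^ k / fact k * of_real (m k))"

text \<open>
  The Taylor polynomials are cut off at even orders \<open>j\<close>, for which the absolute moment in the error bound
  is a moment and thus converges as well.
\<close>

lemma char_tendsto_moment_char:
  fixes \<mu> :: "nat \<Rightarrow> real measure"
  assumes rd: "\<And>n. real_distribution (\<mu> n)"
    and int: "\<And>n k. integrable (\<mu> n) (\<lambda>x. x ^ k)"
    and lim: "\<And>k. (\<lambda>n. LINT x|\<mu> n. x ^ k) \<longlonglongrightarrow> m k"
    and sm: "summable (\<lambda>k. \<bar>t\<bar> ^ k / fact k * \<bar>m k\<bar>)"
  shows "(\<lambda>n. char (\<mu> n) t) \<longlonglongrightarrow> moment_char m t"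
proof (rule LIMSEQ_I)
  fix \<epsilon> :: real assume \<epsilon>: "\<epsilon> > 0"
  define c :: "nat \<Rightarrow> complex" where "c k = (\<i> * of_real t) ^ k / fact k" for k
  have nc: "norm (c k) = \<bar>t\<bar> ^ k / fact k" for k
    by (simp add: c_def norm_divide norm_power norm_mult)
  have sc: "summable (\<lambda>k. c k * of_real (m k))"
    by (rule summable_norm_cancel) (use sm in \<open>simp add: norm_mult nc\<close>)
  have L1: "(\<lambda>j. \<Sum>k\<le>j. c k * of_real (m k)) \<longlonglongrightarrow> moment_char m t"
    unfolding moment_char_def c_def[symmetric] using sc by (rule summable_LIMSEQ')
  obtain J1 where J1: "\<And>j. j \<ge> J1 \<Longrightarrow> norm ((\<Sum>k\<le>j. c k * of_real (m k)) - moment_char m t) < \<epsilon> / 4"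
    using LIMSEQ_D[OF L1, of "\<epsilon> / 4"] \<epsilon> by auto
  have L2: "(\<lambda>k. \<bar>t\<bar> ^ k / fact k * \<bar>m k\<bar>) \<longlonglongrightarrow> 0" using sm by (rule summable_LIMSEQ_zero)
  obtain J2 where J2: "\<And>j. j \<ge> J2 \<Longrightarrow> \<bar>t\<bar> ^ j / fact j * \<bar>m j\<bar> < \<epsilon> / 8"
    using LIMSEQ_D[OF L2, of "\<epsilon> / 8"] \<epsilon> by auto
  define j where "j = 2 * max J1 J2"
  have j: "even j" "j \<ge> J1" "j \<ge> J2" by (auto simp: j_def)
  let ?E = "\<lambda>n k. LINT x|\<mu> n. x ^ k"
  have L3: "(\<lambda>n. 2 * (\<bar>t\<bar> ^ j / fact j) * ?E n j + norm (\<Sum>k\<le>j. c k * of_real (?E n k - m k)))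
      \<longlonglongrightarrow> 2 * (\<bar>t\<bar> ^ j / fact j) * m j + norm (\<Sum>k\<le>j. c k * of_real (m k - m k))"
    by (intro tendsto_intros lim)
  have "2 * (\<bar>t\<bar> ^ j / fact j) * m j + norm (\<Sum>k\<le>j. c k * of_real (m k - m k)) < \<epsilon> / 2"
  proof -
    have "\<bar>t\<bar> ^ j / fact j * m j \<le> \<bar>t\<bar> ^ j / fact j * \<bar>m j\<bar>" by (intro mult_left_mono) auto
    moreover have "2 * (\<bar>t\<bar> ^ j / fact j) * m j = 2 * (\<bar>t\<bar> ^ j / fact j * m j)"
      by (rule mult.assoc)
    moreover have "norm (\<Sum>k\<le>j. c k * of_real (m k - m k)) = 0" by simp
    ultimately show ?thesis using J2[OF j(3)] \<epsilon> by linarith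
  qed
  from order_tendstoD(2)[OF L3 this] have "eventually (\<lambda>n. 2 * (\<bar>t\<bar> ^ j / fact j) * ?E n j +
      norm (\<Sum>k\<le>j. c k * of_real (?E n k - m k)) < \<epsilon> / 2) sequentially" .
  then obtain N where N: "\<And>n. n \<ge> N \<Longrightarrow> 2 * (\<bar>t\<bar> ^ j / fact j) * ?E n j +
      norm (\<Sum>k\<le>j. c k * of_real (?E n k - m k)) < \<epsilon> / 2"
    by (auto simp: eventually_sequentially)
  have "norm (char (\<mu> n) t - moment_char m t) < \<epsilon>" if n: "n \<ge> N" for n
  proof -
    interpret real_distribution "\<mu> n" by (rule rd)
    have abs: "(\<lambda>x. \<bar>x\<bar> ^ j) = (\<lambda>x::real. x ^ j)" using j(1) by (auto simp: power_even_abs)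
    have 1: "norm (char (\<mu> n) t - (\<Sum>k\<le>j. c k * of_real (?E n k))) \<le> 2 * (\<bar>t\<bar> ^ j / fact j) * ?E n j"
      using char_approx1[of j t, OF int] unfolding abs c_def by simp
    have "char (\<mu> n) t - moment_char m t = (char (\<mu> n) t - (\<Sum>k\<le>j. c k * of_real (?E n k)))
        + (\<Sum>k\<le>j. c k * of_real (?E n k - m k)) + ((\<Sum>k\<le>j. c k * of_real (m k)) - moment_char m t)"
      by (simp add: algebra_simps sum_subtractf)
    also have "norm \<dots> \<le> norm (char (\<mu> n) t - (\<Sum>k\<le>j. c k * of_real (?E n k)))
        + norm (\<Sum>k\<le>j. c k * of_real (?E n k - m k)) + norm ((\<Sum>k\<le>j. c k * of_real (m k)) - moment_char m t)"
      by (intro order_trans[OF norm_triangle_ineq] add_mono norm_triangle_ineq order_refl)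
    finally show ?thesis using 1 N[OF n] J1[OF j(2)] \<epsilon> by linarith
  qed
  then show "\<exists>N. \<forall>n\<ge>N. norm (char (\<mu> n) t - moment_char m t) < \<epsilon>" by blast
qed

text \<open>
  By the preceding lemma, applied to constant sequences, both characteristic functions are equal to \<open>moment_char m\<close>.
\<close>

theorem moments_determine_distribution:
  assumes M: "real_distribution M" "\<And>k. integrable M (\<lambda>x. x ^ k)" "\<And>k. (LINT x|M. x ^ k) = m k"
    and N: "real_distribution N" "\<And>k. integrable N (\<lambda>x. x ^ k)" "\<And>k. (LINT x|N. x ^ k) = m k"
    and sm: "\<And>t. summable (\<lambda>k. \<bar>t\<bar> ^ k / fact k * \<bar>m k\<bar>)"
  shows "M = N"
proof (rule Levy_uniqueness[OF M(1) N(1)])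
  have "char M t = char N t" for t
  proof -
    have "(\<lambda>_::nat. char M t) \<longlonglongrightarrow> moment_char m t" "(\<lambda>_::nat. char N t) \<longlonglongrightarrow> moment_char m t"
      by (rule char_tendsto_moment_char[OF _ _ _ sm]; simp add: M N)+
    then show ?thesis by (simp add: tendsto_const_iff)
  qed
  then show "char M = char N" by blast
qed

lemma tight_of_bounded_second_moment:
  fixes \<mu> :: "nat \<Rightarrow> real measure"
  assumes rd: "\<And>n. real_distribution (\<mu> n)"
    and int: "\<And>n. integrable (\<mu> n) (\<lambda>x. x ^ 2)" and B: "\<And>n. (LINT x|\<mu> n. x ^ 2) \<le> B"
  shows "tight \<mu>"
  unfolding tight_def
proof (intro conjI allI impI rd)
  fix \<epsilon> :: real assume \<epsilon>: "\<epsilon> > 0"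
  define a where "a = sqrt ((\<bar>B\<bar> + 1) / \<epsilon>) + 1"
  have pos: "(\<bar>B\<bar> + 1) / \<epsilon> > 0" using \<epsilon> by (intro divide_pos_pos) auto
  have a: "a > 1" using pos by (simp add: a_def)
  have "(\<bar>B\<bar> + 1) / \<epsilon> = (sqrt ((\<bar>B\<bar> + 1) / \<epsilon>))\<^sup>2" using pos by simp
  also have "\<dots> \<le> a\<^sup>2" unfolding a_def using pos by (intro power_mono) auto
  finally have a2: "\<bar>B\<bar> + 1 \<le> \<epsilon> * a\<^sup>2" using \<epsilon> by (simp add: field_simps)
  show "\<exists>a b. a < b \<and> (\<forall>n. 1 - \<epsilon> < measure (\<mu> n) {a<..b})"
  proof (intro exI conjI allI)
    show "- a < a" using a by simp
    fix n
    interpret real_distribution "\<mu> n" by (rule rd)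
    have sub: "UNIV - {- a<..a} \<subseteq> {x. x\<^sup>2 \<ge> a\<^sup>2}"
    proof
      fix x assume "x \<in> UNIV - {- a<..a}"
      then have "\<bar>a\<bar> \<le> \<bar>x\<bar>" using a by auto
      then show "x \<in> {x. x\<^sup>2 \<ge> a\<^sup>2}" by (simp add: abs_le_square_iff)
    qed
    have "1 - measure (\<mu> n) {- a<..a} = measure (\<mu> n) (UNIV - {- a<..a})"
      using prob_compl[of "{- a<..a}"] by simp
    also have "\<dots> \<le> measure (\<mu> n) {x. x\<^sup>2 \<ge> a\<^sup>2}"
      by (rule finite_measure_mono[OF sub]) simp
    also have "\<dots> \<le> (LINT x|\<mu> n. x ^ 2) / a\<^sup>2"
      using integral_Markov_inequality_measure[OF int[of n], of "{}" "a\<^sup>2"] a by simp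
    also have "\<dots> \<le> \<bar>B\<bar> / a\<^sup>2" using B[of n] by (intro divide_right_mono) auto
    also have "\<dots> < \<epsilon>" using a2 a \<epsilon> by (simp add: divide_less_eq)
    finally show "1 - \<epsilon> < measure (\<mu> n) {- a<..a}" by simp
  qed
qed

definition truncate :: "real \<Rightarrow> real \<Rightarrow> real" where
  "truncate B x = max (- B) (min B x)"

lemma truncate_bound: "B \<ge> 0 \<Longrightarrow> \<bar>truncate B x\<bar> \<le> B"
  by (auto simp: truncate_def)

lemma continuous_truncate [continuous_intros]: "isCont (truncate B) x"
  unfolding truncate_def by (intro continuous_intros)

lemma power_double_eq_abs: "x ^ (2 * k) = \<bar>x ^ k\<bar> * \<bar>x ^ k\<bar>" for x :: real
  by (simp add: mult_2 power_add)

lemma truncate_power_error: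
  assumes "B > 0"
  shows "\<bar>x ^ k - truncate B x ^ k\<bar> \<le> 2 * x ^ (2 * k) / B ^ k"
proof (cases "\<bar>x\<bar> \<le> B")
  case True
  then have "truncate B x = x" by (auto simp: truncate_def)
  then show ?thesis using assms by (simp add: power_mult)
next
  case False
  have "\<bar>truncate B x\<bar> \<le> \<bar>x\<bar>" using False assms by (auto simp: truncate_def)
  then have "\<bar>truncate B x ^ k\<bar> \<le> \<bar>x ^ k\<bar>" unfolding power_abs by (intro power_mono) auto
  then have "\<bar>x ^ k - truncate B x ^ k\<bar> \<le> 2 * \<bar>x ^ k\<bar>"
    using abs_triangle_ineq4[of "x ^ k" "truncate B x ^ k"] by linarith
  also have "\<bar>x ^ k\<bar> \<le> x ^ (2 * k) / B ^ k"
  proof -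
    have "B ^ k \<le> \<bar>x ^ k\<bar>" unfolding power_abs using False assms by (intro power_mono) auto
    then have "\<bar>x ^ k\<bar> * B ^ k \<le> x ^ (2 * k)"
      unfolding power_double_eq_abs by (intro mult_left_mono) auto
    then show ?thesis using assms by (simp add: pos_le_divide_eq)
  qed
  finally show ?thesis by simp
qed

lemma truncate_moment_error:
  assumes "real_distribution M" "\<And>k. integrable M (\<lambda>x. x ^ k)" "B > 0"
  shows "\<bar>(LINT x|M. x ^ k) - (LINT x|M. truncate B x ^ k)\<bar> \<le> 2 * (LINT x|M. x ^ (2 * k)) / B ^ k"
proof -
  interpret real_distribution M by fact
  have meas: "truncate B \<in> borel_measurable borel"
    unfolding truncate_def[abs_def] by measurable
  have int: "integrable M (\<lambda>x. truncate B x ^ k)"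
    using assms(3) meas by (intro integrable_const_bound[of _ "B ^ k"])
      (auto simp: power_abs intro!: power_mono truncate_bound)
  have "\<bar>(LINT x|M. x ^ k) - (LINT x|M. truncate B x ^ k)\<bar> = \<bar>LINT x|M. x ^ k - truncate B x ^ k\<bar>"
    using assms(2) int by simp
  also have "\<dots> \<le> (LINT x|M. \<bar>x ^ k - truncate B x ^ k\<bar>)" by (rule integral_abs_bound)
  also have "\<dots> \<le> (LINT x|M. 2 / B ^ k * x ^ (2 * k))"
    using assms int truncate_power_error[OF assms(3)]
    by (intro integral_mono integrable_abs Bochner_Integration.integrable_diff integrable_mult_right) auto
  also have "\<dots> = 2 * (LINT x|M. x ^ (2 * k)) / B ^ k" by simp
  finally show ?thesis .
qed

text \<open>
  The bounded functions \<open>min (x ^ (2 * j)) i\<close> have integrals that pass to the limit and stay bounded;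
  monotone convergence in \<open>i\<close> does the rest.
\<close>

lemma weak_limit_even_moment_integrable:
  fixes \<mu> :: "nat \<Rightarrow> real measure"
  assumes rd: "\<And>n. real_distribution (\<mu> n)" "real_distribution M" and w: "weak_conv_m \<mu> M"
    and int: "\<And>n. integrable (\<mu> n) (\<lambda>x. x ^ (2 * j))" and lim: "(\<lambda>n. LINT x|\<mu> n. x ^ (2 * j)) \<longlonglongrightarrow> c"
  shows "integrable M (\<lambda>x. x ^ (2 * j))"
proof -
  interpret M: real_distribution M by fact
  let ?g = "\<lambda>i x. min (x ^ (2 * j)) (real i)"
  have nn: "x ^ (2 * j) \<ge> 0" for x :: real by (simp add: power_mult)
  have bd: "norm (?g i x) \<le> real i" for i and x :: real
    using nn[of x] by auto
  have intg: "integrable N (?g i)" if "real_distribution N" for N i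
  proof -
    interpret real_distribution N by fact
    show ?thesis by (rule integrable_const_bound[of _ "real i"]) (use bd in auto)
  qed
  have le: "(LINT x|M. ?g i x) \<le> c" for i
  proof (rule LIMSEQ_le)
    show "(\<lambda>n. LINT x|\<mu> n. ?g i x) \<longlonglongrightarrow> (LINT x|M. ?g i x)"
      by (rule weak_conv_imp_integral_bdd_continuous_conv[OF rd w, of _ "real i"])
        (use bd in \<open>auto intro!: continuous_intros\<close>)
    show "\<exists>N. \<forall>n\<ge>N. (LINT x|\<mu> n. ?g i x) \<le> (LINT x|\<mu> n. x ^ (2 * j))"
      by (intro exI allI impI integral_mono intg rd int) simp
  qed (rule lim)
  have inc: "incseq (\<lambda>i. LINT x|M. ?g i x)"
    by (intro incseq_SucI integral_mono intg rd) (auto simp: min_def)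
  have "convergent (\<lambda>i. LINT x|M. ?g i x)"
    using incseq_convergent[OF inc, of c] le by (metis convergentI)
  then obtain L where L: "(\<lambda>i. LINT x|M. ?g i x) \<longlonglongrightarrow> L" by (auto simp: convergent_def)
  show ?thesis
  proof (rule integrable_monotone_convergence[OF intg[OF rd(2)] _ _ L])
    show "AE x in M. mono (\<lambda>i. ?g i x)" by (intro always_eventually allI monoI) (auto simp: min_def)
    show "AE x in M. (\<lambda>i. ?g i x) \<longlonglongrightarrow> x ^ (2 * j)"
    proof (intro always_eventually allI)
      fix x :: real
      obtain N where N: "x ^ (2 * j) \<le> real N" using real_arch_simple by blast
      have "eventually (\<lambda>i. ?g i x = x ^ (2 * j)) sequentially"
        using eventually_ge_at_top[of N] by eventually_elim (use N in auto)
      then show "(\<lambda>i. ?g i x) \<longlonglongrightarrow> x ^ (2 * j)" by (rule tendsto_eventually)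
    qed
  qed simp
qed

text \<open>
  Tightness gives a limit \<open>M\<close> along a subsequence, and the limit \<open>moment_char m\<close> of all characteristic
  functions must be that of \<open>M\<close>; so the whole sequence converges to \<open>M\<close>. Since higher moments are bounded,
  truncating at \<open>\<plusminus>B\<close> changes a moment by \<open>O(1 / B ^ k)\<close> uniformly, and the moments pass to the limit too.
\<close>

theorem method_of_moments:
  fixes \<mu> :: "nat \<Rightarrow> real measure"
  assumes rd: "\<And>n. real_distribution (\<mu> n)"
    and int: "\<And>n k. integrable (\<mu> n) (\<lambda>x. x ^ k)"
    and lim: "\<And>k. (\<lambda>n. LINT x|\<mu> n. x ^ k) \<longlonglongrightarrow> m k"
    and sm: "\<And>t. summable (\<lambda>k. \<bar>t\<bar> ^ k / fact k * \<bar>m k\<bar>)"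
  obtains M where "real_distribution M" "weak_conv_m \<mu> M"
    "\<And>k. integrable M (\<lambda>x. x ^ k)" "\<And>k. (LINT x|M. x ^ k) = m k"
proof -
  obtain B where B: "\<And>n. norm (LINT x|\<mu> n. x ^ 2) \<le> B"
    using convergent_imp_Bseq[OF convergentI[OF lim[of 2]]] by (metis BseqE)
  have "tight \<mu>"
    by (rule tight_of_bounded_second_moment[OF rd int, where B = B])
      (use B in \<open>simp add: abs_le_iff\<close>)
  then obtain r M where r: "strict_mono r" and M: "real_distribution M" "weak_conv_m (\<mu> \<circ> id \<circ> r) M"
    using tight_imp_convergent_subsubsequence[of \<mu> id] strict_mono_id by blast
  have chars: "(\<lambda>n. char (\<mu> n) t) \<longlonglongrightarrow> moment_char m t" for t
    by (rule char_tendsto_moment_char[OF rd int lim sm])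
  have "char M t = moment_char m t" for t
  proof (rule LIMSEQ_unique)
    show "(\<lambda>n. char ((\<mu> \<circ> r) n) t) \<longlonglongrightarrow> char M t"
      using rd M by (intro levy_continuity1) (auto simp: o_def)
    show "(\<lambda>n. char ((\<mu> \<circ> r) n) t) \<longlonglongrightarrow> moment_char m t"
      using LIMSEQ_subseq_LIMSEQ[OF chars r] by (simp add: o_def)
  qed
  then have w: "weak_conv_m \<mu> M"
    using chars by (intro levy_continuity rd M) auto
  interpret M: real_distribution M by fact
  have even: "integrable M (\<lambda>x. x ^ (2 * j))" for j
    by (rule weak_limit_even_moment_integrable[OF rd M(1) w int lim])
  have intM: "integrable M (\<lambda>x. x ^ k)" for k
  proof (rule Bochner_Integration.integrable_bound[of M "\<lambda>x. 1 + x ^ (2 * k)"])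
    show "integrable M (\<lambda>x. 1 + x ^ (2 * k))" using even by simp
    have "\<bar>x ^ k\<bar> \<le> \<bar>1 + x ^ (2 * k)\<bar>" for x :: real
    proof -
      have "0 \<le> (\<bar>x ^ k\<bar> - 1) * (\<bar>x ^ k\<bar> - 1)" by simp
      then have "2 * \<bar>x ^ k\<bar> \<le> 1 + x ^ (2 * k)"
        unfolding power_double_eq_abs by (simp add: left_diff_distrib right_diff_distrib)
      then show ?thesis by linarith
    qed
    then show "AE x in M. norm (x ^ k) \<le> norm (1 + x ^ (2 * k))" by simp
  qed simp
  have "(LINT x|M. x ^ k) = m k" for k
  proof (cases "k = 0")
    case True
    have "(\<lambda>n. LINT x|\<mu> n. x ^ 0) = (\<lambda>n. 1)"
    proof
      fix n
      interpret real_distribution "\<mu> n" by (rule rd)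
      show "(LINT x|\<mu> n. x ^ 0) = 1" using prob_space by simp
    qed
    then have "m 0 = 1" using lim[of 0] by (simp add: LIMSEQ_const_iff)
    then show ?thesis using True M.prob_space by simp
  next
    case False
    obtain C where C: "\<And>n. norm (LINT x|\<mu> n. x ^ (2 * k)) \<le> C"
      using convergent_imp_Bseq[OF convergentI[OF lim[of "2 * k"]]] by (metis BseqE)
    define D where "D = max C (LINT x|M. x ^ (2 * k))"
    have D: "(LINT x|\<mu> n. x ^ (2 * k)) \<le> D" "(LINT x|M. x ^ (2 * k)) \<le> D" for n
      using C[of n] by (auto simp: D_def)
    have bound: "\<bar>(LINT x|M. x ^ k) - m k\<bar> \<le> 4 * D / real B ^ k" if B: "B > 0" for B :: nat
    proof -
      have err: "\<bar>(LINT x|N. x ^ k) - (LINT x|N. truncate (real B) x ^ k)\<bar> \<le> 2 * D / real B ^ k"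
        if "real_distribution N" "\<And>k. integrable N (\<lambda>x. x ^ k)" "(LINT x|N. x ^ (2 * k)) \<le> D" for N
        by (rule order_trans[OF truncate_moment_error[OF that(1,2)]])
          (use B that(3) in \<open>auto intro!: divide_right_mono\<close>)
      have "(\<lambda>n. LINT x|\<mu> n. truncate (real B) x ^ k) \<longlonglongrightarrow> (LINT x|M. truncate (real B) x ^ k)"
        by (rule weak_conv_imp_integral_bdd_continuous_conv[OF rd M(1) w, of _ "real B ^ k"])
          (auto simp: power_abs intro!: power_mono truncate_bound continuous_intros)
      then have "(\<lambda>n. \<bar>(LINT x|\<mu> n. x ^ k) - (LINT x|\<mu> n. truncate (real B) x ^ k)\<bar>) \<longlonglongrightarrow>
          \<bar>m k - (LINT x|M. truncate (real B) x ^ k)\<bar>"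
        by (intro tendsto_intros lim)
      then have "\<bar>m k - (LINT x|M. truncate (real B) x ^ k)\<bar> \<le> 2 * D / real B ^ k"
        by (rule LIMSEQ_le_const2) (use err[OF rd int D(1)] in blast)
      moreover have "4 * D / real B ^ k = 2 * D / real B ^ k + 2 * D / real B ^ k" by simp
      ultimately show ?thesis using err[OF M(1) intM D(2)] unfolding abs_le_iff by linarith
    qed
    have "(\<lambda>B. 4 * D / real B ^ k) \<longlonglongrightarrow> 0"
      using False by real_asymp
    then have "\<bar>(LINT x|M. x ^ k) - m k\<bar> \<le> 0"
      by (rule LIMSEQ_le_const) (use bound in \<open>auto intro!: exI[of _ 1]\<close>)
    then show ?thesis by simp
  qed
  with M(1) w intM show ?thesis by (rule that)
qed

section \<open>Growth of the limit moments\<close>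

text \<open>
  The function \<open>ln \<circ> \<Gamma>\<close> is convex and has slope \<open>ln y\<close> over \<open>[y, y + 1]\<close>. Its slope over \<open>[x, x + a]\<close> lies
  between those over the adjacent unit intervals.
\<close>

lemma Gamma_ratio_bounds:
  fixes x a :: real
  assumes x: "x > 0" and a: "a > 0"
  shows Gamma_add_le: "Gamma (x + a) \<le> (x + a) powr a * Gamma x"
    and Gamma_add_ge: "x > 1 \<Longrightarrow> (x - 1) powr a * Gamma x \<le> Gamma (x + a)"
proof -
  let ?f = "ln \<circ> Gamma :: real \<Rightarrow> real"
  have step: "?f (y + 1) - ?f y = ln y" if "y > 0" for y
    using that Gamma_real_pos[OF that] by (auto simp: Gamma_plus1 ln_mult_pos nonpos_Ints_def)
  have pos: "Gamma x > 0" "Gamma (x + a) > 0" using x a by (auto intro!: Gamma_real_pos)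
  have "(?f x - ?f (x + a)) / (x - (x + a)) \<le> (?f (x + a) - ?f (x + a + 1)) / (x + a - (x + a + 1))"
    using convex_on_slope_le[OF log_convex_Gamma_real, of x "x + a + 1" "x + a"] x a by force
  then have "?f (x + a) - ?f x \<le> a * ln (x + a)"
    using step[of "x + a"] x a by (simp add: field_simps)
  then have "exp (ln (Gamma (x + a))) \<le> exp (a * ln (x + a) + ln (Gamma x))" by simp
  then show "Gamma (x + a) \<le> (x + a) powr a * Gamma x"
    using pos x a by (simp add: exp_add powr_def)
  assume x1: "x > 1"
  have "(?f (x - 1) - ?f x) / (x - 1 - x) \<le> (?f x - ?f (x + a)) / (x - (x + a))"
    using convex_on_slope_le[OF log_convex_Gamma_real, of "x - 1" "x + a" x] x1 a by force
  then have "a * ln (x - 1) \<le> ?f (x + a) - ?f x"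
    using step[of "x - 1"] x1 a by (simp add: field_simps)
  then have "exp (a * ln (x - 1) + ln (Gamma x)) \<le> exp (ln (Gamma (x + a)))" by simp
  then show "(x - 1) powr a * Gamma x \<le> Gamma (x + a)"
    using pos x1 a by (simp add: exp_add powr_def)
qed

lemma limit_moment_0 [simp]: "limit_moment \<alpha> 0 = 1"
  by (subst limit_moment.simps) simp

text \<open>
  With the moment \<open>1\<close> at \<open>s = 0\<close>, the initial value at \<open>s = 1\<close> is an instance of the recurrence.
\<close>

lemma limit_moment_rec:
  assumes "s \<ge> 1"
  shows "limit_moment \<alpha> s = 1 / (4 * sqrt pi) *
             (\<Sum>k = 1..s - 1. real (s choose k) *
                (Gamma (real k * (\<alpha> + 1 / 2) - 1 / 2) * Gamma (real (s - k) * (\<alpha> + 1 / 2) - 1 / 2) /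
                 Gamma (real s * (\<alpha> + 1 / 2) - 1 / 2)) *
                limit_moment \<alpha> k * limit_moment \<alpha> (s - k)) +
           real s * Gamma (real s * (\<alpha> + 1 / 2) - 1) / (sqrt 2 * Gamma (real s * (\<alpha> + 1 / 2) - 1 / 2)) *
             limit_moment \<alpha> (s - 1)"
proof (cases "s = 1")
  case True
  then show ?thesis by (subst limit_moment.simps) simp
next
  case False
  then show ?thesis using assms by (subst limit_moment.simps) (simp add: Let_def)
qed

lemma sum_inverse_squares_le: "(\<Sum>k=1..n. 1 / (real k)\<^sup>2) \<le> 2"
proof -
  have A: "(\<Sum>k=1..n. 1 / (real k)\<^sup>2) \<le> 2 - 1 / real n" if "n \<ge> 1" for n
    using that
  proof (induction n rule: dec_induct)
    case (step n)
    have "1 / (real (Suc n))\<^sup>2 \<le> 1 / (real n * real (Suc n))"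
      using step by (intro divide_left_mono) (auto simp: power2_eq_square)
    also have "\<dots> = 1 / real n - 1 / real (Suc n)" using step by (simp add: field_simps)
    finally show ?case using step by simp
  qed simp
  have "1 / real n \<ge> 0" by simp
  then show ?thesis using A[of n] by (cases "n = 0") (simp, linarith)
qed

lemma sum_inverse_squares_conv:
  assumes "s \<ge> 1"
  shows "(\<Sum>k=1..s-1. 1 / ((real k)\<^sup>2 * (real (s - k))\<^sup>2)) \<le> 8 / (real s)\<^sup>2"
proof -
  have "1 / ((real k)\<^sup>2 * (real (s - k))\<^sup>2) \<le> 2 / (real s)\<^sup>2 * (1 / (real k)\<^sup>2 + 1 / (real (s - k))\<^sup>2)"
    if "k \<in> {1..s-1}" for k
  proof -
    define x y where "x = real k" and "y = real (s - k)"
    have xy: "x > 0" "y > 0" "real s = x + y" using that by (auto simp: x_def y_def)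
    have "2 * (x\<^sup>2 + y\<^sup>2) - (x + y)\<^sup>2 = (x - y)\<^sup>2" by (simp add: power2_eq_square algebra_simps)
    then have "(x + y)\<^sup>2 \<le> 2 * (x\<^sup>2 + y\<^sup>2)" using zero_le_power2[of "x - y"] by linarith
    then have "(x + y)\<^sup>2 / ((x + y)\<^sup>2 * (x\<^sup>2 * y\<^sup>2)) \<le> 2 * (x\<^sup>2 + y\<^sup>2) / ((x + y)\<^sup>2 * (x\<^sup>2 * y\<^sup>2))"
      by (intro divide_right_mono) auto
    moreover have "(x + y)\<^sup>2 / ((x + y)\<^sup>2 * (x\<^sup>2 * y\<^sup>2)) = 1 / (x\<^sup>2 * y\<^sup>2)"
      using xy by simp
    moreover have "2 * (x\<^sup>2 + y\<^sup>2) / ((x + y)\<^sup>2 * (x\<^sup>2 * y\<^sup>2)) = 2 / (x + y)\<^sup>2 * (1 / x\<^sup>2 + 1 / y\<^sup>2)"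
      using xy by (simp add: divide_simps)
    ultimately show ?thesis unfolding xy(3) by (simp add: x_def y_def)
  qed
  then have "(\<Sum>k=1..s-1. 1 / ((real k)\<^sup>2 * (real (s - k))\<^sup>2)) \<le>
      (\<Sum>k=1..s-1. 2 / (real s)\<^sup>2 * (1 / (real k)\<^sup>2 + 1 / (real (s - k))\<^sup>2))"
    by (rule sum_mono)
  also have "\<dots> = 2 / (real s)\<^sup>2 * ((\<Sum>k=1..s-1. 1 / (real k)\<^sup>2) + (\<Sum>k=1..s-1. 1 / (real (s - k))\<^sup>2))"
    by (simp only: sum_distrib_left[symmetric] sum.distrib)
  also have "(\<Sum>k=1..s-1. 1 / (real (s - k))\<^sup>2) = (\<Sum>k=1..s-1. 1 / (real k)\<^sup>2)"
    by (rule sum.reindex_bij_witness[of _ "\<lambda>k. s - k" "\<lambda>k. s - k"]) auto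
  also have "2 / (real s)\<^sup>2 * ((\<Sum>k=1..s-1. 1 / (real k)\<^sup>2) + (\<Sum>k=1..s-1. 1 / (real k)\<^sup>2)) \<le> 2 / (real s)\<^sup>2 * (2 + 2)"
    by (intro mult_left_mono add_mono sum_inverse_squares_le) auto
  finally show ?thesis by simp
qed

text \<open>
  The numbers \<open>y s = m\<^sub>s * \<Gamma>(s * \<alpha>' - 1/2) / s!\<close> satisfy
  \<open>y s = (\<Sum>k. y k * y (s - k)) / (4 * sqrt \<pi>) + q s * y (s - 1)\<close> with \<open>q s = O(s powr \<alpha>)\<close>. A bound
  \<open>D * K ^ s * s! powr \<alpha> / s\<^sup>2\<close> is preserved by it: \<open>k! * (s - k)! \<le> s!\<close>, the sequence \<open>1 / s\<^sup>2\<close> convolved with itself is at most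
  \<open>8 / s\<^sup>2\<close>, and \<open>s powr \<alpha> * (s - 1)! powr \<alpha> = s! powr \<alpha>\<close>.
\<close>

theorem limit_moment_growth:
  assumes \<alpha>: "\<alpha> > 1 / 2"
  obtains K where "K > 0" "\<And>s. s \<ge> 1 \<Longrightarrow> 0 \<le> limit_moment \<alpha> s"
    "\<And>s. s \<ge> 1 \<Longrightarrow> limit_moment \<alpha> s / fact s \<le> K ^ s * fact s powr \<alpha> / Gamma (real s * (\<alpha> + 1 / 2) - 1 / 2)"
proof -
  let ?A = "\<lambda>s. Gamma (real s * (\<alpha> + 1 / 2) - 1)"
  let ?m = "limit_moment \<alpha>"
  define G where "G s = Gamma (real s * (\<alpha> + 1 / 2) - 1 / 2)" for s
  define y where "y s = ?m s * G s / fact s" for s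
  define q where "q s = ?A s / (sqrt 2 * G (s - 1))" for s
  have arg: "real s * (\<alpha> + 1 / 2) - 1 > 0" if "s \<ge> 1" for s
  proof -
    have "1 < 1 * (\<alpha> + 1 / 2)" using \<alpha> by simp
    also have "\<dots> \<le> real s * (\<alpha> + 1 / 2)" using that \<alpha> by (intro mult_right_mono) auto
    finally show ?thesis by simp
  qed
  have G: "G s > 0" if "s \<ge> 1" for s
    unfolding G_def using arg[OF that] by (intro Gamma_real_pos) simp
  have m: "?m s = y s * fact s / G s" if "s \<ge> 1" for s
    using G[OF that] by (simp add: y_def)
  have rec: "y s = 1 / (4 * sqrt pi) * (\<Sum>k=1..s-1. y k * y (s - k)) + q s * y (s - 1)" if s: "s \<ge> 2" for s
  proof -
    have s1: "s \<ge> 1" using s by simp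
    have "?m s * G s / fact s = 1 / (4 * sqrt pi) * (\<Sum>k = 1..s - 1. real (s choose k) *
                (G k * G (s - k)) * ?m k * ?m (s - k) / fact s) +
           real s * ?A s / sqrt 2 * ?m (s - 1) / fact s"
    proof -
      have S: "(\<Sum>k = 1..s - 1. real (s choose k) * (G k * G (s - k) / G s) * ?m k * ?m (s - k))
        = (\<Sum>k = 1..s - 1. real (s choose k) * (G k * G (s - k)) * ?m k * ?m (s - k)) / G s"
        unfolding sum_divide_distrib by (intro sum.cong refl) simp
      have E: "(K * (S / G) + r / (w * G) * l) * G / f = K * (S / f) + r / w * l / f"
        if "G > 0" "w > 0" "f > 0" for K S G r w l f :: real
        using that by (simp add: field_simps)
      show ?thesis
        unfolding limit_moment_rec[OF s1] G_def[symmetric] S sum_divide_distrib[symmetric]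
        by (rule E) (use G[OF s1] in simp_all)
    qed
    also have "(\<Sum>k = 1..s - 1. real (s choose k) * (G k * G (s - k)) * ?m k * ?m (s - k) / fact s)
        = (\<Sum>k=1..s-1. y k * y (s - k))"
      by (intro sum.cong refl) (auto simp: y_def binomial_fact field_simps)
    also have "real s * ?A s / sqrt 2 * ?m (s - 1) / fact s = q s * y (s - 1)"
    proof -
      have f: "fact s = real s * fact (s - 1)" using s by (simp add: fact_reduce)
      have "G (s - 1) > 0" using s by (intro G) simp
      then show ?thesis unfolding f y_def q_def using s by simp
    qed
    finally show ?thesis by (simp add: y_def)
  qed
  have q0: "q s \<ge> 0" if "s \<ge> 2" for s
    unfolding q_def using that G[of "s - 1"] Gamma_real_pos[OF arg[of s]] by (intro divide_nonneg_pos) auto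
  have y1: "y 1 \<ge> 0"
  proof -
    have "?m 1 \<ge> 0" using \<alpha> Gamma_real_pos[of "\<alpha> - 1 / 2"] Gamma_real_pos[of \<alpha>]
      by (subst limit_moment.simps) simp
    then show ?thesis unfolding y_def using G[of 1] by simp
  qed
  have y0: "y s \<ge> 0" if "s \<ge> 1" for s
    using that
  proof (induction s rule: less_induct)
    case (less s)
    show ?case
    proof (cases "s = 1")
      case False
      then have "s \<ge> 2" using less by simp
      then show ?thesis unfolding rec[OF \<open>s \<ge> 2\<close>] using less.IH q0
        by (intro add_nonneg_nonneg mult_nonneg_nonneg sum_nonneg) auto
    qed (use y1 in simp)
  qed
  define c where "c = (\<alpha> + 1 / 2) powr \<alpha>"
  have c: "c > 0" using \<alpha> by (simp add: c_def)
  have q: "q s \<le> c * real s powr \<alpha>" if s: "s \<ge> 2" for s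
  proof -
    let ?x = "real (s - 1) * (\<alpha> + 1 / 2) - 1 / 2"
    have "real (s - 1) * (\<alpha> + 1 / 2) - 1 > 0" by (rule arg) (use s in simp)
    then have x: "?x > 0" by linarith
    have G1: "G (s - 1) > 0" by (rule G) (use s in simp)
    have e: "real s * (\<alpha> + 1 / 2) - 1 = ?x + \<alpha>" using s by (simp add: of_nat_diff field_simps)
    have "?A s \<le> (?x + \<alpha>) powr \<alpha> * G (s - 1)"
      unfolding e G_def by (rule Gamma_add_le[OF x]) (use \<alpha> in simp)
    also have "\<dots> \<le> (real s * (\<alpha> + 1 / 2)) powr \<alpha> * G (s - 1)"
    proof -
      have "?x + \<alpha> \<ge> 0" "?x + \<alpha> \<le> real s * (\<alpha> + 1 / 2)" using x \<alpha> e by linarith+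
      then show ?thesis using \<alpha> G1 by (intro mult_right_mono powr_mono2) simp_all
    qed
    also have "(real s * (\<alpha> + 1 / 2)) powr \<alpha> = c * real s powr \<alpha>"
      using \<alpha> by (simp add: powr_mult c_def)
    finally have le: "?A s / G (s - 1) \<le> c * real s powr \<alpha>"
      using G1 by (simp only: divide_le_eq if_True)
    have "q s = ?A s / G (s - 1) / sqrt 2" by (simp add: q_def)
    also have "\<dots> \<le> ?A s / G (s - 1) / 1"
      using Gamma_real_pos[OF arg[of s]] G1 s by (intro divide_left_mono) auto
    finally show ?thesis using le by simp
  qed
  \<comment> \<open>With \<open>D = 1/16\<close> the quadratic and the linear term use at most one half of the bound each.
    The former needs \<open>8 * D \<le> 1/2\<close>, the latter \<open>4 * c \<le> K / 2\<close>, and the start \<open>y 1 \<le> D * K\<close>.\<close>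
  define K where "K = max (16 * y 1) (8 * c) + 1"
  have K: "K > 0" "K \<ge> 16 * y 1" "K \<ge> 8 * c" using y1 by (auto simp: K_def)
  let ?f = "\<lambda>s. fact s powr \<alpha> :: real"
  have claim: "y s \<le> 1 / 16 * K ^ s * ?f s / (real s)\<^sup>2" if "s \<ge> 1" for s
    using that
  proof (induction s rule: less_induct)
    case (less s)
    show ?case
    proof (cases "s = 1")
      case True
      then show ?thesis using K by simp
    next
      case False
      then have s: "s \<ge> 2" using less by simp
      have fmono: "?f k * ?f (s - k) \<le> ?f s" if "k \<le> s" for k
      proof -
        have "fact k * fact (s - k) \<le> (fact s :: real)"
          using fact_fact_dvd_fact[of k "s - k"] that
          by (metis dvd_imp_le fact_gt_zero le_add_diff_inverse of_nat_fact of_nat_le_iff of_nat_mult)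
        then have "(fact k * fact (s - k)) powr \<alpha> \<le> ?f s" using \<alpha> by (intro powr_mono2) auto
        then show ?thesis by (simp add: powr_mult)
      qed
      have "(\<Sum>k=1..s-1. y k * y (s - k)) \<le> (\<Sum>k=1..s-1. (1 / 256 * K ^ s * ?f s) * (1 / ((real k)\<^sup>2 * (real (s - k))\<^sup>2)))"
      proof (rule sum_mono)
        fix k assume k: "k \<in> {1..s-1}"
        have "y k * y (s - k) \<le> (1 / 16 * K ^ k * ?f k / (real k)\<^sup>2) * (1 / 16 * K ^ (s - k) * ?f (s - k) / (real (s - k))\<^sup>2)"
          using k less.IH[of k] less.IH[of "s - k"] y0[of k] y0[of "s - k"] K by (intro mult_mono) auto
        also have "\<dots> = 1 / 256 * (K ^ k * K ^ (s - k)) * (1 / ((real k)\<^sup>2 * (real (s - k))\<^sup>2)) * (?f k * ?f (s - k))"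
          by simp
        also have "\<dots> \<le> 1 / 256 * (K ^ k * K ^ (s - k)) * (1 / ((real k)\<^sup>2 * (real (s - k))\<^sup>2)) * ?f s"
          using K k by (intro mult_left_mono fmono) auto
        also have "K ^ k * K ^ (s - k) = K ^ s" using k s unfolding power_add[symmetric] by (intro arg_cong[where f = "(^) K"]) auto
        finally show "y k * y (s - k) \<le> (1 / 256 * K ^ s * ?f s) * (1 / ((real k)\<^sup>2 * (real (s - k))\<^sup>2))"
          by (simp only: mult_ac)
      qed
      also have "\<dots> = (1 / 256 * K ^ s * ?f s) * (\<Sum>k=1..s-1. 1 / ((real k)\<^sup>2 * (real (s - k))\<^sup>2))"
        by (rule sum_distrib_left[symmetric])
      also have "\<dots> \<le> (1 / 256 * K ^ s * ?f s) * (8 / (real s)\<^sup>2)"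
        using K s by (intro mult_left_mono sum_inverse_squares_conv) auto
      finally have A: "(\<Sum>k=1..s-1. y k * y (s - k)) \<le> 1 / 32 * K ^ s * ?f s / (real s)\<^sup>2" by simp
      have "1 / (4 * sqrt pi) \<le> 1"
      proof -
        have "1 \<le> 4 * sqrt pi" using pi_ge_two real_sqrt_ge_one[of pi] by linarith
        then show ?thesis by (simp add: divide_le_eq)
      qed
      then have "1 / (4 * sqrt pi) * (\<Sum>k=1..s-1. y k * y (s - k)) \<le> 1 * (\<Sum>k=1..s-1. y k * y (s - k))"
        using y0 by (intro mult_right_mono sum_nonneg mult_nonneg_nonneg) auto
      with A have A': "1 / (4 * sqrt pi) * (\<Sum>k=1..s-1. y k * y (s - k)) \<le> 1 / 32 * K ^ s * ?f s / (real s)\<^sup>2" by simp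
      have "q s * y (s - 1) \<le> (c * real s powr \<alpha>) * (1 / 16 * K ^ (s - 1) * ?f (s - 1) / (real (s - 1))\<^sup>2)"
        using q[OF s] q0[OF s] less.IH[of "s - 1"] y0[of "s - 1"] s c by (intro mult_mono) auto
      also have "\<dots> = 1 / 16 * c * K ^ (s - 1) * (real s powr \<alpha> * ?f (s - 1)) * (1 / (real (s - 1))\<^sup>2)" by simp
      also have "real s powr \<alpha> * ?f (s - 1) = ?f s"
        using s by (subst fact_reduce[of s]) (auto simp: powr_mult)
      also have "1 / 16 * c * K ^ (s - 1) * ?f s * (1 / (real (s - 1))\<^sup>2) \<le> 1 / 16 * (K / 8) * K ^ (s - 1) * ?f s * (4 / (real s)\<^sup>2)"
      proof (intro mult_mono mult_right_mono mult_left_mono)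
        have "real s \<le> 2 * real (s - 1)" using s by simp
        then have "(real s)\<^sup>2 \<le> (2 * real (s - 1))\<^sup>2" by (intro power_mono) auto
        then have "4 / (2 * real (s - 1))\<^sup>2 \<le> 4 / (real s)\<^sup>2"
          using s by (intro divide_left_mono) auto
        then show "1 / (real (s - 1))\<^sup>2 \<le> 4 / (real s)\<^sup>2"
          by (simp only: power_mult_distrib) simp
      qed (use K c in auto)
      also have "\<dots> = 1 / 32 * (K * K ^ (s - 1)) * ?f s / (real s)\<^sup>2" by simp
      also have "K * K ^ (s - 1) = K ^ s" using s by (simp flip: power_Suc)
      finally have B': "q s * y (s - 1) \<le> 1 / 32 * K ^ s * ?f s / (real s)\<^sup>2" .
      have "y s \<le> 1 / 32 * K ^ s * ?f s / (real s)\<^sup>2 + 1 / 32 * K ^ s * ?f s / (real s)\<^sup>2"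
        unfolding rec[OF s] by (rule add_mono[OF A' B'])
      then show ?thesis by simp
    qed
  qed
  have "?m s / fact s \<le> K ^ s * ?f s / G s" if s: "s \<ge> 1" for s
  proof -
    have "y s \<le> 1 / 16 * K ^ s * ?f s / (real s)\<^sup>2" by (rule claim[OF s])
    also have "\<dots> \<le> 1 / 16 * K ^ s * ?f s / 1"
      using s K by (intro divide_left_mono) auto
    also have "\<dots> \<le> K ^ s * ?f s" using K by simp
    finally show ?thesis using G[OF s] unfolding m[OF s] by (simp add: divide_right_mono)
  qed
  moreover have "0 \<le> ?m s" if "s \<ge> 1" for s
    unfolding m[OF that] using y0[OF that] G[OF that] by simp
  ultimately show ?thesis using K(1) that unfolding G_def by blast
qed

text \<open>
  The Gamma function in the denominator gains a factor of order \<open>s powr (\<alpha> + 1/2)\<close> at each step, more than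
  the factor \<open>s powr \<alpha>\<close> of the numerator.
\<close>

theorem limit_moment_summable:
  assumes \<alpha>: "\<alpha> > 1 / 2"
  shows "summable (\<lambda>s. \<bar>t\<bar> ^ s / fact s * \<bar>limit_moment \<alpha> s\<bar>)"
proof -
  obtain K where K: "K > 0" and nn: "\<And>s. s \<ge> 1 \<Longrightarrow> 0 \<le> limit_moment \<alpha> s"
    and bound: "\<And>s. s \<ge> 1 \<Longrightarrow> limit_moment \<alpha> s / fact s \<le> K ^ s * fact s powr \<alpha> / Gamma (real s * (\<alpha> + 1 / 2) - 1 / 2)"
    using limit_moment_growth[OF \<alpha>] by blast
  define T where "T = \<bar>t\<bar> * K"
  have T: "T \<ge> 0" using K by (simp add: T_def)
  define G where "G s = Gamma (real s * (\<alpha> + 1 / 2) - 1 / 2)" for s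
  define e where "e s = T ^ s * fact s powr \<alpha> / G s" for s
  have arg: "real s * (\<alpha> + 1 / 2) - 1 / 2 > 1" if "s \<ge> 2" for s
  proof -
    have "2 < 2 * (\<alpha> + 1 / 2)" using \<alpha> by simp
    also have "\<dots> \<le> real s * (\<alpha> + 1 / 2)" using that \<alpha> by (intro mult_right_mono) auto
    finally show ?thesis by simp
  qed
  have G: "G s > 0" if "s \<ge> 2" for s
    unfolding G_def using arg[OF that] by (intro Gamma_real_pos) simp
  have ratio: "(\<lambda>s. T * (real s + 1) powr \<alpha> / (real s * (\<alpha> + 1 / 2) - 3 / 2) powr (\<alpha> + 1 / 2)) \<longlonglongrightarrow> 0"
    using \<alpha> by real_asymp
  then have "eventually (\<lambda>s. T * (real s + 1) powr \<alpha> / (real s * (\<alpha> + 1 / 2) - 3 / 2) powr (\<alpha> + 1 / 2) < 1 / 2) sequentially"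
    by (rule order_tendstoD(2)) simp
  then have "eventually (\<lambda>s. s \<ge> 2 \<and> T * (real s + 1) powr \<alpha> / (real s * (\<alpha> + 1 / 2) - 3 / 2) powr (\<alpha> + 1 / 2) < 1 / 2) sequentially"
    by (intro eventually_conj eventually_ge_at_top)
  then obtain N where N: "\<And>s. s \<ge> N \<Longrightarrow> s \<ge> 2 \<and> T * (real s + 1) powr \<alpha> / (real s * (\<alpha> + 1 / 2) - 3 / 2) powr (\<alpha> + 1 / 2) < 1 / 2"
    by (auto simp: eventually_sequentially)
  have "summable e"
  proof (rule summable_ratio_test[of "1 / 2" N])
    fix s assume s: "N \<le> s"
    let ?x = "real s * (\<alpha> + 1 / 2) - 1 / 2" and ?P = "(real s * (\<alpha> + 1 / 2) - 3 / 2) powr (\<alpha> + 1 / 2)"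
    have s2: "s \<ge> 2" using N[OF s] by simp
    have P: "?P > 0" using arg[OF s2] by simp
    have "(?x - 1) powr (\<alpha> + 1 / 2) * Gamma ?x \<le> Gamma (?x + (\<alpha> + 1 / 2))"
      by (rule Gamma_add_ge) (use arg[OF s2] \<alpha> in auto)
    moreover have "?x + (\<alpha> + 1 / 2) = real (Suc s) * (\<alpha> + 1 / 2) - 1 / 2" by (simp add: algebra_simps)
    ultimately have ge: "?P * G s \<le> G (Suc s)" by (simp add: G_def)
    have f: "fact (Suc s) powr \<alpha> = (real s + 1) powr \<alpha> * fact s powr \<alpha>"
      by (simp add: powr_mult add.commute)
    have "e (Suc s) \<le> T ^ Suc s * fact (Suc s) powr \<alpha> / (?P * G s)"
      unfolding e_def using ge G[OF s2] P T by (intro divide_left_mono mult_pos_pos G) (use s2 in auto)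
    also have "\<dots> = (T * (real s + 1) powr \<alpha> / ?P) * e s"
      unfolding f e_def by simp
    also have "\<dots> \<le> 1 / 2 * e s"
      using less_imp_le[OF conjunct2[OF N[OF s]]] T G[OF s2] by (intro mult_right_mono) (auto simp: e_def)
    finally show "norm (e (Suc s)) \<le> 1 / 2 * norm (e s)"
      using T G[OF s2] G[of "Suc s"] s2 by (simp add: e_def)
  qed simp
  then show ?thesis
  proof (rule summable_comparison_test'[where N = 1])
    fix s :: nat assume s: "1 \<le> s"
    have "\<bar>t\<bar> ^ s / fact s * limit_moment \<alpha> s = \<bar>t\<bar> ^ s * (limit_moment \<alpha> s / fact s)" by simp
    also have "\<dots> \<le> \<bar>t\<bar> ^ s * (K ^ s * fact s powr \<alpha> / G s)"
      unfolding G_def by (intro mult_left_mono bound s) simp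
    also have "\<dots> = e s" by (simp add: e_def T_def power_mult_distrib)
    finally show "norm (\<bar>t\<bar> ^ s / fact s * \<bar>limit_moment \<alpha> s\<bar>) \<le> e s"
      using nn[OF s] by simp
  qed
qed

section \<open>Rescaling\<close>

definition fps_rescale :: "real \<Rightarrow> real fps \<Rightarrow> real fps" where
  "fps_rescale \<rho> f = Abs_fps (\<lambda>n. fps_nth f n * \<rho> ^ n)"

lemma fps_rescale_nth [simp]: "fps_nth (fps_rescale \<rho> f) n = fps_nth f n * \<rho> ^ n"
  by (simp add: fps_rescale_def)

lemma fps_rescale_mult: "fps_rescale \<rho> f * fps_rescale \<rho> h = fps_rescale \<rho> (f * h)"
proof (rule fps_ext)
  fix n
  have "fps_nth (fps_rescale \<rho> f * fps_rescale \<rho> h) n =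
      (\<Sum>i=0..n. (fps_nth f i * fps_nth h (n - i)) * (\<rho> ^ i * \<rho> ^ (n - i)))"
    by (simp add: fps_mult_nth mult_ac)
  also have "\<dots> = (\<Sum>i=0..n. (fps_nth f i * fps_nth h (n - i)) * \<rho> ^ n)"
    by (intro sum.cong refl) (simp flip: power_add)
  finally show "fps_nth (fps_rescale \<rho> f * fps_rescale \<rho> h) n = fps_nth (fps_rescale \<rho> (f * h)) n"
    by (simp add: fps_mult_nth sum_distrib_right)
qed

lemma size_recurrence_rescale:
  assumes "size_recurrence b g T"
  shows "size_recurrence b g (fps_rescale \<rho> T)"
  unfolding size_recurrence_def fps_rescale_mult
proof
  fix n
  have "(real n - 1) * fps_nth T n = ((b + g) * real n - 2 * g) / 2 * fps_nth (T * T) n"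
    using assms by (simp only: size_recurrence_def)
  then show "(real n - 1) * fps_nth (fps_rescale \<rho> T) n =
      ((b + g) * real n - 2 * g) / 2 * fps_nth (fps_rescale \<rho> (T * T)) n"
    unfolding fps_rescale_nth by (metis mult.assoc)
qed

section \<open>Asymptotics of the moments\<close>

text \<open>
  The series \<open>G s\<close> stands for \<open>moment_fps \<Phi> toll s\<close> with toll \<open>n powr \<alpha>\<close>, rescaled in the same way as \<open>U\<close>.
\<close>

locale cost_series = size_series +
  fixes \<alpha> :: real and G :: "nat \<Rightarrow> real fps"
  assumes \<alpha>: "\<alpha> > 1 / 2" and G0: "G 0 = U" and G_nth_0: "\<And>s. fps_nth (G s) 0 = 0"
    and c_eq: "c = sqrt (b / (2 * pi * (b + g) ^ 3))"
    and G_rec: "\<And>n s. n \<ge> 2 \<Longrightarrow> (real n - 1) * fps_nth (G s) n =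
      ((b + g) * real n - 2 * g) / 2 * (\<Sum>i\<le>s. real (s choose i) * (real n powr \<alpha>) ^ i *
        (\<Sum>j\<le>s - i. real (s - i choose j) * fps_nth (G j * G (s - i - j)) n))"
begin

definition \<sigma> :: real where "\<sigma> = sqrt ((b + g) / b)"

lemma \<sigma>_pos: "\<sigma> > 0" using b bg by (simp add: \<sigma>_def)

text \<open>
  The moment of order \<open>m\<close> of the sum of the costs of the two parts.
\<close>

definition split_moment :: "nat \<Rightarrow> real fps" where
  "split_moment m = (\<Sum>j\<le>m. fps_const (real (m choose j)) * (G j * G (m - j)))"

lemma split_moment_nth: "fps_nth (split_moment m) n = (\<Sum>j\<le>m. real (m choose j) * fps_nth (G j * G (m - j)) n)"
  by (simp add: split_moment_def fps_sum_nth)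

text \<open>
  The part of \<open>split_moment s\<close> to which both parts of the tree contribute a positive power.
\<close>

definition inner_products :: "nat \<Rightarrow> real fps" where
  "inner_products s = (\<Sum>j=1..s-1. fps_const (real (s choose j)) * (G j * G (s - j)))"

lemma split_moment_split:
  assumes "s \<ge> 1"
  shows "split_moment s = fps_const 2 * (G s * U) + inner_products s"
proof -
  have "{..s} = insert 0 (insert s {1..s-1})" using assms by auto
  then have "split_moment s = G 0 * G s + (G s * G 0 + inner_products s)"
    unfolding split_moment_def inner_products_def using assms by (subst \<open>{..s} = _\<close>) (simp add: sum.insert_if)
  then show ?thesis by (simp add: G0 algebra_simps flip: numeral_fps_const)
qed

text \<open>
  The terms of the recurrence for \<open>G s\<close> that involve moments of lower order only.
\<close>

definition source :: "nat \<Rightarrow> real fps" where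
  "source s = Abs_fps (\<lambda>n. ((b + g) * real n - 2 * g) / 2 * (fps_nth (inner_products s) n +
     (\<Sum>i=1..s. real (s choose i) * (real n powr \<alpha>) ^ i * fps_nth (split_moment (s - i)) n)))"

lemma G_solves:
  assumes "s \<ge> 1"
  shows "solves (G s) (source s)"
  unfolding solves_def
proof (intro allI impI)
  fix n :: nat assume n: "n \<ge> 2"
  have "{..s} = insert 0 {1..s}" by auto
  then have sp: "(\<Sum>i\<le>s. f i) = f 0 + (\<Sum>i=1..s. f i)" for f :: "nat \<Rightarrow> real"
    by (simp add: sum.insert_if)
  have "(real n - 1) * fps_nth (G s) n = ((b + g) * real n - 2 * g) / 2 *
      (\<Sum>i\<le>s. real (s choose i) * (real n powr \<alpha>) ^ i * fps_nth (split_moment (s - i)) n)"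
    using G_rec[OF n, of s] by (simp add: split_moment_nth)
  also have "\<dots> = ((b + g) * real n - 2 * g) / 2 * (2 * fps_nth (G s * U) n + fps_nth (inner_products s) n +
     (\<Sum>i=1..s. real (s choose i) * (real n powr \<alpha>) ^ i * fps_nth (split_moment (s - i)) n))"
    unfolding sp by (simp add: split_moment_split[OF assms])
  also have "\<dots> = ((b + g) * real n - 2 * g) * fps_nth (G s * U) n + fps_nth (source s) n"
  proof -
    have "k / 2 * (2 * x + y + z) = k * x + k / 2 * (y + z)" for k x y z :: real
      by (simp add: field_simps)
    then show ?thesis unfolding source_def fps_nth_Abs_fps .
  qed
  finally show "(real n - 1) * fps_nth (G s) n = \<dots>" .
qed

abbreviation m :: "nat \<Rightarrow> real" where "m \<equiv> limit_moment \<alpha>"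
abbreviation \<alpha>' :: real where "\<alpha>' \<equiv> \<alpha> + 1 / 2"

lemma \<alpha>'_mult: "s \<ge> 1 \<Longrightarrow> real s * \<alpha>' > 1"
proof -
  assume "s \<ge> 1"
  then have "1 * \<alpha>' \<le> real s * \<alpha>'" using \<alpha> by (intro mult_right_mono) auto
  moreover have "1 < 1 * \<alpha>'" using \<alpha> by simp
  ultimately show "real s * \<alpha>' > 1" by (rule less_le_trans[rotated])
qed

definition moment_asymp :: "nat \<Rightarrow> bool" where
  "moment_asymp s \<longleftrightarrow> coeff_asymp (G s) (real s * \<alpha>' - 3 / 2) (c * \<sigma> ^ s * m s)"

lemma product_asymp:
  assumes "moment_asymp j" "moment_asymp k" "j \<ge> 1" "k \<ge> 1"
  shows "coeff_asymp (G j * G k) (real (j + k) * \<alpha>' - 2)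
    (c\<^sup>2 * \<sigma> ^ (j + k) * (m j * m k * (Gamma (real j * \<alpha>' - 1 / 2) * Gamma (real k * \<alpha>' - 1 / 2) /
       Gamma (real (j + k) * \<alpha>' - 1))))"
proof -
  let ?P = "real j * \<alpha>' - 1 / 2" and ?R = "real k * \<alpha>' - 1 / 2"
  have "coeff_asymp (G j * G k) (?P + ?R - 1)
      ((c * \<sigma> ^ j * m j) * (c * \<sigma> ^ k * m k) * Gamma ?P * Gamma ?R / Gamma (?P + ?R))"
  proof (intro coeff_asymp_mult)
    show "?P > 0" "?R > 0" using \<alpha>'_mult assms(3,4) by force+
    have "?P - 1 = real j * \<alpha>' - 3 / 2" "?R - 1 = real k * \<alpha>' - 3 / 2" by simp_all
    then show "coeff_asymp (G j) (?P - 1) (c * \<sigma> ^ j * m j)" "coeff_asymp (G k) (?R - 1) (c * \<sigma> ^ k * m k)"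
      using assms(1,2) by (simp_all only: moment_asymp_def)
  qed
  moreover have "?P + ?R - 1 = real (j + k) * \<alpha>' - 2" "?P + ?R = real (j + k) * \<alpha>' - 1"
    by (simp_all add: algebra_simps)
  moreover have "(c * \<sigma> ^ j * m j) * (c * \<sigma> ^ k * m k) * Gamma ?P * Gamma ?R / D =
      c\<^sup>2 * \<sigma> ^ (j + k) * (m j * m k * (Gamma ?P * Gamma ?R / D))" for D
    by (simp add: power2_eq_square power_add)
  ultimately show ?thesis by (simp only:)
qed

definition inner_const :: "nat \<Rightarrow> real" where
  "inner_const s = (\<Sum>j=1..s-1. real (s choose j) * (m j * m (s - j) *
      (Gamma (real j * \<alpha>' - 1 / 2) * Gamma (real (s - j) * \<alpha>' - 1 / 2) / Gamma (real s * \<alpha>' - 1))))"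

lemma inner_products_asymp:
  assumes "\<And>j. j < s \<Longrightarrow> moment_asymp j"
  shows "coeff_asymp (inner_products s) (real s * \<alpha>' - 2) (c\<^sup>2 * \<sigma> ^ s * inner_const s)"
proof -
  have "coeff_asymp (inner_products s) (real s * \<alpha>' - 2) (\<Sum>j=1..s-1. real (s choose j) *
    (c\<^sup>2 * \<sigma> ^ s * (m j * m (s - j) * (Gamma (real j * \<alpha>' - 1 / 2) * Gamma (real (s - j) * \<alpha>' - 1 / 2) /
       Gamma (real s * \<alpha>' - 1)))))"
    unfolding inner_products_def
  proof (intro coeff_asymp_sum coeff_asymp_cmult)
    fix j assume j: "j \<in> {1..s-1}"
    then have "j + (s - j) = s" by auto
    moreover have "moment_asymp j" "moment_asymp (s - j)" using j by (auto intro!: assms)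
    ultimately show "coeff_asymp (G j * G (s - j)) (real s * \<alpha>' - 2) (c\<^sup>2 * \<sigma> ^ s *
      (m j * m (s - j) * (Gamma (real j * \<alpha>' - 1 / 2) * Gamma (real (s - j) * \<alpha>' - 1 / 2) / Gamma (real s * \<alpha>' - 1))))"
      using product_asymp[of j "s - j"] j by auto
  qed
  then show ?thesis unfolding inner_const_def sum_distrib_left by (simp only: mult.left_commute)
qed

text \<open>
  To leading order all of the cost comes from one of the two parts while the other one stays bounded;
  the factor \<open>2 / (b + g)\<close> consists of the two choices of that part and the sum of \<open>U\<close>.
\<close>

lemma split_moment_asymp:
  assumes "\<And>j. j \<le> k \<Longrightarrow> moment_asymp j"
  shows "coeff_asymp (split_moment k) (real k * \<alpha>' - 3 / 2) (2 * c * \<sigma> ^ k * m k / (b + g))"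
proof (cases "k = 0")
  case True
  have "split_moment 0 = U * U" by (simp add: split_moment_def G0)
  then show ?thesis using True square_asymp by simp
next
  case False
  then have k: "k \<ge> 1" by simp
  have "coeff_asymp (G k) (real k * \<alpha>' - 1 / 2 - 1) (c * \<sigma> ^ k * m k)"
    using assms[of k] by (simp add: moment_asymp_def)
  then have "coeff_asymp (G k * U) (real k * \<alpha>' - 1 / 2 - 1) (c * \<sigma> ^ k * m k / (b + g))"
    using \<alpha>'_mult[OF k] by (intro mult_U_asymp) simp
  then have "coeff_asymp (fps_const 2 * (G k * U)) (real k * \<alpha>' - 3 / 2) (2 * (c * \<sigma> ^ k * m k / (b + g)))"
    by (intro coeff_asymp_cmult) simp
  moreover have "coeff_asymp (inner_products k) (real k * \<alpha>' - 3 / 2) 0"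
    by (rule coeff_asymp_negligible[OF inner_products_asymp]) (use assms in auto)
  ultimately have "coeff_asymp (split_moment k) (real k * \<alpha>' - 3 / 2) (2 * (c * \<sigma> ^ k * m k / (b + g)) + 0)"
    unfolding split_moment_split[OF k] by (rule coeff_asymp_add)
  then show ?thesis by (simp add: mult.assoc)
qed

text \<open>
  Two contributions have the order \<open>n powr (s * \<alpha>' - 1)\<close>: the products of lower moments of the two parts, and the terms
  with exactly one factor from the toll. Every further factor from the toll loses \<open>n powr (1/2)\<close>.
\<close>

lemma source_asymp:
  assumes s: "s \<ge> 1" and IH: "\<And>j. j < s \<Longrightarrow> moment_asymp j"
  shows "coeff_asymp (source s) (real s * \<alpha>' - 1)
    ((b + g) / 2 * (c\<^sup>2 * \<sigma> ^ s * inner_const s + real s * (2 * c * \<sigma> ^ (s - 1) * m (s - 1) / (b + g))))"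
proof -
  let ?d = "real s * (2 * c * \<sigma> ^ (s - 1) * m (s - 1) / (b + g))"
  let ?t = "\<lambda>i n. real (s choose i) * (real n powr \<alpha>) ^ i * fps_nth (split_moment (s - i)) n"
  define p where "p = real s * \<alpha>' - 1"
  have toll: "(\<lambda>n. ?t i n * real n powr (- (p - 1)))
      \<longlonglongrightarrow> (if i = 1 then ?d else 0)"
    if i: "i \<in> {1..s}" for i
  proof -
    have lim: "(\<lambda>n. fps_nth (split_moment (s - i)) n * real n powr (- (real (s - i) * \<alpha>' - 3 / 2))) \<longlonglongrightarrow>
        2 * c * \<sigma> ^ (s - i) * m (s - i) / (b + g)"
      unfolding coeff_asymp_def[symmetric] by (rule split_moment_asymp, rule IH) (use i in auto)
    have pw: "(\<lambda>n. real n powr (- ((real i - 1) / 2))) \<longlonglongrightarrow> (if i = 1 then 1 else 0)"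
    proof (cases "i = 1")
      case True
      have "eventually (\<lambda>n. real n powr (- ((real i - 1) / 2)) = 1) sequentially"
        using eventually_gt_at_top[of 0] by eventually_elim (simp add: True)
      then show ?thesis using True by (simp add: tendsto_eventually)
    next
      case False
      then have "(real i - 1) / 2 > 0" using i by simp
      then show ?thesis using False by simp real_asymp
    qed
    have "(\<lambda>n. real (s choose i) * (real n powr (- ((real i - 1) / 2)) *
        (fps_nth (split_moment (s - i)) n * real n powr (- (real (s - i) * \<alpha>' - 3 / 2))))) \<longlonglongrightarrow>
        real (s choose i) * ((if i = 1 then 1 else 0) * (2 * c * \<sigma> ^ (s - i) * m (s - i) / (b + g)))"
      by (intro tendsto_intros lim pw)
    moreover have "eventually (\<lambda>n. real (s choose i) * (real n powr (- ((real i - 1) / 2)) *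
        (fps_nth (split_moment (s - i)) n * real n powr (- (real (s - i) * \<alpha>' - 3 / 2)))) =
        ?t i n * real n powr (- (p - 1))) sequentially"
      using eventually_gt_at_top[of 0]
    proof eventually_elim
      case (elim n)
      have "real n powr (- ((real i - 1) / 2)) * real n powr (- (real (s - i) * \<alpha>' - 3 / 2)) =
          real n powr (real i * \<alpha> + - (p - 1))"
        unfolding powr_add[symmetric] p_def using i
        by (intro arg_cong[where f = "(powr) _"]) (simp add: of_nat_diff field_simps)
      also have "\<dots> = (real n powr \<alpha>) ^ i * real n powr (- (p - 1))"
        using elim by (simp add: powr_add powr_powr powr_realpow[symmetric] mult.commute)
      finally show ?case by (simp add: mult_ac)
    qed
    ultimately have "(\<lambda>n. ?t i n * real n powr (- (p - 1)))
      \<longlonglongrightarrow> real (s choose i) * ((if i = 1 then 1 else 0) * (2 * c * \<sigma> ^ (s - i) * m (s - i) / (b + g)))"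
      by (rule Lim_transform_eventually)
    then show ?thesis by (cases "i = 1") simp_all
  qed
  have "(\<lambda>n. \<Sum>i=1..s. ?t i n * real n powr (- (p - 1)))
      \<longlonglongrightarrow> (\<Sum>i=1..s. if i = 1 then ?d else 0)"
    by (intro tendsto_sum toll)
  also have "(\<Sum>i=1..s. if i = 1 then ?d else 0) =
      ?d"
    using s by simp
  finally have 1: "(\<lambda>n. (\<Sum>i=1..s. ?t i n) * real n powr (- (p - 1)))
      \<longlonglongrightarrow> ?d"
    by (simp only: sum_distrib_right)
  have 2: "(\<lambda>n. fps_nth (inner_products s) n * real n powr (- (p - 1))) \<longlonglongrightarrow> c\<^sup>2 * \<sigma> ^ s * inner_const s"
    using inner_products_asymp[OF IH] by (simp add: coeff_asymp_def p_def)
  have 3: "(\<lambda>n. ((b + g) * real n - 2 * g) / 2 / real n) \<longlonglongrightarrow> (b + g) / 2"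
    by real_asymp
  have "(\<lambda>n. ((b + g) * real n - 2 * g) / 2 / real n * (fps_nth (inner_products s) n * real n powr (- (p - 1)) +
      (\<Sum>i=1..s. ?t i n) * real n powr (- (p - 1))))
      \<longlonglongrightarrow> (b + g) / 2 * (c\<^sup>2 * \<sigma> ^ s * inner_const s + ?d)"
    by (intro tendsto_mult tendsto_add 1 2 3)
  moreover have "eventually (\<lambda>n. ((b + g) * real n - 2 * g) / 2 / real n * (fps_nth (inner_products s) n * real n powr (- (p - 1)) +
      (\<Sum>i=1..s. ?t i n) * real n powr (- (p - 1))) =
      fps_nth (source s) n * real n powr (- p)) sequentially"
    using eventually_gt_at_top[of 0]
  proof eventually_elim
    case (elim n)
    have "real n powr (- (p - 1)) = real n powr 1 * real n powr (- p)"
      unfolding powr_add[symmetric] by simp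
    then have e: "real n powr (- (p - 1)) = real n * real n powr (- p)" using elim by simp
    have "k / 2 / N * (x * (N * w) + y * (N * w)) = k / 2 * (x + y) * w" if "N > 0" for k N x y w :: real
      using that by (simp add: field_simps)
    from this[of "real n"] show ?case unfolding e source_def fps_nth_Abs_fps using elim by simp
  qed
  ultimately show ?thesis unfolding coeff_asymp_def p_def by (rule Lim_transform_eventually)
qed

lemma constants: "c * sqrt pi * (b + g)\<^sup>2 / b = \<sigma> / sqrt 2" "(b + g) * c * \<sigma> = 1 / sqrt (2 * pi)"
proof -
  define a where "a = b + g"
  have a: "a > 0" using bg by (simp add: a_def)
  have "b / (2 * pi * a ^ 3) = b / a / (a\<^sup>2) / (2 * pi)"
    by (simp add: power2_eq_square power3_eq_cube)
  then have "c = sqrt (b / a) / a / sqrt (2 * pi)"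
    unfolding c_eq a_def[symmetric] using a by (simp only: real_sqrt_divide) simp
  moreover have "sqrt (b / a) = 1 / \<sigma>" using a b by (simp add: \<sigma>_def a_def real_sqrt_divide)
  ultimately have c': "c = 1 / (\<sigma> * a * sqrt (2 * pi))" by simp
  then show "(b + g) * c * \<sigma> = 1 / sqrt (2 * pi)"
    using a \<sigma>_pos by (simp add: a_def[symmetric])
  have "a / b = \<sigma>\<^sup>2" using a b by (simp add: \<sigma>_def a_def)
  have "c * sqrt pi * a\<^sup>2 / b = c * sqrt pi * a * (a / b)" by (simp add: power2_eq_square)
  also have "\<dots> = c * sqrt pi * a * \<sigma>\<^sup>2" unfolding \<open>a / b = \<sigma>\<^sup>2\<close> ..
  also have "\<dots> = \<sigma> / sqrt 2"
    unfolding c' using a \<sigma>_pos by (simp add: real_sqrt_mult power2_eq_square field_simps)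
  finally show "c * sqrt pi * (b + g)\<^sup>2 / b = \<sigma> / sqrt 2" by (simp add: a_def)
qed

text \<open>
  On the left is the constant that \<open>transfer\<close> produces from \<open>source_asymp\<close>. The two terms of the recurrence
  for \<open>m s\<close> come from the two contributions to \<open>source s\<close>.
\<close>

lemma moment_rec:
  assumes s: "s \<ge> 1"
  shows "(b + g) / 2 * (c\<^sup>2 * \<sigma> ^ s * inner_const s + real s * (2 * c * \<sigma> ^ (s - 1) * m (s - 1) / (b + g))) *
      (\<sigma> / sqrt 2) * Gamma (real s * \<alpha>' - 1) / Gamma (real s * \<alpha>' - 1 / 2) = c * \<sigma> ^ s * m s"
proof -
  define A B where "A = Gamma (real s * \<alpha>' - 1)" and "B = Gamma (real s * \<alpha>' - 1 / 2)"
  define Y where "Y = (\<Sum>j=1..s-1. real (s choose j) *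
      (Gamma (real j * \<alpha>' - 1 / 2) * Gamma (real (s - j) * \<alpha>' - 1 / 2) / B) * m j * m (s - j))"
  have AB: "A > 0" "B > 0" using \<alpha>'_mult[OF s] by (auto simp: A_def B_def intro!: Gamma_real_pos)
  have XY: "inner_const s * A = Y * B"
    unfolding inner_const_def Y_def A_def[symmetric] sum_distrib_right using AB
    by (intro sum.cong refl) simp
  have rec: "m s = 1 / (4 * sqrt pi) * Y + real s * A / (sqrt 2 * B) * m (s - 1)"
    using limit_moment_rec[OF s, of \<alpha>] by (simp only: Y_def A_def B_def)
  obtain k where k: "s = Suc k" using s by (cases s) auto
  have q: "(b + g) * c * \<sigma> / (2 * sqrt 2) = 1 / (4 * sqrt pi)"
    unfolding constants(2) by (simp add: real_sqrt_mult)
  have "(b + g) / 2 * (c\<^sup>2 * \<sigma> ^ s * inner_const s + real s * (2 * c * \<sigma> ^ (s - 1) * m (s - 1) / (b + g))) * (\<sigma> / sqrt 2) * A / B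
     = c * \<sigma> ^ s * (((b + g) * c * \<sigma> / (2 * sqrt 2)) * (inner_const s * A) / B + real s * A / (sqrt 2 * B) * m (s - 1))"
  proof -
    have "(a / 2 * (c\<^sup>2 * (\<sigma> * w) * x + r * (2 * c * w * M / a))) * (\<sigma> / v) * A / B =
        c * (\<sigma> * w) * ((a * c * \<sigma> / (2 * v)) * (x * A) / B + r * A / (v * B) * M)"
      if "a > 0" "v > 0" for a w x r M v :: real
      using that AB by (simp add: field_simps power2_eq_square)
    from this[OF bg, of "sqrt 2"] show ?thesis unfolding k power_Suc diff_Suc_1 by simp
  qed
  also have "\<dots> = c * \<sigma> ^ s * (1 / (4 * sqrt pi) * Y + real s * A / (sqrt 2 * B) * m (s - 1))"
    unfolding q XY using AB by simp
  finally show ?thesis unfolding rec[symmetric] unfolding A_def B_def .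
qed

theorem G_asymp: "moment_asymp s"
proof (induction s rule: less_induct)
  case (less s)
  show ?case
  proof (cases "s = 0")
    case True
    then show ?thesis using U_asymp by (simp add: moment_asymp_def G0)
  next
    case False
    then have s: "s \<ge> 1" by simp
    let ?p = "real s * \<alpha>' - 1"
    have p: "?p > 0" using \<alpha>'_mult[OF s] by simp
    have "coeff_asymp (G s) (?p - 1 / 2) ((b + g) / 2 * (c\<^sup>2 * \<sigma> ^ s * inner_const s + real s * (2 * c * \<sigma> ^ (s - 1) * m (s - 1) / (b + g))) *
      (c * sqrt pi * (b + g)\<^sup>2 / b) * Gamma ?p / Gamma (?p + 1 / 2))"
      by (rule transfer[OF p G_solves[OF s] G_nth_0 source_asymp[OF s less]])
    moreover have "?p - 1 / 2 = real s * \<alpha>' - 3 / 2" "?p + 1 / 2 = real s * \<alpha>' - 1 / 2" by simp_all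
    ultimately show ?thesis unfolding moment_asymp_def constants(1) by (simp only: moment_rec[OF s])
  qed
qed

end

section \<open>The limit theorem\<close>

lemma finite_set_pmf_total_cost:
  assumes "very_simple \<Phi>" "n \<ge> 1"
  shows "finite (set_pmf (total_cost \<Phi> toll n))"
proof -
  have "finite (set_pmf (random_tree \<Phi> n))"
    using set_pmf_random_tree[OF assms] finite_num_nodes by (rule finite_subset)
  then show ?thesis by (simp add: total_cost_def)
qed

theorem normalized_cost_moments:
  assumes vs: "very_simple \<Phi>" and \<alpha>: "\<alpha> > 1 / 2"
  shows "(\<lambda>n. measure_pmf.expectation (normalized_cost \<Phi> \<alpha> n) (\<lambda>x. x ^ s)) \<longlonglongrightarrow> limit_moment \<alpha> s"
proof -
  obtain b g where lr: "linear_ratio \<Phi> b g" and b: "b > 0" and bg: "b + g > 0"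
    and \<Phi>: "fps_nth \<Phi> 0 = 1" "\<And>k. fps_nth \<Phi> k \<ge> 0"
    using very_simple_linear_ratio[OF vs] by blast
  define c where "c = sqrt (b / (2 * pi * (b + g) ^ 3))"
  obtain \<rho> where \<rho>: "\<rho> > 0" "coeff_asymp (Abs_fps (\<lambda>n. total_weight \<Phi> n * \<rho> ^ n)) (- 3 / 2) c"
    using total_weight_asymp[OF lr \<Phi>(1) b bg] unfolding c_def by blast
  define toll where "toll = (\<lambda>j. real j powr \<alpha>)"
  define T where "T = Abs_fps (total_weight \<Phi>)"
  define U where "U = fps_rescale \<rho> T"
  define G where "G k = fps_rescale \<rho> (moment_fps \<Phi> toll k)" for k
  have M0: "moment_fps \<Phi> toll 0 = T" by (rule fps_ext) (simp add: moment_fps_0_nth T_def)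
  interpret cost_series b g c U \<alpha> G
  proof
    show "0 < b" "0 < b + g" "0 < c" "1 / 2 < \<alpha>" using b bg \<alpha> by (simp_all add: c_def)
    show "size_recurrence b g U"
      unfolding U_def T_def by (intro size_recurrence_rescale size_recurrence_total_weight lr)
    show "fps_nth U 0 = 0" by (simp add: U_def T_def total_weight_0)
    show "0 < fps_nth U n" if "1 \<le> n" for n
      using total_weight_pos[OF vs that] \<rho>(1) by (simp add: U_def T_def)
    show "coeff_asymp U (- 3 / 2) c" using \<rho>(2) by (simp add: U_def T_def fps_rescale_def)
    show "G 0 = U" by (simp add: G_def U_def M0)
    show "fps_nth (G s) 0 = 0" for s by (simp add: G_def)
    show "c = sqrt (b / (2 * pi * (b + g) ^ 3))" by (rule c_def)
    show "(real n - 1) * fps_nth (G s) n =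
      ((b + g) * real n - 2 * g) / 2 * (\<Sum>i\<le>s. real (s choose i) * (real n powr \<alpha>) ^ i *
        (\<Sum>j\<le>s - i. real (s - i choose j) * fps_nth (G j * G (s - i - j)) n))" if "2 \<le> n" for n s
    proof -
      have "(real n - 1) * fps_nth (G s) n = ((real n - 1) * fps_nth (moment_fps \<Phi> toll s) n) * \<rho> ^ n"
        by (simp add: G_def)
      also have "\<dots> = ((b + g) * real n - 2 * g) / 2 * (\<Sum>i\<le>s. real (s choose i) * toll n ^ i *
        (\<Sum>j\<le>s - i. real (s - i choose j) * fps_nth (moment_fps \<Phi> toll j * moment_fps \<Phi> toll (s - i - j)) n)) * \<rho> ^ n"
        unfolding moment_fps_recurrence[OF lr that, of toll s] ..
      also have "\<dots> = ((b + g) * real n - 2 * g) / 2 * (\<Sum>i\<le>s. real (s choose i) * toll n ^ i *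
        (\<Sum>j\<le>s - i. real (s - i choose j) * (fps_nth (moment_fps \<Phi> toll j * moment_fps \<Phi> toll (s - i - j)) n * \<rho> ^ n)))"
        by (simp only: sum_distrib_right mult.assoc)
      finally show ?thesis by (simp add: G_def fps_rescale_mult toll_def)
    qed
  qed
  have sig: "char_sigma \<Phi> = \<sigma>" using char_tau_sigma(2)[OF lr b bg \<Phi>] by (simp add: \<sigma>_def)
  let ?\<alpha>' = "\<alpha> + 1 / 2"
  have lim: "(\<lambda>n. (1 / \<sigma> ^ s) * (fps_nth (G s) n * real n powr (- (real s * ?\<alpha>' - 3 / 2)) /
      (fps_nth U n * real n powr (- (- 3 / 2))))) \<longlonglongrightarrow> (1 / \<sigma> ^ s) * ((c * \<sigma> ^ s * limit_moment \<alpha> s) / c)"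
    by (intro tendsto_mult_left tendsto_divide G_asymp[of s, unfolded moment_asymp_def coeff_asymp_def]
        U_asymp[unfolded coeff_asymp_def]) (use c in simp)
  have "(1 / \<sigma> ^ s) * ((c * \<sigma> ^ s * limit_moment \<alpha> s) / c) = limit_moment \<alpha> s"
    using c \<sigma>_pos by simp
  moreover have "eventually (\<lambda>n. (1 / \<sigma> ^ s) * (fps_nth (G s) n * real n powr (- (real s * ?\<alpha>' - 3 / 2)) /
      (fps_nth U n * real n powr (- (- 3 / 2)))) =
      measure_pmf.expectation (normalized_cost \<Phi> \<alpha> n) (\<lambda>x. x ^ s)) sequentially"
    using eventually_ge_at_top[of 1]
  proof eventually_elim
    case (elim n)
    have "measure_pmf.expectation (normalized_cost \<Phi> \<alpha> n) (\<lambda>x. x ^ s) =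
        (inverse \<sigma> * real n powr (- ?\<alpha>')) ^ s * measure_pmf.expectation (total_cost \<Phi> toll n) (\<lambda>x. x ^ s)"
      unfolding normalized_cost_def toll_def sig by (simp add: power_mult_distrib)
    also have "measure_pmf.expectation (total_cost \<Phi> toll n) (\<lambda>x. x ^ s) =
        fps_nth (moment_fps \<Phi> toll s) n / total_weight \<Phi> n"
      by (rule expectation_total_cost[OF vs elim])
    also have "\<dots> = fps_nth (G s) n / fps_nth U n"
      using \<rho>(1) by (simp add: G_def U_def T_def)
    also have "(inverse \<sigma> * real n powr (- ?\<alpha>')) ^ s = 1 / \<sigma> ^ s * real n powr (- (real s * ?\<alpha>'))"
    proof -
      have "(real n powr (- ?\<alpha>')) ^ s = real n powr (real s * - ?\<alpha>')"
        by (rule powr_power) (use elim in simp)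
      then show ?thesis
        unfolding power_mult_distrib power_inverse divide_inverse mult_minus_right by (simp only: mult_1)
    qed
    also have "real n powr (- (real s * ?\<alpha>')) = real n powr (- (real s * ?\<alpha>' - 3 / 2)) / real n powr (- (- 3 / 2))"
      unfolding powr_diff[symmetric] by simp
    finally show ?case by (simp add: mult_ac)
  qed
  ultimately show ?thesis using lim by (simp add: tendsto_cong)
qed

lemma weak_conv_m_Suc: "weak_conv_m (\<lambda>n. \<mu> (Suc n)) M \<Longrightarrow> weak_conv_m \<mu> M"
  unfolding weak_conv_m_def weak_conv_def by (auto intro: LIMSEQ_imp_Suc)

theorem theorem4p4:
  fixes \<Phi> :: "real fps" and \<alpha> :: real
  assumes "very_simple \<Phi>" and "\<alpha> > 1 / 2"
  shows "\<exists>M. has_limit_moments \<alpha> M \<and> (\<forall>N. has_limit_moments \<alpha> N \<longrightarrow> N = M) \<and>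
             weak_conv_m (\<lambda>n. distr (measure_pmf (normalized_cost \<Phi> \<alpha> n)) borel (\<lambda>x. x)) M \<and>
             (\<forall>s\<ge>1. (\<lambda>n. measure_pmf.expectation (normalized_cost \<Phi> \<alpha> n) (\<lambda>x. x ^ s))
                      \<longlonglongrightarrow> (LINT x|M. x ^ s))"
proof -
  let ?\<mu> = "\<lambda>n. distr (measure_pmf (normalized_cost \<Phi> \<alpha> n)) borel (\<lambda>x. x)"
  have rd: "real_distribution (?\<mu> n)" for n
    unfolding real_distribution_def real_distribution_axioms_def
    by (auto intro!: measure_pmf.prob_space_distr)
  have E: "(LINT x|?\<mu> n. x ^ k) = measure_pmf.expectation (normalized_cost \<Phi> \<alpha> n) (\<lambda>x. x ^ k)" for n k
    by (rule integral_distr) auto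
  \<comment> \<open>There is no tree of size \<open>0\<close>, and \<open>?\<mu> 0\<close> is an arbitrary distribution; hence the shift of the index.\<close>
  have int: "integrable (?\<mu> (Suc n)) (\<lambda>x. x ^ k)" for n k
  proof -
    have "finite (set_pmf (normalized_cost \<Phi> \<alpha> (Suc n)))"
      unfolding normalized_cost_def using finite_set_pmf_total_cost[OF assms(1)] by simp
    then show ?thesis by (subst integrable_distr_eq) (auto intro: integrable_measure_pmf_finite)
  qed
  have lim: "(\<lambda>n. LINT x|?\<mu> n. x ^ k) \<longlonglongrightarrow> limit_moment \<alpha> k" for k
    unfolding E by (rule normalized_cost_moments[OF assms])
  note sm = limit_moment_summable[OF assms(2)]
  obtain M where M: "real_distribution M" "weak_conv_m (\<lambda>n. ?\<mu> (Suc n)) M"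
    "\<And>k. integrable M (\<lambda>x. x ^ k)" "\<And>k. (LINT x|M. x ^ k) = limit_moment \<alpha> k"
    using method_of_moments[of "\<lambda>n. ?\<mu> (Suc n)" "limit_moment \<alpha>"] rd int sm LIMSEQ_Suc[OF lim] by blast
  show ?thesis
  proof (intro exI[of _ M] conjI allI impI)
    show "has_limit_moments \<alpha> M" using M by (simp add: has_limit_moments_def)
    show "weak_conv_m ?\<mu> M" using M(2) by (rule weak_conv_m_Suc)
    show "(\<lambda>n. measure_pmf.expectation (normalized_cost \<Phi> \<alpha> n) (\<lambda>x. x ^ s)) \<longlonglongrightarrow> (LINT x|M. x ^ s)" for s
      unfolding M(4) by (rule normalized_cost_moments[OF assms])
    fix N assume N: "has_limit_moments \<alpha> N"
    then interpret N: real_distribution N by (simp add: has_limit_moments_def)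
    have "integrable N (\<lambda>x. x ^ k) \<and> (LINT x|N. x ^ k) = limit_moment \<alpha> k" for k
      using N N.prob_space by (cases "k = 0") (auto simp: has_limit_moments_def)
    then show "N = M"
      by (intro moments_determine_distribution[of N "limit_moment \<alpha>" M] M sm N.real_distribution_axioms) auto
  qed
qed

end
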